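(* For every positive integer $c$, the Normal Identity Problem and the Bi-Order Extension Problem are decidable for any finitely generated free nilpotent group of class $c$.
   Context: Let $G$ be a group with identity element $e_G$. For $S\subseteq G$, $S^\circ$ denotes the normal subsemigroup of $G$ generated by $S$, i.e. the smallest subsemigroup $P\supseteq S$ of $G$ such that $a\in P$, $b\in G$ implies $bab^{-1}\in P$. The Normal Identity Problem for $G$ asks, given a finite $S\subseteq G$, whether $e_G\in S^\circ$. A bi-order on $G$ is a total order $\le$ on $G$ such that $a\le b$ implies $cad\le cbd$ for all $a,b,c,d\in G$; its positive cone is $\{a\in G\mid e_G<a\}$. The Bi-Order Extension Problem for $G$ asks, given a finite $S\subseteq G$, whether $S$ is contained in the positive cone of some bi-order on $G$. A free nilpotent group of class $c$ is a (relatively) free group of the variety of groups that are nilpotent of class (at most) $c$; elements of $G$ are given as words over a fixed finite free generating set and its inverses. *)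

theory Defs
  imports
    "HOL-Algebra.Generated_Groups"
    "HOL-Algebra.Weak_Morphisms"
    "HOL-Library.Nat_Bijection"
    "HOL-Library.Countable_Set"
begin

section \<open>Decidable sets of natural numbers\<close>

text \<open>Programs for the partial recursive functions, with a big-step semantics on argument
  lists.  In a primitive recursion the recursion variable is the first argument and \<open>g\<close>
  receives the predecessor, the previous value and the parameters; \<open>Mu\<close> is unbounded search,
  defined only if all earlier values exist.\<close>

datatype recf =
    Zero
  | Succ
  | Proj nat
  | Comp recf "recf list"
  | PrimRec recf recf
  | Mu recf

inductive recf_eval :: "recf \<Rightarrow> nat list \<Rightarrow> nat \<Rightarrow> bool" where
  Zero: "recf_eval Zero xs 0"
| Succ: "recf_eval Succ [x] (Suc x)"
| Proj: "i < length xs \<Longrightarrow> recf_eval (Proj i) xs (xs ! i)"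
| Comp: "length gs = length ys \<Longrightarrow> (\<And>i. i < length gs \<Longrightarrow> recf_eval (gs ! i) xs (ys ! i)) \<Longrightarrow>
    recf_eval f ys z \<Longrightarrow> recf_eval (Comp f gs) xs z"
| PrimRec_0: "recf_eval f xs y \<Longrightarrow> recf_eval (PrimRec f g) (0 # xs) y"
| PrimRec_Suc: "recf_eval (PrimRec f g) (n # xs) y \<Longrightarrow> recf_eval g (n # y # xs) z \<Longrightarrow>
    recf_eval (PrimRec f g) (Suc n # xs) z"
| Mu: "recf_eval f (n # xs) 0 \<Longrightarrow> (\<And>m. m < n \<Longrightarrow> \<exists>y>0. recf_eval f (m # xs) y) \<Longrightarrow>
    recf_eval (Mu f) xs n"

lemma recf_eval_deterministic:
  "recf_eval f xs y \<Longrightarrow> recf_eval f xs z \<Longrightarrow> y = z"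
proof (induction f xs y arbitrary: z rule: recf_eval.induct)
  case (Zero xs)
  from Zero.prems show ?case by cases simp_all
next
  case (Succ x)
  from Succ.prems show ?case by cases simp_all
next
  case (Proj i xs)
  from Proj.prems show ?case by cases simp_all
next
  case (Comp gs ys xs f y)
  from Comp.prems obtain zs where zs: "length gs = length zs"
    "\<And>i. i < length gs \<Longrightarrow> recf_eval (gs ! i) xs (zs ! i)" "recf_eval f zs z"
    by cases auto
  have "ys = zs"
  proof (rule nth_equalityI)
    show "length ys = length zs" using Comp.hyps(1) zs(1) by simp
    show "ys ! i = zs ! i" if "i < length ys" for i
      using Comp.IH(1)[of i "zs ! i"] zs(2)[of i] that Comp.hyps(1) by simp
  qed
  then show ?case using Comp.IH(2) zs(3) by simp
next
  case (PrimRec_0 f xs y g)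
  from PrimRec_0.prems have "recf_eval f xs z" by cases simp_all
  then show ?case by (rule PrimRec_0.IH)
next
  case (PrimRec_Suc f g n xs y z')
  from PrimRec_Suc.prems obtain y' where
    y': "recf_eval (PrimRec f g) (n # xs) y'" "recf_eval g (n # y' # xs) z"
    by cases auto
  have "y = y'" using y'(1) by (rule PrimRec_Suc.IH(1))
  then show ?case using y'(2) PrimRec_Suc.IH(2) by simp
next
  case (Mu f n xs)
  from Mu.prems have z: "recf_eval f (z # xs) 0" "\<And>m. m < z \<Longrightarrow> \<exists>y>0. recf_eval f (m # xs) y"
    by (cases, blast)+
  have "\<not> z < n"
  proof
    assume "z < n"
    then obtain y where "y > 0" "\<And>v. recf_eval f (z # xs) v \<Longrightarrow> y = v"
      using Mu.IH(2) by blast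
    then show False using z(1) by fastforce
  qed
  moreover have "\<not> n < z"
  proof
    assume "n < z"
    then obtain y where "y > 0" "recf_eval f (n # xs) y" using z(2) by blast
    then show False using Mu.IH(1) by fastforce
  qed
  ultimately show ?case by simp
qed

definition decidable_set :: "nat set \<Rightarrow> bool" where
  "decidable_set A \<longleftrightarrow> (\<exists>f. \<forall>n. recf_eval f [n] (if n \<in> A then 1 else 0))"


section \<open>Nilpotent groups and relatively free nilpotent groups\<close>

text \<open>The indexing is shifted by one: \<open>lower_central G n\<close> is the term usually written
  \<open>\<gamma>\<close> with index \<open>n + 1\<close>.\<close>

primrec lower_central :: "('a, 'b) monoid_scheme \<Rightarrow> nat \<Rightarrow> 'a set" where
  "lower_central G 0 = carrier G"
| "lower_central G (Suc n) = generate G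
    {a \<otimes>\<^bsub>G\<^esub> b \<otimes>\<^bsub>G\<^esub> inv\<^bsub>G\<^esub> a \<otimes>\<^bsub>G\<^esub> inv\<^bsub>G\<^esub> b | a b. a \<in> lower_central G n \<and> b \<in> carrier G}"

definition nilpotent_group :: "nat \<Rightarrow> ('a, 'b) monoid_scheme \<Rightarrow> bool" where
  "nilpotent_group c G \<longleftrightarrow> group G \<and> lower_central G c = {\<one>\<^bsub>G\<^esub>}"

text \<open>\<open>G\<close> is relatively free on the finite set \<open>X\<close> in the variety of groups of nilpotency class
  at most \<open>c\<close>.  The target groups in the universal property have their carriers inside the
  type of natural numbers.  This is no restriction, since only the subgroup generated by the
  finitely many images matters and that subgroup is countable; \<open>free_nilpotent_group_extend\<close>
  below gives the property for target groups over an arbitrary type.\<close>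

definition free_nilpotent_group :: "nat \<Rightarrow> ('a, 'b) monoid_scheme \<Rightarrow> 'a set \<Rightarrow> bool" where
  "free_nilpotent_group c G X \<longleftrightarrow>
     nilpotent_group c G \<and> finite X \<and> X \<subseteq> carrier G \<and> generate G X = carrier G \<and>
     (\<forall>(H :: nat monoid) y. nilpotent_group c H \<and> y \<in> X \<rightarrow> carrier H \<longrightarrow>
        (\<exists>h \<in> hom G H. \<forall>x\<in>X. h x = y x))"


section \<open>Words\<close>

text \<open>The letter \<open>Inl i\<close> stands for the \<open>i\<close>-th generator, \<open>Inr i\<close> for its inverse.\<close>

type_synonym group_word = "(nat + nat) list"

definition words_over :: "nat \<Rightarrow> group_word set" where
  "words_over r = lists ({..<r} <+> {..<r})"

primrec letter_value :: "('a, 'b) monoid_scheme \<Rightarrow> 'a list \<Rightarrow> nat + nat \<Rightarrow> 'a" where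
  "letter_value G xs (Inl i) = xs ! i"
| "letter_value G xs (Inr i) = inv\<^bsub>G\<^esub> (xs ! i)"

definition word_value :: "('a, 'b) monoid_scheme \<Rightarrow> 'a list \<Rightarrow> group_word \<Rightarrow> 'a" where
  "word_value G xs w = foldr (\<lambda>l a. letter_value G xs l \<otimes>\<^bsub>G\<^esub> a) w \<one>\<^bsub>G\<^esub>"

text \<open>A finite subset of \<open>G\<close> is presented by a list of words whose values are its elements.\<close>

definition instance_code :: "group_word list \<Rightarrow> nat" where
  "instance_code ws = list_encode (map (\<lambda>w. list_encode (map sum_encode w)) ws)"

lemma inj_instance_code: "inj instance_code"
proof (rule injI)
  fix ws vs assume "instance_code ws = instance_code vs"
  then have "map (\<lambda>w. list_encode (map sum_encode w)) ws =
      map (\<lambda>w. list_encode (map sum_encode w)) vs"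
    by (simp add: instance_code_def inj_list_encode[THEN inj_eq])
  moreover have "inj (\<lambda>w. list_encode (map sum_encode w))"
    by (intro injI) (simp add: inj_list_encode[THEN inj_eq] inj_map_eq_map inj_sum_encode)
  ultimately show "ws = vs" by (simp add: inj_map_eq_map)
qed


section \<open>The two decision problems\<close>

inductive_set normal_subsemigroup :: "('a, 'b) monoid_scheme \<Rightarrow> 'a set \<Rightarrow> 'a set"
  for G and S where
  incl: "a \<in> S \<Longrightarrow> a \<in> normal_subsemigroup G S"
| mult: "a \<in> normal_subsemigroup G S \<Longrightarrow> b \<in> normal_subsemigroup G S \<Longrightarrow>
    a \<otimes>\<^bsub>G\<^esub> b \<in> normal_subsemigroup G S"
| conj: "a \<in> normal_subsemigroup G S \<Longrightarrow> b \<in> carrier G \<Longrightarrow>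
    b \<otimes>\<^bsub>G\<^esub> a \<otimes>\<^bsub>G\<^esub> inv\<^bsub>G\<^esub> b \<in> normal_subsemigroup G S"

definition bi_order :: "('a, 'b) monoid_scheme \<Rightarrow> 'a rel \<Rightarrow> bool" where
  "bi_order G R \<longleftrightarrow> linear_order_on (carrier G) R \<and>
     (\<forall>a\<in>carrier G. \<forall>b\<in>carrier G. \<forall>c\<in>carrier G. \<forall>d\<in>carrier G.
        (a, b) \<in> R \<longrightarrow> (c \<otimes>\<^bsub>G\<^esub> a \<otimes>\<^bsub>G\<^esub> d, c \<otimes>\<^bsub>G\<^esub> b \<otimes>\<^bsub>G\<^esub> d) \<in> R)"

definition positive_cone :: "('a, 'b) monoid_scheme \<Rightarrow> 'a rel \<Rightarrow> 'a set" where
  "positive_cone G R = {a \<in> carrier G. (\<one>\<^bsub>G\<^esub>, a) \<in> R \<and> a \<noteq> \<one>\<^bsub>G\<^esub>}"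

text \<open>Each problem is the set of codes of its yes-instances, for the group \<open>G\<close> with the fixed
  list \<open>xs\<close> of generators.\<close>

definition normal_identity_problem :: "('a, 'b) monoid_scheme \<Rightarrow> 'a list \<Rightarrow> nat set" where
  "normal_identity_problem G xs =
     {instance_code ws | ws. set ws \<subseteq> words_over (length xs) \<and>
        \<one>\<^bsub>G\<^esub> \<in> normal_subsemigroup G (word_value G xs ` set ws)}"

definition bi_order_extension_problem :: "('a, 'b) monoid_scheme \<Rightarrow> 'a list \<Rightarrow> nat set" where
  "bi_order_extension_problem G xs =
     {instance_code ws | ws. set ws \<subseteq> words_over (length xs) \<and>
        (\<exists>R. bi_order G R \<and> word_value G xs ` set ws \<subseteq> positive_cone G R)}"


section \<open>The universal property for target groups over an arbitrary type\<close>

lemma (in group) lower_central_subset: "lower_central G n \<subseteq> carrier G"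
proof (induction n)
  case (Suc n)
  then show ?case by (auto intro!: generate_incl)
qed simp

lemma (in group) lower_central_subgroup_mono:
  assumes "subgroup K G"
  shows "lower_central (G\<lparr>carrier := K\<rparr>) n \<subseteq> lower_central G n"
proof (induction n)
  case 0
  then show ?case using assms by (simp add: subgroup.subset)
next
  case (Suc n)
  let ?K = "G\<lparr>carrier := K\<rparr>"
  interpret K: group ?K using assms by (rule subgroup.subgroup_is_group) (rule is_group)
  let ?C = "{a \<otimes>\<^bsub>?K\<^esub> b \<otimes>\<^bsub>?K\<^esub> inv\<^bsub>?K\<^esub> a \<otimes>\<^bsub>?K\<^esub> inv\<^bsub>?K\<^esub> b | a b. a \<in> lower_central ?K n \<and> b \<in> carrier ?K}"
  let ?D = "{a \<otimes> b \<otimes> inv a \<otimes> inv b | a b. a \<in> lower_central G n \<and> b \<in> carrier G}"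
  have CK: "?C \<subseteq> K"
    using K.lower_central_subset[of n] K.m_closed K.inv_closed by fastforce
  have "?C \<subseteq> ?D"
  proof
    fix z assume "z \<in> ?C"
    then obtain a b where ab: "a \<in> lower_central ?K n" "b \<in> K"
      "z = a \<otimes> b \<otimes> inv\<^bsub>?K\<^esub> a \<otimes> inv\<^bsub>?K\<^esub> b" by auto
    moreover have "a \<in> K" using ab(1) K.lower_central_subset[of n] by auto
    ultimately have "z = a \<otimes> b \<otimes> inv a \<otimes> inv b"
      using m_inv_consistent[OF assms] by simp
    moreover have "b \<in> carrier G" using ab(2) assms subgroup.subset by blast
    ultimately show "z \<in> ?D" using ab(1) Suc.IH by blast
  qed
  then have "generate G ?C \<subseteq> generate G ?D" by (rule mono_generate)
  moreover have "generate G ?C = generate ?K ?C"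
    using generate_consistent[OF CK assms] by simp
  ultimately show ?case by simp
qed

lemma (in group_hom) lower_central_image:
  assumes "h ` carrier G = carrier H"
  shows "lower_central H n = h ` lower_central G n"
proof (induction n)
  case (Suc n)
  let ?C = "{a \<otimes> b \<otimes> inv a \<otimes> inv b | a b. a \<in> lower_central G n \<and> b \<in> carrier G}"
  let ?D = "{a \<otimes>\<^bsub>H\<^esub> b \<otimes>\<^bsub>H\<^esub> inv\<^bsub>H\<^esub> a \<otimes>\<^bsub>H\<^esub> inv\<^bsub>H\<^esub> b | a b. a \<in> lower_central H n \<and> b \<in> carrier H}"
  have sub: "lower_central G n \<subseteq> carrier G" by (rule G.lower_central_subset)
  have eq: "h (a \<otimes> b \<otimes> inv a \<otimes> inv b) = h a \<otimes>\<^bsub>H\<^esub> h b \<otimes>\<^bsub>H\<^esub> inv\<^bsub>H\<^esub> h a \<otimes>\<^bsub>H\<^esub> inv\<^bsub>H\<^esub> h b"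
    if "a \<in> lower_central G n" "b \<in> carrier G" for a b
    using that sub by (simp add: subset_iff)
  have "?D = h ` ?C"
  proof (intro equalityI subsetI)
    fix z assume "z \<in> ?D"
    then obtain a b where ab: "a \<in> lower_central G n" "b \<in> carrier G"
      "z = h a \<otimes>\<^bsub>H\<^esub> h b \<otimes>\<^bsub>H\<^esub> inv\<^bsub>H\<^esub> h a \<otimes>\<^bsub>H\<^esub> inv\<^bsub>H\<^esub> h b"
      unfolding Suc.IH assms[symmetric] by blast
    then have "z = h (a \<otimes> b \<otimes> inv a \<otimes> inv b)" using eq[OF ab(1,2)] by simp
    then show "z \<in> h ` ?C" using ab(1,2) by blast
  next
    fix z assume "z \<in> h ` ?C"
    then obtain a b where ab: "a \<in> lower_central G n" "b \<in> carrier G"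
      "z = h (a \<otimes> b \<otimes> inv a \<otimes> inv b)" by blast
    moreover have "h a \<in> lower_central H n" "h b \<in> carrier H"
      using ab Suc.IH by auto
    ultimately show "z \<in> ?D" using eq[OF ab(1,2)] by blast
  qed
  moreover have "?C \<subseteq> carrier G" using sub by blast
  ultimately show ?case using generate_img[of ?C] by simp
qed (simp add: assms)

lemma (in group) countable_generate:
  assumes "X \<subseteq> carrier G" "finite X"
  shows "countable (generate G X)"
proof -
  let ?L = "X \<union> m_inv G ` X"
  let ?v = "\<lambda>l. foldr (\<otimes>) l \<one>"
  have L: "?L \<subseteq> carrier G" using assms(1) by auto
  have closed: "?v l \<in> carrier G" if "l \<in> lists ?L" for l
    using that L by (induction l) (auto simp: subset_iff)
  have append: "?v (l @ l') = ?v l \<otimes> ?v l'" if "l \<in> lists ?L" "l' \<in> lists ?L" for l l'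
    using that(1)
  proof (induction l)
    case Nil
    then show ?case using closed[OF that(2)] by simp
  next
    case (Cons a l)
    then have "a \<in> carrier G" using L by auto
    then show ?case using Cons closed[of l] closed[OF that(2)] by (simp add: m_assoc)
  qed
  have "z \<in> ?v ` lists ?L" if "z \<in> generate G X" for z
    using that
  proof (induction rule: generate.induct)
    case one
    then show ?case by (intro image_eqI[of _ _ "[]"]) auto
  next
    case (incl x)
    then show ?case using assms(1) by (intro image_eqI[of _ _ "[x]"]) auto
  next
    case (inv x)
    then show ?case using assms(1) by (intro image_eqI[of _ _ "[inv x]"]) auto
  next
    case (eng x1 x2)
    then obtain l l' where l: "l \<in> lists ?L" "l' \<in> lists ?L" "x1 = ?v l" "x2 = ?v l'"
      by blast
    then show ?case using append[OF l(1,2)] by (intro image_eqI[of _ _ "l @ l'"]) auto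
  qed
  then have "generate G X \<subseteq> ?v ` lists ?L" by blast
  moreover have "countable (?v ` lists ?L)"
    using assms(2) by (intro countable_image countable_lists countable_finite) auto
  ultimately show ?thesis by (rule countable_subset)
qed

theorem free_nilpotent_group_extend:
  fixes H :: "('h, 'k) monoid_scheme"
  assumes free: "free_nilpotent_group c G X" and H: "nilpotent_group c H"
    and y: "y \<in> X \<rightarrow> carrier H"
  shows "\<exists>h \<in> hom G H. \<forall>x\<in>X. h x = y x"
proof -
  interpret H: group H using H by (simp add: nilpotent_group_def)
  have yX: "y ` X \<subseteq> carrier H" using y by blast
  define K where "K = generate H (y ` X)"
  have K: "subgroup K H" unfolding K_def by (rule H.generate_is_subgroup[OF yX])
  let ?K = "H\<lparr>carrier := K\<rparr>"
  interpret K: group ?K using K by (rule subgroup.subgroup_is_group) (rule H.is_group)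
  have "finite X" using free by (simp add: free_nilpotent_group_def)
  then have "countable K" unfolding K_def using yX by (intro H.countable_generate) auto
  then obtain f :: "'h \<Rightarrow> nat" where f: "inj_on f K" by (rule countableE)
  define N where "N = image_group f ?K"
  have fiso: "f \<in> iso ?K N"
    unfolding N_def using f by (intro inj_imp_image_group_iso) simp
  have N: "group N"
    unfolding N_def using f by (intro K.inj_imp_image_group_is_group) simp
  have fhom: "group_hom ?K N f"
    using fiso N K.is_group by (auto simp: group_hom_def group_hom_axioms_def iso_def)
  have bij: "bij_betw f (carrier ?K) (carrier N)" using fiso by (simp add: iso_def)
  have "lower_central ?K c \<subseteq> {\<one>\<^bsub>H\<^esub>}"
    using H.lower_central_subgroup_mono[OF K, of c] H by (simp add: nilpotent_group_def)
  moreover have "lower_central N c = f ` lower_central ?K c"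
    using group_hom.lower_central_image[OF fhom] bij by (simp add: bij_betw_def)
  moreover have "f \<one>\<^bsub>H\<^esub> = \<one>\<^bsub>N\<^esub>" using group_hom.hom_one[OF fhom] by simp
  moreover have "\<one>\<^bsub>N\<^esub> \<in> lower_central N c"
    by (cases c) (auto intro: generate.one simp: group.is_monoid[OF N] monoid.one_closed)
  ultimately have "nilpotent_group c N" using N by (auto simp: nilpotent_group_def)
  moreover have "f \<circ> y \<in> X \<rightarrow> carrier N"
    using bij generate.incl[of _ "y ` X" H] by (fastforce simp: K_def bij_betw_def)
  ultimately obtain g where g: "g \<in> hom G N" "\<forall>x\<in>X. g x = (f \<circ> y) x"
    using free unfolding free_nilpotent_group_def by metis
  define k where "k = inv_into (carrier ?K) f"
  have "k \<in> hom N ?K"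
    using K.iso_set_sym[OF fiso] by (simp add: k_def iso_def)
  then have "k \<circ> g \<in> hom G ?K" using g(1) by (rule hom_compose[rotated])
  then have "k \<circ> g \<in> hom G H"
    using subgroup.subset[OF K] by (auto simp: hom_def)
  moreover have "(k \<circ> g) x = y x" if "x \<in> X" for x
    using that g(2) f by (simp add: k_def inv_into_f_f K_def generate.incl)
  ultimately show ?thesis by blast
qed

end

(* A finitely generated nilpotent group G has a central series with cyclic factors, and normal forms
   along it make G computable. Membership of the identity in the normal subsemigroup generated by S
   is visibly semidecidable. For the complement: if the identity is not in it, then there is a central
   series with cyclic factors such that each s in S is, up to the lower terms, a positive power of the
   generator of an infinite factor; conversely such a series defines an invariant cone containing S.
   It is built downwards. Let N be the normal closure of S. By Stiemke's alternative, either
   N/[N,G] has a nonzero functional that is nonnegative on S, and one continues with its kernel, or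
   a product of positive powers of all elements of S lies in [N,G], and then nilpotency puts the
   identity into the normal subsemigroup. That a factor of a given series is infinite is certified
   through the Hirsch length, which is a constant of G: it suffices to show that enough other factors
   are finite. So both the problem and its complement are semidecidable.
   If G has torsion, no bi-order exists; otherwise, by Malcev, every invariant cone extends to a
   bi-order, because a maximal one is total (downward induction along the lower central series). *)

theory Submission
  imports Defs
begin

section \<open>Computable functions\<close>

text \<open>The subgroups in play are known through generators, and membership in them is used only
  in its semidecidable form, by listing words. That a power lies in a subgroup can thus be
  certified, but not that it stays outside, and the infinite order of a factor is a statement of the
  second kind; hence the count of finite factors against a fixed total. That total, the orders of
  the factors of one fixed series and the codes of finitely many elements enter the programs as
  constants that need only exist.

  What carries a positive relation from N/[N,G] into N is conjugation. If n and its inverse agree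
  with elements of the semigroup modulo a suitable term of a central filtration, then conjugating
  the first by powers of g and multiplying by the second produces all integer powers of the
  commutator of n and g, up to one fixed factor. Powers of both signs force a whole layer into the
  semigroup modulo the next term, and there are finitely many layers. The functionals live on
  N/[N,G], not on N modulo its own commutators, because positivity must survive conjugation by all
  of G.\<close>

definition list_computable :: "nat \<Rightarrow> (nat list \<Rightarrow> nat) \<Rightarrow> bool" where
  "list_computable k F \<longleftrightarrow> (\<exists>r. \<forall>xs. length xs = k \<longrightarrow> recf_eval r xs (F xs))"

lemma list_computable_cong:
  assumes "list_computable k F" "\<And>xs. length xs = k \<Longrightarrow> F xs = F' xs"
  shows "list_computable k F'"
  using assms unfolding list_computable_def by metis

lemma list_computable_proj: "i < k \<Longrightarrow> list_computable k (\<lambda>xs. xs ! i)"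
  unfolding list_computable_def using recf_eval.Proj by metis

lemma list_computable_comp:
  assumes F: "list_computable (length Gs) F" and Gs: "\<And>G. G \<in> set Gs \<Longrightarrow> list_computable k G"
  shows "list_computable k (\<lambda>xs. F (map (\<lambda>G. G xs) Gs))"
proof -
  obtain f where f: "\<And>xs. length xs = length Gs \<Longrightarrow> recf_eval f xs (F xs)"
    using F unfolding list_computable_def by blast
  from Gs have "\<forall>G\<in>set Gs. \<exists>r. \<forall>xs. length xs = k \<longrightarrow> recf_eval r xs (G xs)"
    unfolding list_computable_def by blast
  then obtain R where R: "\<And>G xs. G \<in> set Gs \<Longrightarrow> length xs = k \<Longrightarrow> recf_eval (R G) xs (G xs)"
    by metis
  have "recf_eval (Comp f (map R Gs)) xs (F (map (\<lambda>G. G xs) Gs))" if "length xs = k" for xs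
    by (rule recf_eval.Comp[where ys = "map (\<lambda>G. G xs) Gs"]) (use that f R in auto)
  then show ?thesis unfolding list_computable_def by blast
qed

lemma list_computable_comp1:
  assumes "list_computable 1 (\<lambda>xs. f (xs ! 0))" "list_computable k a"
  shows "list_computable k (\<lambda>xs. f (a xs))"
  using list_computable_comp[of "[a]" "\<lambda>xs. f (xs ! 0)" k] assms by simp

lemma list_computable_comp2:
  assumes "list_computable 2 (\<lambda>xs. f (xs ! 0) (xs ! 1))" "list_computable k a" "list_computable k b"
  shows "list_computable k (\<lambda>xs. f (a xs) (b xs))"
  using list_computable_comp[of "[a, b]" "\<lambda>xs. f (xs ! 0) (xs ! 1)" k] assms
  by (auto simp: numeral_2_eq_2)

lemma list_computable_Suc: "list_computable k a \<Longrightarrow> list_computable k (\<lambda>xs. Suc (a xs))"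
proof (rule list_computable_comp1[where f = Suc])
  have "recf_eval Succ xs (Suc (xs ! 0))" if "length xs = 1" for xs
    using that recf_eval.Succ[of "xs ! 0"] by (cases xs) auto
  then show "list_computable 1 (\<lambda>xs. Suc (xs ! 0))"
    unfolding list_computable_def by blast
qed

lemma list_computable_const: "list_computable k (\<lambda>_. n)"
proof (induction n)
  case 0
  then show ?case unfolding list_computable_def using recf_eval.Zero by blast
next
  case (Suc n)
  then show ?case by (rule list_computable_Suc)
qed

text \<open>\<open>PrimRec\<close> recurses on its first argument, whereas here the bound
  \<open>a\<close> and the start value \<open>b\<close> may be any computable functions of the
  parameters; the arithmetic functions below are obtained in this shape.\<close>

lemma list_computable_rec:
  assumes "list_computable k a" "list_computable k b" "list_computable (Suc (Suc k)) G"
  shows "list_computable k (\<lambda>xs. rec_nat (b xs) (\<lambda>n y. G (n # y # xs)) (a xs))"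
proof -
  obtain f g where f: "\<And>xs. length xs = k \<Longrightarrow> recf_eval f xs (b xs)"
    and g: "\<And>xs. length xs = Suc (Suc k) \<Longrightarrow> recf_eval g xs (G xs)"
    using assms(2,3) unfolding list_computable_def by blast
  have *: "recf_eval (PrimRec f g) (n # xs) (rec_nat (b xs) (\<lambda>n y. G (n # y # xs)) n)"
    if "length xs = k" for n xs
  proof (induction n)
    case 0
    then show ?case using f that by (auto intro: recf_eval.PrimRec_0)
  next
    case (Suc n)
    then show ?case using g that by (auto intro: recf_eval.PrimRec_Suc)
  qed
  \<comment> \<open>\<open>H\<close> is the bare recursion with its argument in head position;
    composing it with \<open>a\<close> and the projections in \<open>Gs\<close> feeds it the list
    \<open>a xs # xs\<close>.\<close>
  define H where "H = (\<lambda>xs. rec_nat (b (tl xs)) (\<lambda>n y. G (n # y # tl xs)) (hd xs))"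
  have "recf_eval (PrimRec f g) xs (H xs)" if "length xs = Suc k" for xs
    using that * by (cases xs) (auto simp: H_def)
  then have "list_computable (Suc k) H"
    unfolding list_computable_def by blast
  moreover define Gs :: "(nat list \<Rightarrow> nat) list" where "Gs = a # map (\<lambda>i xs. xs ! i) [0..<k]"
  moreover have "list_computable k G" if "G \<in> set Gs" for G
    using that assms(1) by (auto simp: Gs_def intro: list_computable_proj)
  ultimately have c: "list_computable k (\<lambda>xs. H (map (\<lambda>G. G xs) Gs))"
    by (intro list_computable_comp) auto
  have "map (\<lambda>G. G xs) Gs = a xs # xs" if "length xs = k" for xs
    using that by (auto simp: Gs_def intro: nth_equalityI)
  then show ?thesis
    by (intro list_computable_cong[OF c]) (simp add: H_def)
qed

text \<open>Unbounded search stays total because a zero is assumed to exist; \<open>Mu\<close> also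
  needs positive values before it, and minimality supplies them.\<close>

lemma list_computable_Least:
  assumes "list_computable (Suc k) F" "\<And>xs. length xs = k \<Longrightarrow> \<exists>n. F (n # xs) = 0"
  shows "list_computable k (\<lambda>xs. LEAST n. F (n # xs) = 0)"
proof -
  obtain f where f: "\<And>xs. length xs = Suc k \<Longrightarrow> recf_eval f xs (F xs)"
    using assms(1) unfolding list_computable_def by blast
  have "recf_eval (Mu f) xs (LEAST n. F (n # xs) = 0)" if xs: "length xs = k" for xs
  proof (rule recf_eval.Mu)
    have *: "recf_eval f (n # xs) (F (n # xs))" for n using f xs by simp
    have "F ((LEAST n. F (n # xs) = 0) # xs) = 0"
      by (rule LeastI_ex) (rule assms(2)[OF xs])
    then show "recf_eval f ((LEAST n. F (n # xs) = 0) # xs) 0" using * by metis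
    show "\<exists>y>0. recf_eval f (m # xs) y" if "m < (LEAST n. F (n # xs) = 0)" for m
      using not_less_Least[OF that] *[of m] by blast
  qed
  then show ?thesis unfolding list_computable_def by blast
qed

lemma list_computable_add:
  "list_computable k a \<Longrightarrow> list_computable k b \<Longrightarrow> list_computable k (\<lambda>xs. a xs + b xs)"
proof (rule list_computable_comp2[where f = "(+)"])
  have "list_computable 2 (\<lambda>xs. rec_nat (xs ! 1) (\<lambda>n y. Suc ((n # y # xs) ! 1)) (xs ! 0))"
    by (intro list_computable_rec list_computable_Suc list_computable_proj) auto
  moreover have "rec_nat b (\<lambda>n y. Suc y) a = a + b" for a b :: nat by (induction a) auto
  ultimately show "list_computable 2 (\<lambda>xs. xs ! 0 + xs ! 1)" by simp
qed

lemma list_computable_mult: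
  "list_computable k a \<Longrightarrow> list_computable k b \<Longrightarrow> list_computable k (\<lambda>xs. a xs * b xs)"
proof (rule list_computable_comp2[where f = "(*)"])
  have "list_computable 2 (\<lambda>xs. rec_nat 0 (\<lambda>n y. (n # y # xs) ! 1 + (n # y # xs) ! 3) (xs ! 0))"
    by (intro list_computable_rec list_computable_add list_computable_const list_computable_proj) auto
  moreover have "rec_nat 0 (\<lambda>n y. y + b) a = a * b" for a b :: nat by (induction a) auto
  ultimately show "list_computable 2 (\<lambda>xs. xs ! 0 * xs ! 1)"
    by (simp add: eval_nat_numeral)
qed

lemma list_computable_pred: "list_computable k a \<Longrightarrow> list_computable k (\<lambda>xs. a xs - 1)"
proof (rule list_computable_comp1[where f = "\<lambda>n. n - 1"])
  have "list_computable 1 (\<lambda>xs. rec_nat 0 (\<lambda>n y. (n # y # xs) ! 0) (xs ! 0))"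
    by (intro list_computable_rec list_computable_const list_computable_proj) auto
  moreover have "rec_nat 0 (\<lambda>n y. n) a = a - 1" for a :: nat by (induction a) auto
  ultimately show "list_computable 1 (\<lambda>xs. xs ! 0 - 1)" by simp
qed

lemma list_computable_diff:
  "list_computable k a \<Longrightarrow> list_computable k b \<Longrightarrow> list_computable k (\<lambda>xs. a xs - b xs)"
proof (rule list_computable_comp2[where f = "(-)"])
  have "list_computable 2 (\<lambda>xs. rec_nat (xs ! 0) (\<lambda>n y. (n # y # xs) ! 1 - 1) (xs ! 1))"
    by (intro list_computable_rec list_computable_pred list_computable_proj) auto
  moreover have "rec_nat a (\<lambda>n y. y - 1) b = a - b" for a b :: nat by (induction b) auto
  ultimately show "list_computable 2 (\<lambda>xs. xs ! 0 - xs ! 1)" by simp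
qed

lemma list_computable_triangle: "list_computable k a \<Longrightarrow> list_computable k (\<lambda>xs. triangle (a xs))"
proof (rule list_computable_comp1[where f = triangle])
  have "list_computable 1 (\<lambda>xs. rec_nat 0 (\<lambda>n y. (n # y # xs) ! 1 + Suc ((n # y # xs) ! 0)) (xs ! 0))"
    by (intro list_computable_rec list_computable_add list_computable_Suc list_computable_const
        list_computable_proj) auto
  moreover have "rec_nat 0 (\<lambda>n y. y + Suc n) a = triangle a" for a :: nat by (induction a) auto
  ultimately show "list_computable 1 (\<lambda>xs. triangle (xs ! 0))" by simp
qed

section \<open>Unary computable functions, with several arguments packed into one number\<close>

definition computable :: "(nat \<Rightarrow> nat) \<Rightarrow> bool" where
  "computable f \<longleftrightarrow> list_computable 1 (\<lambda>xs. f (xs ! 0))"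

definition pair :: "nat \<Rightarrow> nat \<Rightarrow> nat" where "pair a b = prod_encode (a, b)"
definition pfst :: "nat \<Rightarrow> nat" where "pfst n = fst (prod_decode n)"
definition psnd :: "nat \<Rightarrow> nat" where "psnd n = snd (prod_decode n)"

lemma pair_simps [simp]: "pfst (pair a b) = a" "psnd (pair a b) = b" "pair (pfst n) (psnd n) = n"
  "pair a b = pair a' b' \<longleftrightarrow> a = a' \<and> b = b'"
  by (simp_all add: pair_def pfst_def psnd_def)

lemma computable_compose: "computable f \<Longrightarrow> computable a \<Longrightarrow> computable (\<lambda>n. f (a n))"
  unfolding computable_def by (rule list_computable_comp1)

lemma computable_id: "computable (\<lambda>n. n)"
  unfolding computable_def by (rule list_computable_proj) simp

lemma computable_const: "computable (\<lambda>_. c)"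
  unfolding computable_def by (rule list_computable_const)

lemma computable_Suc: "computable a \<Longrightarrow> computable (\<lambda>n. Suc (a n))"
  unfolding computable_def by (rule list_computable_Suc)

lemma computable_add: "computable a \<Longrightarrow> computable b \<Longrightarrow> computable (\<lambda>n. a n + b n)"
  unfolding computable_def by (rule list_computable_add)

lemma computable_mult: "computable a \<Longrightarrow> computable b \<Longrightarrow> computable (\<lambda>n. a n * b n)"
  unfolding computable_def by (rule list_computable_mult)

lemma computable_diff: "computable a \<Longrightarrow> computable b \<Longrightarrow> computable (\<lambda>n. a n - b n)"
  unfolding computable_def by (rule list_computable_diff)

lemma computable_pair: "computable a \<Longrightarrow> computable b \<Longrightarrow> computable (\<lambda>n. pair (a n) (b n))"
  unfolding computable_def pair_def prod_encode_def
  by (simp add: list_computable_add list_computable_triangle)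

lemma triangle_mono: "a \<le> b \<Longrightarrow> triangle a \<le> triangle b"
  by (induction b) (auto simp: le_Suc_eq)

lemma computable_unpair: "computable pfst" "computable psnd"
proof -
  \<comment> \<open>\<open>pair a b\<close> is \<open>triangle (a + b) + a\<close>, so decoding
    amounts to finding the diagonal \<open>a + b\<close>. It is the least \<open>s\<close> with
    \<open>n < triangle (Suc s)\<close>, written as a truncated difference that vanishes.\<close>
  define s where "s n = (LEAST s. Suc n - triangle (Suc s) = 0)" for n
  have tri: "n \<le> triangle n" for n by (induction n) auto
  have ex: "\<exists>s. Suc n - triangle (Suc s) = 0" for n
    using tri[of "Suc n"] by (intro exI[of _ n]) simp
  have "list_computable 1 (\<lambda>xs. LEAST s. Suc ((s # xs) ! 1) - triangle (Suc ((s # xs) ! 0)) = 0)"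
    by (intro list_computable_Least list_computable_diff list_computable_Suc list_computable_triangle
        list_computable_proj) (use ex in auto)
  then have s: "computable s" by (simp add: computable_def s_def)
  have s_eq: "s (pair a b) = a + b" for a b
    unfolding s_def
  proof (rule Least_equality)
    show "Suc (pair a b) - triangle (Suc (a + b)) = 0"
      by (simp add: pair_def prod_encode_def)
    fix y assume "Suc (pair a b) - triangle (Suc y) = 0"
    then have "triangle (a + b) < triangle (Suc y)"
      by (simp add: pair_def prod_encode_def)
    then have "\<not> Suc y \<le> a + b" using triangle_mono[of "Suc y" "a + b"] by linarith
    then show "a + b \<le> y" by simp
  qed
  have s_sum: "s n = pfst n + psnd n" for n
    using s_eq[of "pfst n" "psnd n"] by simp
  have "triangle (pfst n + psnd n) + pfst n = n" for n
    using pair_simps(3)[of n] unfolding pair_def prod_encode_def by simp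
  then have 1: "pfst n = n - triangle (s n)" for n
    unfolding s_sum by (metis add_diff_cancel_left')
  have 2: "psnd n = s n - pfst n" for n
    by (simp add: s_sum)
  have tc: "computable a \<Longrightarrow> computable (\<lambda>n. triangle (a n))" for a
    unfolding computable_def by (rule list_computable_triangle)
  show c: "computable pfst"
    unfolding 1[abs_def] by (intro computable_diff tc computable_id s)
  show "computable psnd"
    unfolding 2[abs_def] by (intro computable_diff c s)
qed

lemmas computable_pfst = computable_compose[OF computable_unpair(1)]
  and computable_psnd = computable_compose[OF computable_unpair(2)]

text \<open>Every bounded loop below is an iteration of a step on a coded state. The parameter
  \<open>n\<close> stays available to the step, which is why \<open>f\<close> takes it as a separate
  argument.\<close>

lemma computable_funpow:
  assumes "computable (\<lambda>m. f (pfst m) (psnd m))" "computable a" "computable b"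
  shows "computable (\<lambda>n. (f n ^^ a n) (b n))"
proof -
  have f': "list_computable k (\<lambda>xs. f (u xs) (v xs))"
    if "list_computable k u" "list_computable k v" for k u v
  proof -
    have "list_computable 2 (\<lambda>xs. pair (xs ! 0) (xs ! 1))"
      unfolding pair_def prod_encode_def
      by (simp add: list_computable_add list_computable_triangle list_computable_proj)
    then have "list_computable k (\<lambda>xs. pair (u xs) (v xs))"
      using that by (rule list_computable_comp2)
    then have "list_computable k (\<lambda>xs. f (pfst (pair (u xs) (v xs))) (psnd (pair (u xs) (v xs))))"
      using assms(1) unfolding computable_def by (rule list_computable_comp1[rotated])
    then show ?thesis by simp
  qed
  have "list_computable 1 (\<lambda>xs. rec_nat (b (xs ! 0)) (\<lambda>n y. f ((n # y # xs) ! 2) ((n # y # xs) ! 1)) (a (xs ! 0)))"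
    using assms(2,3) unfolding computable_def
    by (intro list_computable_rec f' list_computable_proj) auto
  moreover have "rec_nat b (\<lambda>n y. g y) a = (g ^^ a) b" for g :: "nat \<Rightarrow> nat" and a b
    by (induction a) auto
  ultimately show ?thesis unfolding computable_def by simp
qed

lemma computable_Least:
  assumes "computable (\<lambda>m. f (pfst m) (psnd m))" "\<And>n. \<exists>y. f n y = 0"
  shows "computable (\<lambda>n. LEAST y. f n y = 0)"
proof -
  have "list_computable 2 (\<lambda>xs. pair (xs ! 1) (xs ! 0))"
    unfolding pair_def prod_encode_def
    by (simp add: list_computable_add list_computable_triangle list_computable_proj)
  then have "list_computable 2 (\<lambda>xs. f (pfst (pair (xs ! 1) (xs ! 0))) (psnd (pair (xs ! 1) (xs ! 0))))"
    using assms(1) unfolding computable_def by (rule list_computable_comp1[rotated])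
  then have "list_computable (Suc 1) (\<lambda>xs. f (xs ! 1) (xs ! 0))" by (simp add: numeral_2_eq_2)
  from list_computable_Least[OF this] show ?thesis
    using assms(2) unfolding computable_def by simp
qed

section \<open>Decidable and semidecidable predicates\<close>

text \<open>Truth is the value 0, so that conjunction becomes a sum, disjunction a product and
  \<open>\<le>\<close> a truncated difference.\<close>

definition decidable :: "(nat \<Rightarrow> bool) \<Rightarrow> bool" where
  "decidable P \<longleftrightarrow> (\<exists>f. computable f \<and> (\<forall>n. P n \<longleftrightarrow> f n = 0))"

definition semidecidable :: "(nat \<Rightarrow> bool) \<Rightarrow> bool" where
  "semidecidable P \<longleftrightarrow> (\<exists>f. computable f \<and> (\<forall>n. P n \<longleftrightarrow> (\<exists>y. f (pair n y) = 0)))"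

lemma decidableI: "computable f \<Longrightarrow> (\<And>n. P n \<longleftrightarrow> f n = 0) \<Longrightarrow> decidable P"
  unfolding decidable_def by blast

lemma decidable_subst: "decidable P \<Longrightarrow> computable a \<Longrightarrow> decidable (\<lambda>n. P (a n))"
proof -
  assume "decidable P" "computable a"
  then obtain f where f: "computable f" "\<And>n. P n \<longleftrightarrow> f n = 0"
    unfolding decidable_def by blast
  show ?thesis by (rule decidableI[OF computable_compose[OF f(1) \<open>computable a\<close>]]) (rule f(2))
qed

lemma decidable_le: "computable a \<Longrightarrow> computable b \<Longrightarrow> decidable (\<lambda>n. a n \<le> b n)"
  by (rule decidableI[OF computable_diff]) auto

lemma decidable_conj: "decidable P \<Longrightarrow> decidable Q \<Longrightarrow> decidable (\<lambda>n. P n \<and> Q n)"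
proof -
  assume "decidable P" "decidable Q"
  then obtain f g where fg: "computable f" "\<And>n. P n \<longleftrightarrow> f n = 0" "computable g" "\<And>n. Q n \<longleftrightarrow> g n = 0"
    unfolding decidable_def by blast
  show ?thesis by (rule decidableI[OF computable_add[OF fg(1,3)]]) (simp add: fg(2,4))
qed

lemma decidable_eq:
  assumes "computable a" "computable b"
  shows "decidable (\<lambda>n. a n = b n)"
  using decidable_conj[OF decidable_le[OF assms] decidable_le[OF assms(2,1)]]
  by (simp add: eq_iff)

lemma decidable_not: "decidable P \<Longrightarrow> decidable (\<lambda>n. \<not> P n)"
proof -
  assume "decidable P"
  then obtain f where f: "computable f" "\<And>n. P n \<longleftrightarrow> f n = 0" unfolding decidable_def by blast
  then have "computable (\<lambda>n. 1 - f n)" by (intro computable_diff computable_const)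
  then show ?thesis by (rule decidableI) (use f(2) in auto)
qed

lemma decidable_less: "computable a \<Longrightarrow> computable b \<Longrightarrow> decidable (\<lambda>n. a n < b n)"
  using decidable_not[OF decidable_le[of b a]] by (simp add: not_le)

lemma computable_if:
  assumes "decidable P" "computable a" "computable b"
  shows "computable (\<lambda>n. if P n then a n else b n)"
proof -
  obtain f where f: "computable f" "\<And>n. P n \<longleftrightarrow> f n = 0"
    using assms(1) unfolding decidable_def by blast
  have "computable (\<lambda>n. (1 - f n) * a n + (1 - (1 - f n)) * b n)"
    by (intro computable_add computable_mult computable_diff computable_const f assms)
  moreover have "(1 - f n) * a n + (1 - (1 - f n)) * b n = (if P n then a n else b n)" for n
    using f(2)[of n] by (cases "f n") auto
  ultimately show ?thesis by simp
qed

lemma semidecidableI: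
  "decidable (\<lambda>m. P (pfst m) (psnd m)) \<Longrightarrow> (\<And>n. Q n \<longleftrightarrow> (\<exists>y. P n y)) \<Longrightarrow> semidecidable Q"
proof -
  assume "decidable (\<lambda>m. P (pfst m) (psnd m))" and Q: "\<And>n. Q n \<longleftrightarrow> (\<exists>y. P n y)"
  then obtain f where f: "computable f" "\<And>m. P (pfst m) (psnd m) \<longleftrightarrow> f m = 0"
    unfolding decidable_def by blast
  have "P n y \<longleftrightarrow> f (pair n y) = 0" for n y using f(2)[of "pair n y"] by simp
  with f(1) Q show ?thesis unfolding semidecidable_def by auto
qed

lemma semidecidable_witness:
  assumes "semidecidable Q"
  shows "\<exists>P. decidable (\<lambda>m. P (pfst m) (psnd m)) \<and> (\<forall>n. Q n \<longleftrightarrow> (\<exists>y. P n y))"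
proof -
  obtain f where f: "computable f" "\<And>n. Q n \<longleftrightarrow> (\<exists>y. f (pair n y) = 0)"
    using assms unfolding semidecidable_def by blast
  have "decidable (\<lambda>m. f (pair (pfst m) (psnd m)) = 0)" using f(1) by (auto intro: decidableI)
  with f(2) show ?thesis by (intro exI[of _ "\<lambda>n y. f (pair n y) = 0"]) simp
qed

lemma semidecidable_decidable: "decidable P \<Longrightarrow> semidecidable P"
  by (rule semidecidableI[where P = "\<lambda>n _. P n"])
     (auto intro: decidable_subst computable_unpair)

lemma semidecidable_subst:
  assumes "semidecidable P" "computable a"
  shows "semidecidable (\<lambda>n. P (a n))"
proof -
  obtain R where R: "decidable (\<lambda>m. R (pfst m) (psnd m))" "\<And>n. P n \<longleftrightarrow> (\<exists>y. R n y)"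
    using semidecidable_witness[OF assms(1)] by blast
  have "computable (\<lambda>m. pair (a (pfst m)) (psnd m))"
    by (intro computable_pair computable_compose[OF assms(2)] computable_unpair)
  from decidable_subst[OF R(1) this] have "decidable (\<lambda>m. R (a (pfst m)) (psnd m))" by simp
  then show ?thesis by (rule semidecidableI[where P = "\<lambda>n y. R (a n) y"]) (simp add: R(2))
qed

text \<open>The witness and the certificate for its own semidecidable property are packed into one
  number.\<close>

lemma semidecidable_ex:
  assumes "semidecidable (\<lambda>m. P (pfst m) (psnd m))"
  shows "semidecidable (\<lambda>n. \<exists>y. P n y)"
proof -
  obtain R where R: "decidable (\<lambda>m. R (pfst m) (psnd m))"
    "\<And>m. P (pfst m) (psnd m) \<longleftrightarrow> (\<exists>y. R m y)"
    using semidecidable_witness[OF assms] by blast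
  let ?a = "\<lambda>m. pair (pair (pfst m) (pfst (psnd m))) (psnd (psnd m))"
  have "computable ?a"
    by (intro computable_pair computable_pfst computable_psnd computable_id)
  from decidable_subst[OF R(1) this]
  have "decidable (\<lambda>m. R (pair (pfst m) (pfst (psnd m))) (psnd (psnd m)))" by simp
  then show ?thesis
  proof (rule semidecidableI[where P = "\<lambda>n y. R (pair n (pfst y)) (psnd y)"])
    have "P n y \<longleftrightarrow> (\<exists>z. R (pair n y) z)" for n y using R(2)[of "pair n y"] by simp
    then show "(\<exists>y. P n y) \<longleftrightarrow> (\<exists>y. R (pair n (pfst y)) (psnd y))" for n
      by (metis pair_simps(1,2))
  qed
qed

lemma semidecidable_conj:
  assumes "semidecidable P" "semidecidable Q"
  shows "semidecidable (\<lambda>n. P n \<and> Q n)"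
proof -
  obtain R where R: "decidable (\<lambda>m. R (pfst m) (psnd m))" "\<And>n. P n \<longleftrightarrow> (\<exists>y. R n y)"
    using semidecidable_witness[OF assms(1)] by blast
  obtain S where S: "decidable (\<lambda>m. S (pfst m) (psnd m))" "\<And>n. Q n \<longleftrightarrow> (\<exists>y. S n y)"
    using semidecidable_witness[OF assms(2)] by blast
  have "decidable (\<lambda>m. R (pfst m) (pfst (psnd m)) \<and> S (pfst m) (psnd (psnd m)))"
    using decidable_subst[OF R(1), of "\<lambda>m. pair (pfst m) (pfst (psnd m))"]
      decidable_subst[OF S(1), of "\<lambda>m. pair (pfst m) (psnd (psnd m))"]
    by (intro decidable_conj)
       (simp_all add: computable_pair computable_pfst computable_psnd computable_id)
  then show ?thesis
    by (rule semidecidableI[where P = "\<lambda>n y. R n (pfst y) \<and> S n (psnd y)"])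
       (metis R(2) S(2) pair_simps(1,2))
qed

lemma semidecidable_disj:
  assumes "semidecidable P" "semidecidable Q"
  shows "semidecidable (\<lambda>n. P n \<or> Q n)"
proof -
  obtain f where f: "computable f" "\<And>n. P n \<longleftrightarrow> (\<exists>y. f (pair n y) = 0)"
    using assms(1) unfolding semidecidable_def by blast
  obtain g where g: "computable g" "\<And>n. Q n \<longleftrightarrow> (\<exists>y. g (pair n y) = 0)"
    using assms(2) unfolding semidecidable_def by blast
  have "computable (\<lambda>n. f n * g n)" using f g by (intro computable_mult)
  then show ?thesis unfolding semidecidable_def
    by (intro exI[of _ "\<lambda>n. f n * g n"]) (use f(2) g(2) in auto)
qed

text \<open>A sum of natural numbers vanishes only if every summand does; the loop state is the pair
  of the index and the partial sum.\<close>

lemma decidable_all_less: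
  assumes "decidable (\<lambda>m. P (pfst m) (psnd m))" "computable b"
  shows "decidable (\<lambda>n. \<forall>i<b n. P n i)"
proof -
  obtain f where f: "computable f" "\<And>m. P (pfst m) (psnd m) \<longleftrightarrow> f m = 0"
    using assms(1) unfolding decidable_def by blast
  define step where "step = (\<lambda>n s. pair (Suc (pfst s)) (psnd s + f (pair n (pfst s))))"
  have "computable (\<lambda>n. psnd ((step n ^^ b n) (pair 0 0)))"
    unfolding step_def
    by (intro computable_psnd computable_funpow computable_pair computable_Suc computable_add
        computable_compose[OF f(1)] computable_pfst computable_id computable_const assms)
  moreover have "(step n ^^ k) (pair 0 0) = pair k (\<Sum>i<k. f (pair n i))" for n k
    by (induction k) (auto simp: step_def)
  ultimately have "computable (\<lambda>n. \<Sum>i<b n. f (pair n i))" by simp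
  moreover have "P n i \<longleftrightarrow> f (pair n i) = 0" for n i using f(2)[of "pair n i"] by simp
  ultimately show ?thesis by (elim decidableI) auto
qed

section \<open>Lists of natural numbers as codes\<close>

definition code_hd :: "nat \<Rightarrow> nat" where "code_hd n = pfst (n - 1)"
text \<open>The code of a nonempty list is the successor of the code of the pair of head and tail.
  With truncated subtraction the tail of the empty list is again empty, so that dropping too many
  entries is harmless.\<close>

definition code_tl :: "nat \<Rightarrow> nat" where "code_tl n = psnd (n - 1)"
definition code_drop :: "nat \<Rightarrow> nat \<Rightarrow> nat" where "code_drop n i = (code_tl ^^ i) n"
definition code_nth :: "nat \<Rightarrow> nat \<Rightarrow> nat" where "code_nth n i = code_hd (code_drop n i)"

lemma computable_code_hd: "computable a \<Longrightarrow> computable (\<lambda>n. code_hd (a n))"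
  unfolding code_hd_def by (intro computable_pfst computable_diff computable_const)

lemma computable_code_tl: "computable a \<Longrightarrow> computable (\<lambda>n. code_tl (a n))"
  unfolding code_tl_def by (intro computable_psnd computable_diff computable_const)

lemma computable_code_drop:
  "computable a \<Longrightarrow> computable b \<Longrightarrow> computable (\<lambda>n. code_drop (a n) (b n))"
  unfolding code_drop_def
  by (intro computable_funpow computable_code_tl computable_psnd computable_id)

lemma computable_code_nth:
  "computable a \<Longrightarrow> computable b \<Longrightarrow> computable (\<lambda>n. code_nth (a n) (b n))"
  unfolding code_nth_def by (intro computable_code_hd computable_code_drop)

lemma code_hd_tl_Cons [simp]:
  "code_hd (list_encode (x # xs)) = x" "code_tl (list_encode (x # xs)) = list_encode xs"
  by (simp_all add: code_hd_def code_tl_def pfst_def psnd_def)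

lemma code_tl_0 [simp]: "code_tl 0 = 0"
  by (simp add: code_tl_def psnd_def prod_decode_def prod_decode_aux.simps)

lemma code_drop_list_encode: "code_drop (list_encode xs) i = list_encode (drop i xs)"
proof (induction i arbitrary: xs)
  case (Suc i)
  show ?case
  proof (cases xs)
    case Nil
    have "(code_tl ^^ k) 0 = 0" for k by (induction k) auto
    with Nil show ?thesis by (simp add: code_drop_def)
  next
    case (Cons a list)
    then show ?thesis using Suc[of list] by (simp add: code_drop_def funpow_swap1 del: list_encode.simps)
  qed
qed (simp add: code_drop_def)

lemma list_decode_code_drop: "list_decode (code_drop n i) = drop i (list_decode n)"
  using code_drop_list_encode[of "list_decode n" i] by simp

lemma code_nth_list_encode: "i < length xs \<Longrightarrow> code_nth (list_encode xs) i = xs ! i"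
  unfolding code_nth_def code_drop_list_encode
  by (simp add: Cons_nth_drop_Suc[symmetric] del: list_encode.simps)

lemma code_nth_list_decode: "i < length (list_decode n) \<Longrightarrow> code_nth n i = list_decode n ! i"
  using code_nth_list_encode[of i "list_decode n"] by simp

text \<open>A finite table of values is a single number. Witnesses chosen separately for each index
  below a bound are thereby collected into one outer witness.\<close>

lemma ex_code_nth: "\<exists>w. \<forall>i<k. code_nth w i = g i"
  by (rule exI[of _ "list_encode (map g [0..<k])"]) (simp add: code_nth_list_encode)

lemma length_list_decode_le: "length (list_decode n) \<le> n"
proof -
  have "length xs \<le> list_encode xs" for xs
  proof (induction xs)
    case (Cons a xs)
    then show ?case using le_prod_encode_2[of "list_encode xs" a] by simp
  qed simp
  from this[of "list_decode n"] show ?thesis by simp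
qed

lemma computable_fold:
  assumes "computable (\<lambda>m. f (pfst m) (pfst (psnd m)) (psnd (psnd m)))"
    and "computable l" "computable a"
  shows "computable (\<lambda>n. fold (f n) (list_decode (l n)) (a n))"
proof -
  \<comment> \<open>The state holds the code of the remaining list and the accumulator; at the empty
    list the step idles. The code \<open>l n\<close> itself serves as the number of rounds, because
    the length of a list never exceeds its code.\<close>
  define step where "step = (\<lambda>n s. if pfst s = 0 then s
    else pair (code_tl (pfst s)) (f n (code_hd (pfst s)) (psnd s)))"
  have "computable (\<lambda>m. step (pfst m) (psnd m))"
  proof -
    have "computable (\<lambda>m. pair (pfst m) (pair (code_hd (pfst (psnd m))) (psnd (psnd m))))"
      by (intro computable_pair computable_pfst computable_psnd computable_code_hd computable_id)
    from computable_compose[OF assms(1) this]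
    have "computable (\<lambda>m. f (pfst m) (code_hd (pfst (psnd m))) (psnd (psnd m)))" by simp
    then show ?thesis unfolding step_def
      by (intro computable_if decidable_eq computable_pair computable_pfst computable_psnd
          computable_code_tl computable_id computable_const)
  qed
  then have "computable (\<lambda>n. psnd ((step n ^^ l n) (pair (l n) (a n))))"
    by (intro computable_psnd computable_funpow computable_pair assms)
  moreover have fold: "(step n ^^ k) (pair (list_encode xs) v) = pair 0 (fold (f n) xs v)"
    if "length xs \<le> k" for n k xs v
    using that
  proof (induction xs arbitrary: k v)
    case Nil
    have "step n (pair 0 v) = pair 0 v" by (simp add: step_def)
    then have "(step n ^^ k) (pair 0 v) = pair 0 v" by (induction k) auto
    then show ?case by simp
  next
    case (Cons x xs)
    then obtain k' where k: "k = Suc k'" "length xs \<le> k'" by (cases k) auto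
    have "step n (pair (list_encode (x # xs)) v) = pair (list_encode xs) (f n x v)"
      using code_hd_tl_Cons[of x xs] by (simp add: step_def del: code_hd_tl_Cons)
    then show ?case using Cons.IH[OF k(2), of "f n x v"] k(1)
      by (simp add: funpow_swap1 del: list_encode.simps)
  qed
  have "(step n ^^ l n) (pair (l n) (a n)) = pair 0 (fold (f n) (list_decode (l n)) (a n))" for n
    using fold[OF length_list_decode_le, of "l n" n "a n"] by simp
  ultimately show ?thesis by simp
qed

lemma computable_length: "computable l \<Longrightarrow> computable (\<lambda>n. length (list_decode (l n)))"
proof -
  assume "computable l"
  then have "computable (\<lambda>n. fold (\<lambda>_ k. Suc k) (list_decode (l n)) 0)"
    by (intro computable_fold computable_Suc computable_psnd computable_id computable_const)
  moreover have "fold (\<lambda>_. Suc) xs k = length xs + k" for xs :: "nat list" and k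
    by (induction xs arbitrary: k) auto
  ultimately show ?thesis by simp
qed

lemma all_set_code: "(\<forall>x\<in>set (list_decode n). P x) \<longleftrightarrow> (\<forall>i<length (list_decode n). P (code_nth n i))"
  by (metis in_set_conv_nth code_nth_list_decode)

lemma ex_set_code: "(\<exists>x\<in>set (list_decode n). P x) \<longleftrightarrow> (\<exists>i. i < length (list_decode n) \<and> P (code_nth n i))"
  by (metis in_set_conv_nth code_nth_list_decode)

lemma decidable_all_set:
  assumes "decidable (\<lambda>m. P (pfst m) (psnd m))" "computable l"
  shows "decidable (\<lambda>n. \<forall>x\<in>set (list_decode (l n)). P n x)"
proof -
  have "computable (\<lambda>m. pair (pfst m) (code_nth (l (pfst m)) (psnd m)))"
    by (intro computable_pair computable_code_nth computable_compose[OF assms(2)] computable_pfst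
        computable_psnd computable_id)
  from decidable_subst[OF assms(1) this] show ?thesis unfolding all_set_code
    by (intro decidable_all_less computable_length assms) simp
qed

lemma semidecidable_all_less:
  assumes "semidecidable (\<lambda>m. P (pfst m) (psnd m))" "computable b"
  shows "semidecidable (\<lambda>n. \<forall>i<b n. P n i)"
proof -
  obtain R where R: "decidable (\<lambda>m. R (pfst m) (psnd m))"
    "\<And>m. P (pfst m) (psnd m) \<longleftrightarrow> (\<exists>y. R m y)"
    using semidecidable_witness[OF assms(1)] by blast
  have P: "P n i \<longleftrightarrow> (\<exists>y. R (pair n i) y)" for n i using R(2)[of "pair n i"] by simp
  let ?a = "\<lambda>m. pair (pair (pfst (pfst m)) (psnd m)) (code_nth (psnd (pfst m)) (psnd m))"
  have "computable ?a"
    by (intro computable_pair computable_code_nth computable_pfst computable_psnd computable_id)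
  from decidable_subst[OF R(1) this]
  have "decidable (\<lambda>m. \<forall>i<b (pfst m). R (pair (pfst m) i) (code_nth (psnd m) i))"
    by (intro decidable_all_less computable_compose[OF assms(2)] computable_unpair) simp
  then show ?thesis
  proof (rule semidecidableI[where P = "\<lambda>n w. \<forall>i<b n. R (pair n i) (code_nth w i)"])
    fix n
    show "(\<forall>i<b n. P n i) \<longleftrightarrow> (\<exists>w. \<forall>i<b n. R (pair n i) (code_nth w i))"
    proof
      assume "\<forall>i<b n. P n i"
      then obtain g where g: "\<forall>i<b n. R (pair n i) (g i)" unfolding P by metis
      obtain w where "\<forall>i<b n. code_nth w i = g i" using ex_code_nth by blast
      with g show "\<exists>w. \<forall>i<b n. R (pair n i) (code_nth w i)" by (intro exI[of _ w]) simp
    qed (auto simp: P)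
  qed
qed

lemma semidecidable_all_set:
  assumes "semidecidable (\<lambda>m. P (pfst m) (psnd m))" "computable l"
  shows "semidecidable (\<lambda>n. \<forall>x\<in>set (list_decode (l n)). P n x)"
proof -
  have "computable (\<lambda>m. pair (pfst m) (code_nth (l (pfst m)) (psnd m)))"
    by (intro computable_pair computable_code_nth computable_compose[OF assms(2)] computable_pfst
        computable_psnd computable_id)
  from semidecidable_subst[OF assms(1) this] show ?thesis unfolding all_set_code
    by (intro semidecidable_all_less computable_length assms) simp
qed

lemma semidecidable_ex_set:
  assumes "semidecidable (\<lambda>m. P (pfst m) (psnd m))" "computable l"
  shows "semidecidable (\<lambda>n. \<exists>x\<in>set (list_decode (l n)). P n x)"
proof -
  have "computable (\<lambda>m. pair (pfst m) (code_nth (l (pfst m)) (psnd m)))"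
    by (intro computable_pair computable_code_nth computable_compose[OF assms(2)] computable_pfst
        computable_psnd computable_id)
  from semidecidable_subst[OF assms(1) this] show ?thesis unfolding ex_set_code
    by (intro semidecidable_ex semidecidable_conj
          semidecidable_decidable[OF decidable_less[OF computable_psnd[OF computable_id]
            computable_length[OF computable_compose[OF assms(2) computable_pfst[OF computable_id]]]]]) simp
qed

text \<open>One search runs for both sides at once: the product vanishes as soon as \<open>y\<close>
  is a witness for either of them, and since the sides are complementary the value of
  \<open>f\<close> at the first such \<open>y\<close> tells which one it was.\<close>

lemma decidable_if_semidecidable:
  assumes "semidecidable P" "semidecidable (\<lambda>n. \<not> P n)"
  shows "decidable P"
proof -
  obtain f where f: "computable f" "\<And>n. P n \<longleftrightarrow> (\<exists>y. f (pair n y) = 0)"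
    using assms(1) unfolding semidecidable_def by blast
  obtain g where g: "computable g" "\<And>n. \<not> P n \<longleftrightarrow> (\<exists>y. g (pair n y) = 0)"
    using assms(2) unfolding semidecidable_def by blast
  define y where "y = (\<lambda>n. LEAST y. f (pair n y) * g (pair n y) = 0)"
  have ex: "\<exists>y. f (pair n y) * g (pair n y) = 0" for n
    using f(2)[of n] g(2)[of n] by (simp only: mult_is_0) blast
  have "computable y" unfolding y_def
    by (intro computable_Least ex) (simp add: f g computable_mult)
  then have "computable (\<lambda>n. f (pair n (y n)))"
    by (intro computable_compose[OF f(1)] computable_pair computable_id)
  moreover have "P n \<longleftrightarrow> f (pair n (y n)) = 0" for n
  proof -
    have "f (pair n (y n)) = 0 \<or> g (pair n (y n)) = 0"
      using LeastI_ex[OF ex[of n]] by (simp add: y_def)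
    then show ?thesis using f(2) g(2) by blast
  qed
  ultimately show ?thesis by (rule decidableI)
qed

lemma decidable_set_if_decidable:
  assumes "decidable (\<lambda>n. n \<in> A)"
  shows "decidable_set A"
proof -
  have "computable (\<lambda>n. if n \<in> A then 1 else 0)"
    by (intro computable_if assms computable_const)
  then obtain r where r: "\<And>xs. length xs = 1 \<Longrightarrow> recf_eval r xs (if xs ! 0 \<in> A then 1 else 0)"
    unfolding computable_def list_computable_def by blast
  have "recf_eval r [n] (if n \<in> A then 1 else 0)" for n using r[of "[n]"] by simp
  then show ?thesis unfolding decidable_set_def by blast
qed

section \<open>Central series with cyclic factors\<close>

definition centralizes :: "('a, 'b) monoid_scheme \<Rightarrow> 'a set \<Rightarrow> 'a \<Rightarrow> 'a \<Rightarrow> bool" where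
  "centralizes G N a b \<longleftrightarrow> a \<otimes>\<^bsub>G\<^esub> b \<otimes>\<^bsub>G\<^esub> inv\<^bsub>G\<^esub> a \<otimes>\<^bsub>G\<^esub> inv\<^bsub>G\<^esub> b \<in> N"

text \<open>Series are listed from the top: the head generates the uppermost factor over the span of
  the tail. Entries may be redundant and factors trivial, so generators can be added without testing
  whether they are new.\<close>

primrec series_span :: "('a, 'b) monoid_scheme \<Rightarrow> 'a list \<Rightarrow> 'a set" where
  "series_span G [] = {\<one>\<^bsub>G\<^esub>}"
| "series_span G (c # cs) = {c [^]\<^bsub>G\<^esub> k \<otimes>\<^bsub>G\<^esub> x | (k :: int) x. x \<in> series_span G cs}"

primrec central_series :: "('a, 'b) monoid_scheme \<Rightarrow> 'a list \<Rightarrow> bool" where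
  "central_series G [] \<longleftrightarrow> True"
| "central_series G (c # cs) \<longleftrightarrow> c \<in> carrier G \<and>
     (\<forall>g\<in>carrier G. centralizes G (series_span G cs) g c) \<and> central_series G cs"

lemma (in group) inv_mult_cancel_left [simp]:
  assumes "a \<in> carrier G" "b \<in> carrier G"
  shows "inv a \<otimes> (a \<otimes> b) = b" "a \<otimes> (inv a \<otimes> b) = b"
  using assms by (simp_all add: m_assoc[symmetric])

text \<open>An opaque quotient map, so that the simplifier never sees cosets.\<close>

locale quotient_map = group_hom G Q q + normal N G
  for G (structure) and Q (structure) and q and N +
  assumes eq_iff: "a \<in> carrier G \<Longrightarrow> b \<in> carrier G \<Longrightarrow> q a = q b \<longleftrightarrow> a \<otimes>\<^bsub>G\<^esub> inv\<^bsub>G\<^esub> b \<in> N"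

lemma (in normal) quotient_map: "quotient_map G (G Mod H) (\<lambda>a. H #> a) H"
proof (intro quotient_map.intro quotient_map_axioms.intro group_hom.intro group_hom_axioms.intro
    is_group factorgroup_is_group r_coset_hom_Mod normal_axioms)
  fix a b assume ab: "a \<in> carrier G" "b \<in> carrier G"
  show "H #> a = H #> b \<longleftrightarrow> a \<otimes> inv b \<in> H"
  proof
    assume "H #> a = H #> b"
    then have "a \<in> H #> b" using rcos_self[OF ab(1)] subgroup_axioms by blast
    then show "a \<otimes> inv b \<in> H" using rcos_module_imp ab is_group by blast
  next
    assume "a \<otimes> inv b \<in> H"
    then have "a \<in> H #> b" using rcos_module_rev ab is_group by blast
    then show "H #> a = H #> b" using repr_independence[OF _ ab(2) subgroup_axioms] by blast
  qed
qed

context quotient_map begin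

lemma eq_one_iff: "a \<in> carrier G \<Longrightarrow> q a = \<one>\<^bsub>Q\<^esub> \<longleftrightarrow> a \<in> N"
  using eq_iff[of a "\<one>\<^bsub>G\<^esub>"] by simp

lemma centralizes_iff:
  assumes "a \<in> carrier G" "b \<in> carrier G"
  shows "centralizes G N a b \<longleftrightarrow> q a \<otimes>\<^bsub>Q\<^esub> q b = q b \<otimes>\<^bsub>Q\<^esub> q a"
proof -
  have "centralizes G N a b \<longleftrightarrow> (a \<otimes>\<^bsub>G\<^esub> b) \<otimes>\<^bsub>G\<^esub> inv\<^bsub>G\<^esub> (b \<otimes>\<^bsub>G\<^esub> a) \<in> N"
    using assms by (simp add: centralizes_def G.inv_mult_group G.m_assoc)
  also have "\<dots> \<longleftrightarrow> q (a \<otimes>\<^bsub>G\<^esub> b) = q (b \<otimes>\<^bsub>G\<^esub> a)"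
    using assms eq_iff[of "a \<otimes>\<^bsub>G\<^esub> b" "b \<otimes>\<^bsub>G\<^esub> a"] by simp
  finally show ?thesis using assms by simp
qed

text \<open>Membership in a cyclic extension of \<open>N\<close> becomes an equation in the
  quotient, where exponents can be added and subtracted without tracking the remainder in
  \<open>N\<close>.\<close>

lemma mem_cyclic_extension_iff:
  assumes "c \<in> carrier G" "a \<in> carrier G"
  shows "(\<exists>x\<in>N. a = c [^]\<^bsub>G\<^esub> (k :: int) \<otimes>\<^bsub>G\<^esub> x) \<longleftrightarrow> q a = q c [^]\<^bsub>Q\<^esub> k"
proof
  assume "\<exists>x\<in>N. a = c [^]\<^bsub>G\<^esub> k \<otimes>\<^bsub>G\<^esub> x"
  then obtain x where x: "x \<in> N" "a = c [^]\<^bsub>G\<^esub> k \<otimes>\<^bsub>G\<^esub> x" by blast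
  have "x \<in> carrier G" using x(1) by simp
  moreover have "q x = \<one>\<^bsub>Q\<^esub>" using x(1) \<open>x \<in> carrier G\<close> eq_one_iff by blast
  ultimately show "q a = q c [^]\<^bsub>Q\<^esub> k" using assms x(2) by (simp add: hom_int_pow)
next
  assume a: "q a = q c [^]\<^bsub>Q\<^esub> k"
  define x where "x = inv\<^bsub>G\<^esub> (c [^]\<^bsub>G\<^esub> k) \<otimes>\<^bsub>G\<^esub> a"
  have "q x = \<one>\<^bsub>Q\<^esub>" using a assms by (simp add: x_def hom_int_pow)
  then have "x \<in> N" using eq_one_iff[of x] assms by (simp add: x_def)
  moreover have "a = c [^]\<^bsub>G\<^esub> k \<otimes>\<^bsub>G\<^esub> x" using assms by (simp add: x_def)
  ultimately show "\<exists>x\<in>N. a = c [^]\<^bsub>G\<^esub> k \<otimes>\<^bsub>G\<^esub> x" by blast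
qed

end

lemma series_span_ConsI:
  "x \<in> series_span G cs \<Longrightarrow> c [^]\<^bsub>G\<^esub> (k :: int) \<otimes>\<^bsub>G\<^esub> x \<in> series_span G (c # cs)"
  by auto

context normal begin

lemma centralizes_iff_quotient:
  assumes "a \<in> carrier G" "b \<in> carrier G"
  shows "centralizes G H a b \<longleftrightarrow>
    (H #> a) \<otimes>\<^bsub>G Mod H\<^esub> (H #> b) = (H #> b) \<otimes>\<^bsub>G Mod H\<^esub> (H #> a)"
  by (rule quotient_map.centralizes_iff[OF quotient_map assms])

lemma centralizes_sym:
  "a \<in> carrier G \<Longrightarrow> b \<in> carrier G \<Longrightarrow> centralizes G H a b \<longleftrightarrow> centralizes G H b a"
  using centralizes_iff_quotient[of a b] centralizes_iff_quotient[of b a] by metis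

lemma ex_quotient_map: "\<exists>(Q :: 'a set monoid) q. quotient_map G Q q H"
  using quotient_map by blast

text \<open>Commuting with a fixed element modulo \<open>H\<close> is preserved by products and
  inverses; hence centrality has to be checked only on generators, in either argument.\<close>

lemma subgroup_centralizer:
  assumes b: "b \<in> carrier G"
  shows "subgroup {a \<in> carrier G. centralizes G H a b} G"
proof -
  obtain Q :: "'a set monoid" and q where "quotient_map G Q q H" using ex_quotient_map by blast
  then interpret q: quotient_map G Q q H .
  have qb: "q b \<in> carrier Q" using b by simp
  show ?thesis
  proof (rule subgroupI)
    have "\<one> \<in> {a \<in> carrier G. centralizes G H a b}"
      using b by (simp add: q.centralizes_iff)
    then show "{a \<in> carrier G. centralizes G H a b} \<noteq> {}" by blast
    show "inv a \<in> {a \<in> carrier G. centralizes G H a b}"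
      if "a \<in> {a \<in> carrier G. centralizes G H a b}" for a
    proof -
      have a: "a \<in> carrier G" and eq: "q a \<otimes>\<^bsub>Q\<^esub> q b = q b \<otimes>\<^bsub>Q\<^esub> q a"
        using that b q.centralizes_iff by auto
      have "q b = inv\<^bsub>Q\<^esub> q a \<otimes>\<^bsub>Q\<^esub> (q a \<otimes>\<^bsub>Q\<^esub> q b)" using a b by simp
      also have "\<dots> \<otimes>\<^bsub>Q\<^esub> inv\<^bsub>Q\<^esub> q a = inv\<^bsub>Q\<^esub> q a \<otimes>\<^bsub>Q\<^esub> q b"
        unfolding eq using a b by (simp add: q.H.m_assoc)
      finally show ?thesis using a b by (simp add: q.centralizes_iff)
    qed
    show "a \<otimes> a' \<in> {a \<in> carrier G. centralizes G H a b}"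
      if "a \<in> {a \<in> carrier G. centralizes G H a b}" "a' \<in> {a \<in> carrier G. centralizes G H a b}" for a a'
    proof -
      have a: "a \<in> carrier G" "q a \<otimes>\<^bsub>Q\<^esub> q b = q b \<otimes>\<^bsub>Q\<^esub> q a"
        and a': "a' \<in> carrier G" "q a' \<otimes>\<^bsub>Q\<^esub> q b = q b \<otimes>\<^bsub>Q\<^esub> q a'"
        using that b q.centralizes_iff by auto
      have "q a \<otimes>\<^bsub>Q\<^esub> (q a' \<otimes>\<^bsub>Q\<^esub> q b) = q b \<otimes>\<^bsub>Q\<^esub> (q a \<otimes>\<^bsub>Q\<^esub> q a')"
        unfolding a'(2) using a a' b by (simp add: q.H.m_assoc[symmetric])
      then show ?thesis using a a' b by (simp add: q.centralizes_iff q.H.m_assoc)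
    qed
  qed auto
qed

lemma subgroup_centralizer':
  assumes "a \<in> carrier G"
  shows "subgroup {b \<in> carrier G. centralizes G H a b} G"
proof -
  have "{b \<in> carrier G. centralizes G H a b} = {b \<in> carrier G. centralizes G H b a}"
    using centralizes_sym[OF assms] by blast
  then show ?thesis using subgroup_centralizer[OF assms] by simp
qed

lemma centralizes_generate:
  assumes "a \<in> carrier G" "X \<subseteq> carrier G" "\<And>x. x \<in> X \<Longrightarrow> centralizes G H a x" "b \<in> generate G X"
  shows "centralizes G H a b"
  using generate_subgroup_incl[OF _ subgroup_centralizer'[OF assms(1)], of X] assms(2-4) by blast

lemma centralizes_generate':
  assumes "b \<in> carrier G" "X \<subseteq> carrier G" "\<And>x. x \<in> X \<Longrightarrow> centralizes G H x b" "a \<in> generate G X"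
  shows "centralizes G H a b"
  using generate_subgroup_incl[OF _ subgroup_centralizer[OF assms(1)], of X] assms(2-4) by blast

lemma centralizes_member:
  assumes "g \<in> carrier G" "x \<in> H"
  shows "centralizes G H g x"
  using subgroup.m_closed[OF subgroup_axioms inv_op_closed2[OF assms] m_inv_closed[OF assms(2)]]
  unfolding centralizes_def .

end

context group begin

lemma series_span_Cons_iff:
  assumes "quotient_map G Q q (series_span G cs)" "c \<in> carrier G" "a \<in> carrier G"
  shows "a \<in> series_span G (c # cs) \<longleftrightarrow> (\<exists>k::int. q a = q c [^]\<^bsub>Q\<^esub> k)"
  using quotient_map.mem_cyclic_extension_iff[OF assms, symmetric] by auto

text \<open>Modulo the span of the tail, the head is central and so are its powers. Conjugation
  therefore fixes every element of the larger span modulo the smaller one.\<close>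

lemma central_series_normal: "central_series G cs \<Longrightarrow> series_span G cs \<lhd> G"
proof (induction cs)
  case Nil
  then show ?case by (simp add: one_is_normal)
next
  case (Cons c cs)
  let ?N = "series_span G cs"
  have N: "?N \<lhd> G" and c: "c \<in> carrier G"
    and cent: "\<And>g. g \<in> carrier G \<Longrightarrow> centralizes G ?N g c"
    using Cons by auto
  obtain Q :: "'a set monoid" and q where "quotient_map G Q q ?N"
    using normal.ex_quotient_map[OF N] by blast
  then interpret q: quotient_map G Q q ?N .
  note iff = series_span_Cons_iff[OF q.quotient_map_axioms c]
  have sub: "series_span G (c # cs) \<subseteq> carrier G"
  proof
    fix a assume "a \<in> series_span G (c # cs)"
    then obtain k :: int and x where "a = c [^] k \<otimes> x" "x \<in> ?N" by auto
    then show "a \<in> carrier G" using c q.subset by auto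
  qed
  have "subgroup (series_span G (c # cs)) G"
  proof (rule subgroupI[OF sub])
    show "series_span G (c # cs) \<noteq> {}"
      using q.one_closed by (simp only: series_span.simps) blast
  next
    fix a assume a: "a \<in> series_span G (c # cs)"
    then have aG: "a \<in> carrier G" using sub by blast
    then obtain k :: int where "q a = q c [^]\<^bsub>Q\<^esub> k" using a iff[OF aG] by metis
    then have "q (inv a) = q c [^]\<^bsub>Q\<^esub> (- k)"
      using aG c by (simp add: q.H.int_pow_neg)
    then show "inv a \<in> series_span G (c # cs)" unfolding iff[OF inv_closed[OF aG]] by (rule exI)
  next
    fix a b assume ab: "a \<in> series_span G (c # cs)" "b \<in> series_span G (c # cs)"
    then have abG: "a \<in> carrier G" "b \<in> carrier G" using sub by blast+
    then obtain k l :: int where "q a = q c [^]\<^bsub>Q\<^esub> k" "q b = q c [^]\<^bsub>Q\<^esub> l"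
      using ab iff[OF abG(1)] iff[OF abG(2)] by metis
    then have "q (a \<otimes> b) = q c [^]\<^bsub>Q\<^esub> (k + l)"
      using abG c by (simp add: q.H.int_pow_mult)
    then show "a \<otimes> b \<in> series_span G (c # cs)"
      unfolding iff[OF m_closed[OF abG]] by (rule exI)
  qed
  moreover have "g \<otimes> a \<otimes> inv g \<in> series_span G (c # cs)"
    if a: "a \<in> series_span G (c # cs)" and g: "g \<in> carrier G" for g a
  proof -
    have aG: "a \<in> carrier G" using a sub by blast
    obtain k :: int and x where a_eq: "a = c [^] k \<otimes> x" and x: "x \<in> ?N" using a by auto
    have "centralizes G ?N g (c [^] k)"
      using q.centralizes_generate[of g "{c}" "c [^] k"] cent[OF g] g c generate_pow[OF c] by blast
    then have "centralizes G ?N g a"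
      using subgroup.m_closed[OF q.subgroup_centralizer'[OF g], of "c [^] k" x] x c g
        q.centralizes_member[OF g x] unfolding a_eq by auto
    then have "q g \<otimes>\<^bsub>Q\<^esub> q a = q a \<otimes>\<^bsub>Q\<^esub> q g" using q.centralizes_iff g aG by blast
    then have "q (g \<otimes> a \<otimes> inv g) = q a"
      using g aG by (simp add: q.H.m_assoc)
    then show ?thesis using iff[OF aG] iff[of "g \<otimes> a \<otimes> inv g"] a g aG
      by (simp del: series_span.simps)
  qed
  ultimately show ?case unfolding normal_inv_iff by blast
qed

lemma series_span_subset: "central_series G cs \<Longrightarrow> series_span G cs \<subseteq> carrier G"
  using central_series_normal normal_imp_subgroup subgroup.subset by blast

lemma central_series_appendD:
  "central_series G (bs @ cs) \<Longrightarrow> central_series G cs"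
  by (induction bs) auto

lemma series_span_append_subset: "central_series G (bs @ cs) \<Longrightarrow> series_span G cs \<subseteq> series_span G (bs @ cs)"
proof (induction bs)
  case (Cons b bs)
  then have sub: "series_span G (bs @ cs) \<subseteq> carrier G"
    by (intro series_span_subset) simp
  have "x \<in> series_span G ((b # bs) @ cs)" if "x \<in> series_span G (bs @ cs)" for x
    using that sub by (force intro: exI[of _ "0::int"])
  with Cons show ?case by auto
qed simp

lemma set_subset_series_span: "central_series G cs \<Longrightarrow> set cs \<subseteq> series_span G cs"
proof (induction cs)
  case (Cons c cs)
  then interpret N: normal "series_span G cs" G using central_series_normal by simp
  have "c \<in> series_span G (c # cs)"
    using series_span_ConsI[OF N.one_closed, of c 1] Cons.prems by (simp del: series_span.simps)
  moreover have "series_span G cs \<subseteq> series_span G (c # cs)"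
    using series_span_append_subset[of "[c]" cs] Cons.prems by simp
  ultimately show ?case using Cons by auto
qed simp

text \<open>The certificates for the search speak of generated subgroups, whose elements are listed
  by words; this identity translates them into spans, where the factors are visible.\<close>

lemma series_span_eq_generate: "central_series G cs \<Longrightarrow> series_span G cs = generate G (set cs)"
proof
  assume cs: "central_series G cs"
  then interpret N: normal "series_span G cs" G by (rule central_series_normal)
  show "generate G (set cs) \<subseteq> series_span G cs"
    by (rule generate_subgroup_incl[OF set_subset_series_span[OF cs] N.subgroup_axioms])
  show "series_span G cs \<subseteq> generate G (set cs)" using cs
  proof (induction cs)
    case (Cons c cs)
    then have c: "set (c # cs) \<subseteq> carrier G"
      using set_subset_series_span[of "c # cs"] series_span_subset[of "c # cs"] by blast
    interpret S: subgroup "generate G (set (c # cs))" G by (rule generate_is_subgroup[OF c])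
    have "series_span G cs \<subseteq> generate G (set (c # cs))"
      using Cons mono_generate[of "set cs" "set (c # cs)"] by auto
    moreover have "c [^] (k::int) \<in> generate G (set (c # cs))" for k
      by (rule subgroup_int_pow_closed[OF S.subgroup_axioms]) (simp add: generate.incl)
    ultimately show ?case using S.m_closed by auto
  qed (simp add: generate.one)
qed

text \<open>Elements that are central modulo the same lower span may be stacked in any order, since
  enlarging the lower span keeps the commutators inside it.\<close>

lemma central_series_append:
  assumes "central_series G cs" "set bs \<subseteq> carrier G"
    "\<And>g b. g \<in> carrier G \<Longrightarrow> b \<in> set bs \<Longrightarrow> centralizes G (series_span G cs) g b"
  shows "central_series G (bs @ cs)"
  using assms(2,3)
proof (induction bs)
  case (Cons b bs)
  then have "central_series G (bs @ cs)" by simp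
  with Cons series_span_append_subset[OF this] show ?case
    by (auto simp: centralizes_def)
qed (simp add: assms(1))

end

section \<open>Finite generation along the lower central series, and series through a normal
  subgroup\<close>

definition commutator_subgroup :: "('a, 'b) monoid_scheme \<Rightarrow> 'a set \<Rightarrow> 'a set" where
  "commutator_subgroup G N = generate G
    {a \<otimes>\<^bsub>G\<^esub> b \<otimes>\<^bsub>G\<^esub> inv\<^bsub>G\<^esub> a \<otimes>\<^bsub>G\<^esub> inv\<^bsub>G\<^esub> b | a b. a \<in> N \<and> b \<in> carrier G}"

lemma lower_central_Suc: "lower_central G (Suc n) = commutator_subgroup G (lower_central G n)"
  by (simp add: commutator_subgroup_def)

declare lower_central.simps(2) [simp del]

text \<open>The generator is the least positive element, by division with remainder;
  \<open>d = 0\<close> is kept for the trivial subgroup, where no nonzero exponent is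
  attained.\<close>

lemma int_subgroup_principal:
  assumes "(0::int) \<in> I" "\<And>a b. a \<in> I \<Longrightarrow> b \<in> I \<Longrightarrow> a - b \<in> I"
  shows "\<exists>d\<in>I. d \<ge> 0 \<and> (\<forall>k\<in>I. d dvd k)"
proof (cases "\<exists>k\<in>I. k \<noteq> 0")
  case False
  then show ?thesis using assms(1) by (intro bexI[of _ 0]) auto
next
  case True
  have neg: "- a \<in> I" if "a \<in> I" for a using assms(2)[OF assms(1) that] by simp
  have add: "a + b \<in> I" if "a \<in> I" "b \<in> I" for a b
    using assms(2)[OF that(1) neg[OF that(2)]] by simp
  have nmult: "int n * a \<in> I" if "a \<in> I" for n a
    by (induction n) (use assms(1) add that in \<open>auto simp: distrib_right\<close>)
  have mult: "k * a \<in> I" if "a \<in> I" for k a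
    using nmult[OF that, of "nat k"] nmult[OF neg[OF that], of "nat (- k)"] by (cases "k \<ge> 0") auto
  have "\<exists>n>0. int n \<in> I"
  proof -
    obtain k where "k \<in> I" "k \<noteq> 0" using True by blast
    then have "int (nat \<bar>k\<bar>) \<in> I" "nat \<bar>k\<bar> > 0" using neg by (auto simp: abs_if)
    then show ?thesis by blast
  qed
  then obtain n where n: "n > 0" "int n \<in> I" "\<And>m. m < n \<Longrightarrow> \<not> (m > 0 \<and> int m \<in> I)"
    using exists_least_iff[of "\<lambda>n. n > 0 \<and> int n \<in> I"] by auto
  have "int n dvd k" if "k \<in> I" for k
  proof -
    have "k - (k div int n) * int n \<in> I" by (intro assms(2) mult n that)
    then have "k mod int n \<in> I" by (simp add: minus_div_mult_eq_mod)
    then have "\<not> nat (k mod int n) > 0" using n(3)[of "nat (k mod int n)"] n(1)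
        pos_mod_bound[of "int n" k] by (auto simp: nat_less_iff)
    moreover have "k mod int n \<ge> 0" using n(1) by simp
    ultimately show ?thesis by (simp add: dvd_eq_mod_eq_0)
  qed
  then show ?thesis using n by (intro bexI[of _ "int n"]) auto
qed

context group begin

lemma commutator_subgroup_normal:
  assumes "N \<lhd> G"
  shows "commutator_subgroup G N \<lhd> G" "commutator_subgroup G N \<subseteq> N"
    and "\<And>a b. a \<in> N \<Longrightarrow> b \<in> carrier G \<Longrightarrow> centralizes G (commutator_subgroup G N) a b"
proof -
  interpret N: normal N G by (rule assms)
  let ?C = "{a \<otimes> b \<otimes> inv a \<otimes> inv b | a b. a \<in> N \<and> b \<in> carrier G}"
  show "commutator_subgroup G N \<lhd> G" unfolding commutator_subgroup_def
  proof (rule normal_generateI)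
    show "?C \<subseteq> carrier G" by auto
    fix h g assume "h \<in> ?C" and g: "g \<in> carrier G"
    then obtain a b where ab: "a \<in> N" "b \<in> carrier G" "h = a \<otimes> b \<otimes> inv a \<otimes> inv b" by blast
    have "g \<otimes> h \<otimes> inv g = (g \<otimes> a \<otimes> inv g) \<otimes> (g \<otimes> b \<otimes> inv g) \<otimes> inv (g \<otimes> a \<otimes> inv g) \<otimes> inv (g \<otimes> b \<otimes> inv g)"
      using ab g by (simp add: inv_mult_group m_assoc)
    moreover have "g \<otimes> a \<otimes> inv g \<in> N" using N.inv_op_closed2 g ab by blast
    ultimately show "g \<otimes> h \<otimes> inv g \<in> ?C" using g ab(2) by auto
  qed
  have "?C \<subseteq> N"
  proof
    fix h assume "h \<in> ?C"
    then obtain a b where ab: "a \<in> N" "b \<in> carrier G" "h = a \<otimes> b \<otimes> inv a \<otimes> inv b" by blast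
    then have "h = a \<otimes> (b \<otimes> inv a \<otimes> inv b)" by (simp add: m_assoc)
    moreover have "b \<otimes> inv a \<otimes> inv b \<in> N" using ab by (intro N.inv_op_closed2) auto
    ultimately show "h \<in> N" using ab(1) by simp
  qed
  then show "commutator_subgroup G N \<subseteq> N"
    unfolding commutator_subgroup_def by (intro generate_subgroup_incl N.subgroup_axioms)
  show "centralizes G (commutator_subgroup G N) a b" if "a \<in> N" "b \<in> carrier G" for a b
    using that unfolding centralizes_def commutator_subgroup_def by (intro generate.incl) blast
qed

lemma lower_central_normal: "lower_central G n \<lhd> G"
  by (induction n)
     (simp_all add: normal_self lower_central_Suc commutator_subgroup_normal)

lemma lower_central_Suc_subset: "lower_central G (Suc n) \<subseteq> lower_central G n"
  unfolding lower_central_Suc by (rule commutator_subgroup_normal(2)[OF lower_central_normal])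

lemma normal_if_centralized:
  assumes W: "subgroup W G" and cent: "\<And>g w. g \<in> carrier G \<Longrightarrow> w \<in> W \<Longrightarrow> centralizes G W w g"
  shows "W \<lhd> G"
  unfolding normal_inv_iff
proof (intro conjI W ballI)
  fix g w assume g: "g \<in> carrier G" "w \<in> W"
  then have wG: "w \<in> carrier G" using W subgroup.subset by blast
  \<comment> \<open>A conjugate differs from the element by a commutator, and the hypothesis puts
    that commutator into \<open>W\<close>.\<close>
  have "g \<otimes> w \<otimes> inv g = inv (w \<otimes> g \<otimes> inv w \<otimes> inv g) \<otimes> w"
    using g wG by (simp add: inv_mult_group m_assoc)
  also have "\<dots> \<in> W"
    using cent[OF g] g(2) unfolding centralizes_def
    by (blast intro: subgroup.m_closed[OF W] subgroup.m_inv_closed[OF W])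
  finally show "g \<otimes> w \<otimes> inv g \<in> W" .
qed

lemma centralizes_mono: "centralizes G N a b \<Longrightarrow> N \<subseteq> M \<Longrightarrow> centralizes G M a b"
  by (auto simp: centralizes_def)

text \<open>Modulo \<open>lower_central G (n + 2)\<close> the commutator is multiplicative in both
  arguments, so the commutators of the finite set \<open>Y\<close> with the generators
  \<open>X\<close> suffice for the next factor. The proof expresses this by commutation modulo a
  normal subgroup \<open>W\<close>, tested on generators one argument at a time.\<close>

lemma lower_central_finite_generation:
  assumes "X \<subseteq> carrier G" "finite X" "generate G X = carrier G"
  shows "\<exists>Y. finite Y \<and> Y \<subseteq> lower_central G n \<and>
    lower_central G n \<subseteq> generate G (Y \<union> lower_central G (Suc n))"
proof (induction n)
  case 0
  show ?case using assms mono_generate[of X "X \<union> lower_central G 1"]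
    by (intro exI[of _ X]) simp
next
  case (Suc n)
  then obtain Y where Y: "finite Y" "Y \<subseteq> lower_central G n"
    "lower_central G n \<subseteq> generate G (Y \<union> lower_central G (Suc n))" by blast
  let ?\<gamma> = "lower_central G"
  note cent = commutator_subgroup_normal(3)[OF lower_central_normal, folded lower_central_Suc]
  define Z where "Z = (\<lambda>(y, x). y \<otimes> x \<otimes> inv y \<otimes> inv x) ` (Y \<times> X)"
  have "finite Z" using Y assms by (simp add: Z_def)
  moreover have "Z \<subseteq> ?\<gamma> (Suc n)"
  proof
    fix z assume "z \<in> Z"
    then obtain y x where "y \<in> Y" "x \<in> X" "z = y \<otimes> x \<otimes> inv y \<otimes> inv x" by (auto simp: Z_def)
    moreover have "y \<in> ?\<gamma> n" "x \<in> carrier G" using calculation Y assms by auto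
    ultimately show "z \<in> ?\<gamma> (Suc n)" using cent[of y n x] by (simp add: centralizes_def)
  qed
  ultimately have Z: "finite Z" "Z \<subseteq> ?\<gamma> (Suc n)" by auto
  have sub: "?\<gamma> (Suc (Suc n)) \<subseteq> ?\<gamma> (Suc n)"
    by (rule lower_central_Suc_subset)
  define W where "W = generate G (Z \<union> ?\<gamma> (Suc (Suc n)))"
  have ZG: "Z \<union> ?\<gamma> (Suc (Suc n)) \<subseteq> carrier G"
    using Z sub lower_central_subset by blast
  have W: "subgroup W G" unfolding W_def by (rule generate_is_subgroup[OF ZG])
  have \<gamma>W: "?\<gamma> (Suc (Suc n)) \<subseteq> W" "Z \<subseteq> W" by (auto simp: W_def intro: generate.incl)
  have W\<gamma>: "W \<subseteq> ?\<gamma> (Suc n)" unfolding W_def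
    using Z sub by (intro generate_subgroup_incl normal_imp_subgroup lower_central_normal) auto
  \<comment> \<open>Every commutator of an element of \<open>W\<close> lies in the next term of the
    lower central series, which is contained in \<open>W\<close>.\<close>
  have "W \<lhd> G"
    using W\<gamma> \<gamma>W cent[of _ "Suc n"] by (intro normal_if_centralized W) (blast intro: centralizes_mono)
  then interpret W: normal W G .
  have yx: "centralizes G W y b" if "y \<in> Y" "b \<in> carrier G" for y b
  proof (rule W.centralizes_generate)
    show "y \<in> carrier G" using that Y(2) lower_central_subset by blast
    show "centralizes G W y x" if "x \<in> X" for x
      using \<open>y \<in> Y\<close> that \<gamma>W(2) by (auto simp: centralizes_def Z_def)
  qed (use assms that in auto)
  have "centralizes G W a b" if "a \<in> ?\<gamma> n" "b \<in> carrier G" for a b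
  proof (rule W.centralizes_generate')
    show "a \<in> generate G (Y \<union> ?\<gamma> (Suc n))" using that Y by blast
    show "Y \<union> ?\<gamma> (Suc n) \<subseteq> carrier G" using Y lower_central_subset by blast
    show "centralizes G W x b" if "x \<in> Y \<union> ?\<gamma> (Suc n)" for x
      using that yx cent[of x "Suc n" b] \<open>b \<in> carrier G\<close> \<gamma>W(1) by (blast intro: centralizes_mono)
  qed (rule that)
  then have "?\<gamma> (Suc n) \<subseteq> W"
    unfolding lower_central_Suc[of G n] commutator_subgroup_def
    by (intro generate_subgroup_incl W) (auto simp: centralizes_def)
  then show ?case using Z by (intro exI[of _ Z]) (auto simp: W_def)
qed

text \<open>The index \<open>k\<close> counts terms from the trivial end: at each stage a finite set
  generating the next larger term modulo the current one is put in front of the list.\<close>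

lemma nilpotent_central_series:
  assumes "nilpotent_group n G" "X \<subseteq> carrier G" "finite X" "generate G X = carrier G"
  shows "\<exists>cs. central_series G cs \<and> series_span G cs = carrier G"
proof -
  have "\<exists>cs. central_series G cs \<and> series_span G cs = lower_central G (n - k)" if "k \<le> n" for k
    using that
  proof (induction k)
    case 0
    then show ?case using assms(1) by (intro exI[of _ "[]"]) (simp add: nilpotent_group_def)
  next
    case (Suc k)
    let ?i = "n - Suc k"
    have i: "n - k = Suc ?i" using Suc.prems by simp
    obtain cs where cs: "central_series G cs" "series_span G cs = lower_central G (Suc ?i)"
      using Suc i by auto
    obtain Y where Y: "finite Y" "Y \<subseteq> lower_central G ?i"
      "lower_central G ?i \<subseteq> generate G (Y \<union> lower_central G (Suc ?i))"
      using lower_central_finite_generation[OF assms(2-4)] by blast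
    obtain ys where ys: "set ys = Y" using finite_list[OF Y(1)] by blast
    have YG: "Y \<subseteq> carrier G" using Y(2) lower_central_subset by blast
    have cent: "centralizes G (series_span G cs) g y" if "g \<in> carrier G" "y \<in> Y" for g y
    proof -
      interpret N: normal "series_span G cs" G by (rule central_series_normal[OF cs(1)])
      show ?thesis
        using commutator_subgroup_normal(3)[OF lower_central_normal[of ?i], of y g] that Y(2) YG
          N.centralizes_sym[of g y] cs(2) by (auto simp: lower_central_Suc)
    qed
    have ser: "central_series G (ys @ cs)"
      using cent ys YG by (intro central_series_append cs) auto
    have sub: "lower_central G (Suc ?i) \<subseteq> lower_central G ?i"
      by (rule lower_central_Suc_subset)
    have "Y \<union> lower_central G (Suc ?i) \<subseteq> series_span G (ys @ cs)"
      using series_span_append_subset[OF ser] set_subset_series_span[OF ser] cs(2) ys by auto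
    then have "lower_central G ?i \<subseteq> series_span G (ys @ cs)"
      using Y(3) generate_subgroup_incl[OF _ normal_imp_subgroup[OF central_series_normal[OF ser]]]
      by blast
    moreover have "set cs \<subseteq> lower_central G ?i"
      using set_subset_series_span[OF cs(1)] cs(2) sub by blast
    then have "series_span G (ys @ cs) \<subseteq> lower_central G ?i"
      unfolding series_span_eq_generate[OF ser]
      using Y(2) ys by (intro generate_subgroup_incl normal_imp_subgroup lower_central_normal) auto
    ultimately show ?case using ser by blast
  qed
  from this[of n] show ?thesis by simp
qed

lemma centralizes_series_span_Cons:
  assumes "central_series G (c # cs)" "a \<in> series_span G (c # cs)" "g \<in> carrier G"
  shows "centralizes G (series_span G cs) g a"
proof -
  interpret N: normal "series_span G cs" G using assms by (simp add: central_series_normal)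
  obtain k :: int and x where a: "a = c [^] k \<otimes> x" "x \<in> series_span G cs" using assms by auto
  have c: "c \<in> carrier G" using assms by simp
  have "centralizes G (series_span G cs) g (c [^] k)"
    using N.centralizes_generate[of g "{c}" "c [^] k"] assms c generate_pow[OF c] by auto
  then show ?thesis
    using subgroup.m_closed[OF N.subgroup_centralizer'[OF assms(3)], of "c [^] k" x] c a
      N.centralizes_member[OF assms(3) a(2)] by auto
qed

text \<open>The factors of \<open>rs\<close> are cut down to \<open>A\<close> one at a time and
  stacked on \<open>ds\<close>. At a factor generated by \<open>c\<close> the exponents attained by
  elements of \<open>A\<close> form a group of integers, and one element of \<open>A\<close>
  attaining its generator is added. When \<open>rs\<close> spans the group, an empty
  \<open>ds\<close> yields a series of \<open>A\<close>, and any other \<open>ds\<close> inside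
  \<open>A\<close> is extended up to \<open>A\<close>.\<close>

lemma central_series_refine:
  assumes "central_series G rs" "A \<lhd> G" "central_series G ds" "series_span G ds \<subseteq> A"
  shows "\<exists>es. central_series G (es @ ds) \<and> A \<inter> series_span G rs \<subseteq> series_span G (es @ ds) \<and>
    series_span G (es @ ds) \<subseteq> A"
  using assms(1)
proof (induction rs)
  case Nil
  then show ?case
    using assms normal_imp_subgroup[OF central_series_normal[OF assms(3)]] subgroup.one_closed
    by (intro exI[of _ "[]"]) auto
next
  case (Cons c rs)
  then obtain es where es: "central_series G (es @ ds)"
    "A \<inter> series_span G rs \<subseteq> series_span G (es @ ds)" "series_span G (es @ ds) \<subseteq> A" by auto
  let ?N = "series_span G rs"
  have c: "c \<in> carrier G" using Cons.prems by simp
  interpret A: normal A G by (rule assms)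
  have N: "?N \<lhd> G" using Cons.prems by (simp add: central_series_normal)
  obtain Q :: "'a set monoid" and q where "quotient_map G Q q ?N"
    using normal.ex_quotient_map[OF N] by blast
  then interpret q: quotient_map G Q q ?N .
  define I where "I = {k::int. \<exists>x\<in>?N. c [^] k \<otimes> x \<in> A}"
  have I_iff: "k \<in> I \<longleftrightarrow> (\<exists>a\<in>A. q a = q c [^]\<^bsub>Q\<^esub> k)" for k
  proof
    assume "k \<in> I"
    then obtain x where x: "x \<in> ?N" "c [^] k \<otimes> x \<in> A" unfolding I_def by blast
    then have "q (c [^] k \<otimes> x) = q c [^]\<^bsub>Q\<^esub> k"
      using q.mem_cyclic_extension_iff[OF c, of "c [^] k \<otimes> x" k] A.subset by blast
    then show "\<exists>a\<in>A. q a = q c [^]\<^bsub>Q\<^esub> k" using x(2) by blast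
  next
    assume "\<exists>a\<in>A. q a = q c [^]\<^bsub>Q\<^esub> k"
    then obtain a where a: "a \<in> A" "q a = q c [^]\<^bsub>Q\<^esub> k" by blast
    then obtain x where "x \<in> ?N" "a = c [^] k \<otimes> x"
      using q.mem_cyclic_extension_iff[OF c, of a k] A.subset by blast
    then show "k \<in> I" using a(1) unfolding I_def by blast
  qed
  have "\<exists>d\<in>I. d \<ge> 0 \<and> (\<forall>k\<in>I. d dvd k)"
  proof (rule int_subgroup_principal)
    show "0 \<in> I" unfolding I_iff using c A.one_closed by (intro bexI[of _ \<one>]) auto
    fix k l assume "k \<in> I" "l \<in> I"
    then obtain a b where ab: "a \<in> A" "q a = q c [^]\<^bsub>Q\<^esub> k" "b \<in> A" "q b = q c [^]\<^bsub>Q\<^esub> l"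
      unfolding I_iff by blast
    have "q (a \<otimes> inv b) = q c [^]\<^bsub>Q\<^esub> (k - l)"
      using ab c by (simp add: q.H.int_pow_diff)
    then show "k - l \<in> I" unfolding I_iff using ab A.m_closed A.m_inv_closed by blast
  qed
  then obtain d where d: "d \<in> I" "\<And>k. k \<in> I \<Longrightarrow> d dvd k" by blast
  then obtain x where x: "x \<in> ?N" "c [^] d \<otimes> x \<in> A" unfolding I_def by blast
  define a where "a = c [^] d \<otimes> x"
  have aA: "a \<in> A" and aS: "a \<in> series_span G (c # rs)" and aG: "a \<in> carrier G"
    using x c by (auto simp: a_def)
  have qa: "q a = q c [^]\<^bsub>Q\<^esub> d"
    using q.mem_cyclic_extension_iff[OF c aG, of d] x a_def by blast
  \<comment> \<open>The commutator lies in \<open>A\<close> because \<open>A\<close> is normal, and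
    in the span of \<open>rs\<close> because \<open>c # rs\<close> is central; the induction
    hypothesis covers the intersection.\<close>
  have "centralizes G (series_span G (es @ ds)) g a" if g: "g \<in> carrier G" for g
    using A.centralizes_member[OF g aA] centralizes_series_span_Cons[OF Cons.prems aS g] es(2)
    by (auto simp: centralizes_def)
  then have ser: "central_series G ((a # es) @ ds)" using es(1) aG by simp
  have "A \<inter> series_span G (c # rs) \<subseteq> series_span G ((a # es) @ ds)"
  proof
    fix b assume b: "b \<in> A \<inter> series_span G (c # rs)"
    then have bG: "b \<in> carrier G" using A.subset by blast
    obtain k :: int and y where k: "b = c [^] k \<otimes> y" "y \<in> ?N" using b by auto
    then have "k \<in> I" unfolding I_def using b by blast
    then obtain t where t: "k = d * t" using d(2) by (auto elim: dvdE)
    have qb: "q b = q c [^]\<^bsub>Q\<^esub> k" using q.mem_cyclic_extension_iff[OF c bG, of k] k by blast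
    \<comment> \<open>Dividing \<open>b\<close> by the right power of \<open>a\<close> removes the
      exponent of \<open>c\<close> and leaves an element of \<open>A\<close> in the span of
      \<open>rs\<close>.\<close>
    have "q (inv (a [^] t) \<otimes> b) = \<one>\<^bsub>Q\<^esub>"
      using aG bG qa qb c by (simp add: q.hom_int_pow t q.H.int_pow_pow)
    then have "inv (a [^] t) \<otimes> b \<in> ?N" using q.eq_one_iff[of "inv (a [^] t) \<otimes> b"] aG bG by blast
    moreover have "inv (a [^] t) \<otimes> b \<in> A"
      using b subgroup_int_pow_closed[OF A.subgroup_axioms aA] by blast
    ultimately have "inv (a [^] t) \<otimes> b \<in> series_span G (es @ ds)" using es by blast
    then have "a [^] t \<otimes> (inv (a [^] t) \<otimes> b) \<in> series_span G (a # es @ ds)"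
      by (rule series_span_ConsI)
    then show "b \<in> series_span G ((a # es) @ ds)" using aG bG by (simp del: series_span.simps)
  qed
  moreover have "series_span G ((a # es) @ ds) \<subseteq> A"
  proof
    fix b assume "b \<in> series_span G ((a # es) @ ds)"
    then obtain k :: int and y where "b = a [^] k \<otimes> y" "y \<in> series_span G (es @ ds)" by auto
    then show "b \<in> A"
      using subgroup.m_closed[OF A.subgroup_axioms subgroup_int_pow_closed[OF A.subgroup_axioms aA]] es(3)
      by blast
  qed
  ultimately show ?case using ser by blast
qed

end

section \<open>Invariance of the number of infinite factors\<close>

definition infinite_factor :: "('a, 'b) monoid_scheme \<Rightarrow> 'a \<Rightarrow> 'a list \<Rightarrow> bool" where
  "infinite_factor G c cs \<longleftrightarrow> (\<forall>m::nat. m > 0 \<longrightarrow> c [^]\<^bsub>G\<^esub> m \<notin> series_span G cs)"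

text \<open>For a subgroup \<open>H\<close> this is its Hirsch length measured along
  \<open>cs\<close>: an infinite cyclic factor counts when the trace of \<open>H\<close> in it is
  nontrivial, hence infinite. Measuring the terms of one series along another replaces a common
  refinement of the two.\<close>

primrec series_rank :: "('a, 'b) monoid_scheme \<Rightarrow> 'a list \<Rightarrow> 'a set \<Rightarrow> nat" where
  "series_rank G [] H = 0"
| "series_rank G (c # cs) H = series_rank G cs H +
     (if infinite_factor G c cs \<and> \<not> H \<inter> series_span G (c # cs) \<subseteq> series_span G cs then 1 else 0)"

primrec infinite_length :: "('a, 'b) monoid_scheme \<Rightarrow> 'a list \<Rightarrow> nat" where
  "infinite_length G [] = 0"
| "infinite_length G (c # cs) = infinite_length G cs + (if infinite_factor G c cs then 1 else 0)"

context group begin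

lemma infinite_factor_int_pow:
  assumes "central_series G (c # cs)" "infinite_factor G c cs" "c [^] (k::int) \<in> series_span G cs"
  shows "k = 0"
proof (rule ccontr)
  assume "k \<noteq> 0"
  interpret N: normal "series_span G cs" G using assms(1) by (simp add: central_series_normal)
  have c: "c \<in> carrier G" using assms(1) by simp
  have "c [^] \<bar>k\<bar> \<in> series_span G cs"
    using assms(3) N.m_inv_closed[OF assms(3)] int_pow_neg[OF c, of k] by (simp add: abs_if)
  then have "c [^] nat \<bar>k\<bar> \<in> series_span G cs" using int_pow_int[of G c "nat \<bar>k\<bar>"] by simp
  moreover have "nat \<bar>k\<bar> > 0" using \<open>k \<noteq> 0\<close> by simp
  ultimately show False using assms(2) unfolding infinite_factor_def by blast
qed

lemma series_span_quotient:
  assumes "central_series G (c # cs)" "quotient_map G Q q (series_span G cs)" "a \<in> series_span G (c # cs)"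
  shows "\<exists>k::int. q a = q c [^]\<^bsub>Q\<^esub> k"
  using series_span_Cons_iff[OF assms(2), of c a] assms series_span_subset[OF assms(1)]
  by (metis central_series.simps(2) subsetD)

lemma series_span_int_pow:
  "central_series G cs \<Longrightarrow> a \<in> series_span G cs \<Longrightarrow> a [^] (k::int) \<in> series_span G cs"
  by (rule subgroup_int_pow_closed[OF normal_imp_subgroup[OF central_series_normal]])

text \<open>An infinite cyclic quotient has no torsion: a nonzero power becomes trivial there only
  if the element does.\<close>

lemma infinite_factor_pow_mem:
  assumes "central_series G (c # cs)" "infinite_factor G c cs" "a \<in> series_span G (c # cs)"
    "a [^] (m::int) \<in> series_span G cs" "m \<noteq> 0"
  shows "a \<in> series_span G cs"
proof -
  have c: "c \<in> carrier G" and N: "series_span G cs \<lhd> G"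
    using assms(1) by (simp_all add: central_series_normal)
  have aG: "a \<in> carrier G" using assms(3) series_span_subset[OF assms(1)] by blast
  obtain Q :: "'a set monoid" and q where qm: "quotient_map G Q q (series_span G cs)"
    using normal.ex_quotient_map[OF N] by blast
  then interpret q: quotient_map G Q q "series_span G cs" .
  obtain k :: int where k: "q a = q c [^]\<^bsub>Q\<^esub> k"
    using series_span_quotient[OF assms(1) qm assms(3)] by blast
  have "q (c [^] (k * m)) = q (a [^] m)" using k c aG by (simp add: q.hom_int_pow q.H.int_pow_pow)
  also have "\<dots> = \<one>\<^bsub>Q\<^esub>" using q.eq_one_iff assms(4) int_pow_closed[OF aG] by blast
  finally have "c [^] (k * m) \<in> series_span G cs" using q.eq_one_iff int_pow_closed[OF c] by blast
  then have "k * m = 0" by (rule infinite_factor_int_pow[OF assms(1,2)])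
  then have "q a = \<one>\<^bsub>Q\<^esub>" using k assms(5) by simp
  then show ?thesis using q.eq_one_iff[OF aG] by blast
qed

text \<open>An infinite factor met by \<open>H\<close> is also met by \<open>K\<close>, through a
  nonzero power of the same element, since such factors have no torsion.\<close>

lemma series_rank_le_if_torsion:
  assumes "central_series G cs" "\<And>h. h \<in> H \<Longrightarrow> \<exists>m\<noteq>0. h [^] (m::int) \<in> K"
  shows "series_rank G cs H \<le> series_rank G cs K"
  using assms(1)
proof (induction cs)
  case (Cons c cs)
  have "\<not> K \<inter> series_span G (c # cs) \<subseteq> series_span G cs"
    if inf: "infinite_factor G c cs" and H: "\<not> H \<inter> series_span G (c # cs) \<subseteq> series_span G cs"
  proof -
    obtain h where h: "h \<in> H" "h \<in> series_span G (c # cs)" "h \<notin> series_span G cs" using H by blast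
    obtain m :: int where m: "m \<noteq> 0" "h [^] m \<in> K" using assms(2)[OF h(1)] by blast
    then show ?thesis
      using infinite_factor_pow_mem[OF Cons.prems inf h(2) _ m(1)] h(3)
        series_span_int_pow[OF Cons.prems h(2), of m] by blast
  qed
  then show ?case using Cons by (simp del: series_span.simps)
qed simp

text \<open>Going down \<open>cs\<close>, consider the first infinite factor met by \<open>H\<close>
  but not by \<open>K\<close>. Below it every element of \<open>H\<close> already lies in
  \<open>K\<close>: otherwise two elements of \<open>H\<close> would be independent modulo
  \<open>K\<close>, which a cyclic extension forbids. So at most this one factor is gained.\<close>

lemma series_rank_le_if_cyclic:
  assumes "central_series G cs" "K \<lhd> G" "H \<subseteq> carrier G" "d \<in> carrier G"
    and H: "\<And>h. h \<in> H \<Longrightarrow> \<exists>(k::int). \<exists>x\<in>K. h = d [^] k \<otimes> x"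
  shows "series_rank G cs H \<le> series_rank G cs K + 1"
  using assms(1)
proof (induction cs)
  case (Cons c cs)
  let ?jump = "\<lambda>H c cs. infinite_factor G c cs \<and> \<not> H \<inter> series_span G (c # cs) \<subseteq> series_span G cs"
  have N: "series_span G cs \<lhd> G" and c: "c \<in> carrier G" and cs: "central_series G cs"
    using Cons.prems by (simp_all add: central_series_normal)
  show ?case
  proof (cases "?jump H c cs \<and> \<not> ?jump K c cs")
    case False
    then show ?thesis using Cons.IH[OF cs] by (auto simp del: series_span.simps)
  next
    case True
    then obtain x where x: "x \<in> H" "x \<in> series_span G (c # cs)" "x \<notin> series_span G cs"
      and inf: "infinite_factor G c cs" and K: "K \<inter> series_span G (c # cs) \<subseteq> series_span G cs" by blast
    obtain Q :: "'a set monoid" and q where "quotient_map G Q q K"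
      using normal.ex_quotient_map[OF assms(2)] by blast
    then interpret q: quotient_map G Q q K .
    have sub: "series_span G cs \<subseteq> series_span G (c # cs)"
      using series_span_append_subset[of "[c]" cs] Cons.prems by simp
    have xG: "x \<in> carrier G" using x(1) assms(3) by blast
    obtain a :: int where a: "q x = q d [^]\<^bsub>Q\<^esub> a"
      using H[OF x(1)] q.mem_cyclic_extension_iff[OF assms(4) xG] by metis
    have "y \<in> K" if y: "y \<in> H" "y \<in> series_span G cs" for y
    proof (rule ccontr)
      assume "y \<notin> K"
      have yG: "y \<in> carrier G" using y(1) assms(3) by blast
      obtain b :: int where b: "q y = q d [^]\<^bsub>Q\<^esub> b"
        using H[OF y(1)] q.mem_cyclic_extension_iff[OF assms(4) yG] by metis
      have "b \<noteq> 0"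
      proof
        assume "b = 0"
        then have "q y = \<one>\<^bsub>Q\<^esub>" using b by simp
        then show False using q.eq_one_iff[OF yG] \<open>y \<notin> K\<close> by blast
      qed
      \<comment> \<open>The exponents of \<open>d\<close> cancel in this product, so
        \<open>z\<close> lies in \<open>K\<close>. As \<open>K\<close> does not meet the factor,
        \<open>z\<close> and hence \<open>x [^] b\<close> fall into the lower span, against the
        choice of \<open>x\<close>.\<close>
      define z where "z = x [^] b \<otimes> y [^] (- a)"
      have zG: "z \<in> carrier G" using xG yG by (simp add: z_def)
      have "q z = \<one>\<^bsub>Q\<^esub>"
        using xG yG assms(4) a b
        by (simp add: z_def q.hom_int_pow q.H.int_pow_pow q.H.int_pow_mult[symmetric] mult.commute)
      then have zK: "z \<in> K" using q.eq_one_iff[OF zG] by blast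
      have yS: "y [^] (- a) \<in> series_span G cs" by (rule series_span_int_pow[OF cs y(2)])
      have "z \<in> series_span G (c # cs)" unfolding z_def
        using subgroup.m_closed[OF normal_imp_subgroup[OF central_series_normal[OF Cons.prems]]]
          series_span_int_pow[OF Cons.prems x(2), of b] yS sub by blast
      then have "z \<in> series_span G cs" using zK K by blast
      then have "z \<otimes> inv (y [^] (- a)) \<in> series_span G cs"
        using yS normal_imp_subgroup[OF N] by (intro subgroup.m_closed subgroup.m_inv_closed)
      moreover have "z \<otimes> inv (y [^] (- a)) = x [^] b" using xG yG by (simp add: z_def m_assoc)
      ultimately have "x [^] b \<in> series_span G cs" by metis
      then show False using infinite_factor_pow_mem[OF Cons.prems inf x(2) _ \<open>b \<noteq> 0\<close>] x(3) by blast
    qed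
    then have "series_rank G bs H \<le> series_rank G bs K"
      if "central_series G bs" "series_span G bs \<subseteq> series_span G cs" for bs
      using that
    proof (induction bs)
      case (Cons b bs)
      have "series_span G bs \<subseteq> series_span G (b # bs)"
        using series_span_append_subset[of "[b]" bs] Cons.prems by simp
      then have "series_rank G bs H \<le> series_rank G bs K" using Cons by simp
      moreover have "H \<inter> series_span G (b # bs) \<subseteq> K" using Cons by blast
      ultimately show ?case by (auto simp del: series_span.simps)
    qed simp
    from this[OF cs] show ?thesis using True by auto
  qed
qed simp

text \<open>Climbing \<open>ds\<close>, a finite factor does not raise the rank since suitable
  powers fall back into the lower term, while an infinite factor raises it by at most one.\<close>

lemma series_rank_le_infinite_length:
  assumes "central_series G cs" "central_series G ds"
  shows "series_rank G cs (series_span G ds) \<le> infinite_length G ds"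
  using assms(2)
proof (induction ds)
  case Nil
  have "series_rank G cs {\<one>} = 0" using assms(1)
  proof (induction cs)
    case (Cons c cs)
    then have "{\<one>} \<subseteq> series_span G cs"
      using subgroup.one_closed[OF normal_imp_subgroup[OF central_series_normal]] by auto
    with Cons show ?case by (auto simp del: series_span.simps)
  qed simp
  then show ?case by simp
next
  case (Cons d ds)
  then have IH: "series_rank G cs (series_span G ds) \<le> infinite_length G ds"
    and ds: "central_series G ds" and d: "d \<in> carrier G" by simp_all
  have N: "series_span G ds \<lhd> G" by (rule central_series_normal[OF ds])
  show ?case
  proof (cases "infinite_factor G d ds")
    case True
    have "series_rank G cs (series_span G (d # ds)) \<le> series_rank G cs (series_span G ds) + 1"
      by (rule series_rank_le_if_cyclic[OF assms(1) N series_span_subset[OF Cons.prems] d]) auto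
    then show ?thesis using IH True by (simp del: series_span.simps)
  next
    case False
    then obtain m :: nat where m: "m > 0" "d [^] m \<in> series_span G ds"
      unfolding infinite_factor_def by blast
    obtain Q :: "'a set monoid" and q where qm: "quotient_map G Q q (series_span G ds)"
      using normal.ex_quotient_map[OF N] by blast
    then interpret q: quotient_map G Q q "series_span G ds" .
    have "q (d [^] int m) = \<one>\<^bsub>Q\<^esub>"
      using q.eq_one_iff[of "d [^] int m"] m(2) d by (simp add: int_pow_int)
    then have qd: "q d [^]\<^bsub>Q\<^esub> int m = \<one>\<^bsub>Q\<^esub>" using d by (simp add: q.hom_int_pow)
    have "h [^] int m \<in> series_span G ds" if h: "h \<in> series_span G (d # ds)" for h
    proof -
      have hG: "h \<in> carrier G" using h series_span_subset[OF Cons.prems] by blast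
      obtain k :: int where k: "q h = q d [^]\<^bsub>Q\<^esub> k"
        using series_span_quotient[OF Cons.prems qm h] by blast
      have "q (h [^] int m) = (q d [^]\<^bsub>Q\<^esub> int m) [^]\<^bsub>Q\<^esub> k"
        using hG d k by (simp add: q.hom_int_pow q.H.int_pow_pow mult.commute)
      then have "q (h [^] int m) = \<one>\<^bsub>Q\<^esub>" using qd by simp
      then show ?thesis using q.eq_one_iff[OF int_pow_closed[OF hG]] by blast
    qed
    then have "series_rank G cs (series_span G (d # ds)) \<le> series_rank G cs (series_span G ds)"
      using m(1) by (intro series_rank_le_if_torsion[OF assms(1)] exI[of _ "int m"]) auto
    then show ?thesis using IH False by (simp del: series_span.simps)
  qed
qed

lemma infinite_length_le_series_rank:
  "central_series G cs \<Longrightarrow> series_span G cs \<subseteq> H \<Longrightarrow> infinite_length G cs \<le> series_rank G cs H"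
proof (induction cs)
  case (Cons c cs)
  have sub: "series_span G cs \<subseteq> series_span G (c # cs)"
    using series_span_append_subset[of "[c]" cs] Cons.prems by simp
  then have "infinite_length G cs \<le> series_rank G cs H" using Cons by simp
  moreover have "c \<in> H \<inter> series_span G (c # cs)"
    using set_subset_series_span[OF Cons.prems(1)] Cons.prems(2) by auto
  moreover have "c \<notin> series_span G cs" if "infinite_factor G c cs"
    using that[unfolded infinite_factor_def, rule_format, of 1] Cons.prems by simp
  ultimately show ?case by (auto simp del: series_span.simps)
qed simp

text \<open>The rank of the whole group along \<open>cs\<close> is at least the number of infinite
  factors of \<open>cs\<close> and at most that of \<open>ds\<close>; then the roles are
  exchanged.\<close>

lemma infinite_length_invariant:
  assumes "central_series G cs" "series_span G cs = carrier G"
    and "central_series G ds" "series_span G ds = carrier G"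
  shows "infinite_length G cs = infinite_length G ds"
  using infinite_length_le_series_rank[OF assms(1) order_refl]
    infinite_length_le_series_rank[OF assms(3) order_refl]
    series_rank_le_infinite_length[OF assms(1,3)] series_rank_le_infinite_length[OF assms(3,1)]
    assms(2,4) by simp

end

section \<open>Positive relations and invariant functionals\<close>

text \<open>Stiemke's alternative over the integers, by induction on the coordinates:
  \<open>L\<close> is to be read as a module of relations, and the outcomes are a strictly positive
  relation or a nonzero nonnegative functional annihilating all relations. Integers suffice because
  each elimination only cross-multiplies.\<close>

lemma stiemke_int:
  fixes L :: "('a \<Rightarrow> int) set"
  assumes "finite S" "L \<noteq> {}"
    and "\<And>u v a b. u \<in> L \<Longrightarrow> v \<in> L \<Longrightarrow> (\<lambda>s. a * u s + b * v s) \<in> L"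
  shows "(\<exists>v\<in>L. \<forall>s\<in>S. v s > 0) \<or>
    (\<exists>f. (\<forall>s\<in>S. f s \<ge> 0) \<and> (\<exists>s\<in>S. f s > 0) \<and> (\<forall>u\<in>L. (\<Sum>s\<in>S. f s * u s) = 0))"
  using assms
proof (induction S arbitrary: L rule: finite_induct)
  case empty
  then show ?case by auto
next
  case (insert x S)
  note comb = insert.prems(2)
  have sum_insert: "(\<Sum>s\<in>insert x S. f s * u s) = f x * u x + (\<Sum>s\<in>S. f s * u s)" for f u :: "'a \<Rightarrow> int"
    using insert.hyps by simp
  \<comment> \<open>A large multiple of a strictly positive vector absorbs any other vector;
    \<open>K\<close> exceeds every absolute value that has to be compensated.\<close>
  have dominate: "\<exists>K>0. \<forall>s\<in>S. K * w s + u s > 0" if w: "\<forall>s\<in>S. w s > 0" for w u :: "'a \<Rightarrow> int"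
  proof -
    define K where "K = 1 + (\<Sum>s\<in>S. \<bar>u s\<bar>)"
    have K: "K > 0" by (simp add: K_def add_pos_nonneg sum_nonneg)
    have "K * w s + u s > 0" if s: "s \<in> S" for s
    proof -
      have "\<bar>u s\<bar> \<le> (\<Sum>s\<in>S. \<bar>u s\<bar>)" using s insert.hyps(1) by (intro member_le_sum) auto
      then have "\<bar>u s\<bar> < K" by (simp add: K_def)
      moreover have "K * 1 \<le> K * w s" using w s K by (intro mult_left_mono) auto
      ultimately show ?thesis by linarith
    qed
    with K show ?thesis by blast
  qed
  from insert.IH[of L] insert.prems consider
      (pos) v where "v \<in> L" "\<forall>s\<in>S. v s > 0"
    | (ortho) f where "\<forall>s\<in>S. f s \<ge> 0" "\<exists>s\<in>S. f s > 0" "\<forall>u\<in>L. (\<Sum>s\<in>S. f s * u s) = 0"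
    by blast
  then show ?case
  proof cases
    case ortho
    let ?f = "f(x := 0)"
    have "(\<Sum>s\<in>S. ?f s * u s) = (\<Sum>s\<in>S. f s * u s)" for u :: "'a \<Rightarrow> int"
      using insert.hyps by (intro sum.cong) auto
    then have "\<forall>u\<in>L. (\<Sum>s\<in>insert x S. ?f s * u s) = 0" using ortho(3) by (simp only: sum_insert) simp
    moreover have "\<forall>s\<in>insert x S. ?f s \<ge> 0" "\<exists>s\<in>insert x S. ?f s > 0"
      using ortho insert.hyps by auto
    ultimately show ?thesis by blast
  next
    case pos
    consider "v x > 0" | "v x = 0" | "v x < 0" by linarith
    then show ?thesis
    proof cases
      case 1
      then show ?thesis using pos by blast
    next
      case 2
      show ?thesis
      proof (cases "\<forall>u\<in>L. u x = 0")
        case True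
        \<comment> \<open>All relations vanish at \<open>x\<close>, so evaluation at
          \<open>x\<close> is the functional.\<close>
        let ?f = "\<lambda>s. if s = x then 1 else (0::int)"
        have "(\<Sum>s\<in>S. ?f s * u s) = 0" for u
          using insert.hyps by (intro sum.neutral) auto
        then have "\<forall>u\<in>L. (\<Sum>s\<in>insert x S. ?f s * u s) = 0"
          using True by (simp only: sum_insert) simp
        moreover have "\<forall>s\<in>insert x S. ?f s \<ge> 0" "\<exists>s\<in>insert x S. ?f s > 0" by auto
        ultimately show ?thesis by (intro disjI2 exI[of _ ?f] conjI)
      next
        case False
        then obtain u where u: "u \<in> L" "u x \<noteq> 0" by blast
        \<comment> \<open>With the sign adjusted, \<open>u'\<close> supplies the positive value at
          \<open>x\<close> that \<open>v\<close> lacks; a large multiple of \<open>v\<close> repairs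
          the other coordinates and leaves this one alone.\<close>
        define u' where "u' = (\<lambda>s. sgn (u x) * u s)"
        have u': "u' \<in> L" "u' x > 0"
          using comb[OF u(1) u(1), of "sgn (u x)" 0] u(2) by (auto simp: u'_def sgn_if)
        obtain K where K: "K > 0" "\<forall>s\<in>S. K * v s + u' s > 0" using dominate[OF pos(2)] by blast
        have "(\<lambda>s. K * v s + 1 * u' s) \<in> L" by (rule comb[OF pos(1) u'(1)])
        moreover have "\<forall>s\<in>insert x S. K * v s + 1 * u' s > 0" using K 2 u'(2) by simp
        ultimately show ?thesis by (intro disjI1 bexI[of _ "\<lambda>s. K * v s + 1 * u' s"])
      qed
    next
      case 3
      \<comment> \<open>With a negative value at \<open>x\<close> the coordinate is eliminated: the
        induction hypothesis is applied a second time, to the relations vanishing at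
        \<open>x\<close>. A positive \<open>w\<close> found there becomes positive at
        \<open>x\<close> by subtracting \<open>v\<close> from a large multiple.\<close>
      let ?L0 = "{u \<in> L. u x = 0}"
      have "(\<lambda>s. 0 * v s + 0 * v s) \<in> ?L0" using comb[OF pos(1) pos(1), of 0 0] by simp
      then have "?L0 \<noteq> {}" by blast
      moreover have "(\<lambda>s. a * u s + b * v s) \<in> ?L0" if "u \<in> ?L0" "v \<in> ?L0" for u v a b
        using that comb by simp
      ultimately consider (pos0) w where "w \<in> ?L0" "\<forall>s\<in>S. w s > 0"
        | (ortho0) f where "\<forall>s\<in>S. f s \<ge> 0" "\<exists>s\<in>S. f s > 0" "\<forall>u\<in>?L0. (\<Sum>s\<in>S. f s * u s) = 0"
        using insert.IH[of ?L0] by blast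
      then show ?thesis
      proof cases
        case pos0
        obtain K where K: "K > 0" "\<forall>s\<in>S. K * w s + - v s > 0"
          using dominate[OF pos0(2), of "\<lambda>s. - v s"] by blast
        have "(\<lambda>s. K * w s + (-1) * v s) \<in> L" using pos0(1) by (intro comb pos) simp
        moreover have "\<forall>s\<in>insert x S. K * w s + (-1) * v s > 0" using K 3 pos0(1) by simp
        ultimately show ?thesis by (intro disjI1 bexI[of _ "\<lambda>s. K * w s + (-1) * v s"])
      next
        case ortho0
        \<comment> \<open>Every \<open>u\<close> in \<open>L\<close> yields
          \<open>v x * u - u x * v\<close> in \<open>?L0\<close>. Reading orthogonality to it as a
          condition on \<open>u\<close> gives these weights; scaling by \<open>- v x\<close> instead
          of dividing keeps them integral and nonnegative.\<close>
        define f' where "f' = (\<lambda>s. if s = x then (\<Sum>s\<in>S. f s * v s) else - v x * f s)"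
        have sum': "(\<Sum>s\<in>S. f' s * u s) = - v x * (\<Sum>s\<in>S. f s * u s)" for u
          unfolding sum_distrib_left using insert.hyps
          by (intro sum.cong) (auto simp: f'_def algebra_simps)
        have "(\<Sum>s\<in>insert x S. f' s * u s) = 0" if u: "u \<in> L" for u
        proof -
          have "(\<lambda>s. v x * u s + (- u x) * v s) \<in> ?L0" using comb[OF u pos(1), of "v x" "- u x"] by simp
          from bspec[OF ortho0(3) this]
          have "(\<Sum>s\<in>S. f s * (v x * u s + (- u x) * v s)) = 0" .
          then have "v x * (\<Sum>s\<in>S. f s * u s) = u x * (\<Sum>s\<in>S. f s * v s)"
            by (simp add: sum_distrib_left sum_subtractf algebra_simps)
          then show ?thesis unfolding sum_insert sum' by (simp add: f'_def)
        qed
        moreover have "f' s \<ge> 0" if "s \<in> insert x S" for s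
        proof (cases "s = x")
          case True
          have "(\<Sum>s\<in>S. f s * v s) \<ge> 0"
            using ortho0(1) pos(2) by (intro sum_nonneg mult_nonneg_nonneg) (auto intro: less_imp_le)
          with True show ?thesis by (simp add: f'_def)
        next
          case False
          then have "- v x * f s \<ge> 0" using that ortho0(1) 3 by (intro mult_nonneg_nonneg) auto
          with False show ?thesis by (simp add: f'_def)
        qed
        moreover have "\<exists>s\<in>insert x S. f' s > 0"
        proof -
          obtain s where s: "s \<in> S" "f s > 0" using ortho0(2) by blast
          then have "f' s > 0" using 3 insert.hyps by (auto simp: f'_def mult_neg_pos)
          then show ?thesis using s by blast
        qed
        ultimately show ?thesis by blast
      qed
    qed
  qed
qed

section \<open>Normal subsemigroups and their descent through central layers\<close>

definition normal_subsemi :: "('a, 'b) monoid_scheme \<Rightarrow> 'a set \<Rightarrow> bool" where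
  "normal_subsemi G P \<longleftrightarrow> P \<subseteq> carrier G \<and> (\<forall>a\<in>P. \<forall>b\<in>P. a \<otimes>\<^bsub>G\<^esub> b \<in> P) \<and>
     (\<forall>a\<in>P. \<forall>g\<in>carrier G. g \<otimes>\<^bsub>G\<^esub> a \<otimes>\<^bsub>G\<^esub> inv\<^bsub>G\<^esub> g \<in> P)"

text \<open>For normal \<open>M\<close> this is the product of \<open>P\<close> and
  \<open>M\<close>, the preimage of the image of \<open>P\<close> in the quotient by
  \<open>M\<close>.\<close>

definition saturation :: "('a, 'b) monoid_scheme \<Rightarrow> 'a set \<Rightarrow> 'a set \<Rightarrow> 'a set" where
  "saturation G P M = {a \<in> carrier G. \<exists>p\<in>P. a \<otimes>\<^bsub>G\<^esub> inv\<^bsub>G\<^esub> p \<in> M}"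

lemma (in quotient_map) mem_saturation_iff:
  assumes "P \<subseteq> carrier G" "a \<in> carrier G"
  shows "a \<in> saturation G P N \<longleftrightarrow> (\<exists>p\<in>P. q a = q p)"
  unfolding saturation_def using assms eq_iff by blast

context group begin

lemma normal_subsemi_normal_subsemigroup:
  assumes "S \<subseteq> carrier G"
  shows "normal_subsemi G (normal_subsemigroup G S)"
proof -
  have "a \<in> carrier G" if "a \<in> normal_subsemigroup G S" for a
    using that by induction (use assms in auto)
  then show ?thesis unfolding normal_subsemi_def
    by (auto intro: normal_subsemigroup.mult normal_subsemigroup.conj)
qed

lemma normal_subsemigroup_minimal:
  assumes "normal_subsemi G P" "S \<subseteq> P"
  shows "normal_subsemigroup G S \<subseteq> P"
proof
  fix a assume "a \<in> normal_subsemigroup G S"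
  then show "a \<in> P" by induction (use assms in \<open>auto simp: normal_subsemi_def\<close>)
qed

lemma normal_subsemi_saturation:
  assumes P: "normal_subsemi G P" and M: "M \<lhd> G"
  shows "normal_subsemi G (saturation G P M)" "P \<subseteq> saturation G P M"
proof -
  obtain Q :: "'a set monoid" and q where "quotient_map G Q q M"
    using normal.ex_quotient_map[OF M] by blast
  then interpret q: quotient_map G Q q M .
  have PG: "P \<subseteq> carrier G" using P by (simp add: normal_subsemi_def)
  note iff = q.mem_saturation_iff[OF PG]
  have sub: "saturation G P M \<subseteq> carrier G" by (auto simp: saturation_def)
  show "P \<subseteq> saturation G P M" using iff PG by blast
  show "normal_subsemi G (saturation G P M)" unfolding normal_subsemi_def
  proof (intro conjI ballI sub)
    fix a b assume ab: "a \<in> saturation G P M" "b \<in> saturation G P M"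
    then have abG: "a \<in> carrier G" "b \<in> carrier G" using sub by blast+
    obtain p r where pr: "p \<in> P" "q a = q p" "r \<in> P" "q b = q r"
      using ab iff[OF abG(1)] iff[OF abG(2)] by blast
    then have "q (a \<otimes> b) = q (p \<otimes> r)" using abG subsetD[OF PG] by simp
    moreover have "p \<otimes> r \<in> P" using pr P by (simp add: normal_subsemi_def)
    ultimately show "a \<otimes> b \<in> saturation G P M" using iff[OF m_closed[OF abG]] by blast
  next
    fix a g assume a: "a \<in> saturation G P M" and g: "g \<in> carrier G"
    then have aG: "a \<in> carrier G" using sub by blast
    obtain p where p: "p \<in> P" "q a = q p" using a iff[OF aG] by blast
    then have "q (g \<otimes> a \<otimes> inv g) = q (g \<otimes> p \<otimes> inv g)" using aG g subsetD[OF PG p(1)] by simp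
    moreover have "g \<otimes> p \<otimes> inv g \<in> P" using p g P by (simp add: normal_subsemi_def)
    moreover have "g \<otimes> a \<otimes> inv g \<in> carrier G" using aG g by simp
    ultimately show "g \<otimes> a \<otimes> inv g \<in> saturation G P M" using iff by blast
  qed
qed

lemma conj_hom: "g \<in> carrier G \<Longrightarrow> group_hom G G (\<lambda>x. g \<otimes> x \<otimes> inv g)"
  by (intro group_hom.intro group_hom_axioms.intro is_group homI) (simp_all add: m_assoc)

text \<open>The hypotheses say that conjugation by \<open>n\<close> multiplies \<open>g\<close> by
  an element \<open>z\<close> commuting with \<open>g\<close>; it then multiplies
  \<open>g [^] k\<close> by \<open>z [^] k\<close>. So commutators with powers of \<open>g\<close>
  are powers of one commutator, for exponents of either sign.\<close>

lemma int_pow_twisted_commute: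
  assumes "n \<in> carrier G" "g \<in> carrier G" "z \<in> carrier G"
    and "n \<otimes> g = z \<otimes> g \<otimes> n" "z \<otimes> g = g \<otimes> z"
  shows "n \<otimes> g [^] (k::int) = z [^] k \<otimes> g [^] k \<otimes> n"
proof -
  interpret h: group_hom G G "\<lambda>x. n \<otimes> x \<otimes> inv n" by (rule conj_hom[OF assms(1)])
  have "n \<otimes> g \<otimes> inv n = z \<otimes> g" using assms by (simp add: m_assoc)
  then have "n \<otimes> g [^] k \<otimes> inv n = (z \<otimes> g) [^] k" using h.hom_int_pow[OF assms(2), of k] by simp
  also have "\<dots> = z [^] k \<otimes> g [^] k" using assms by (intro int_pow_mult_distrib)
  finally have "n \<otimes> g [^] k \<otimes> inv n \<otimes> n = z [^] k \<otimes> g [^] k \<otimes> n" by simp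
  then show ?thesis using assms by (simp add: m_assoc)
qed

end

context group begin

text \<open>One step of the descent. It suffices to bring all of \<open>A\<close> into
  \<open>P\<close> modulo \<open>M\<close>, where \<open>A\<close> is central. Elements of
  \<open>A\<close> are reached with all integer exponents at once, up to a correcting factor, and a
  finite series of \<open>A\<close> makes that factor uniform.\<close>

lemma saturation_commutator_step:
  assumes P: "normal_subsemi G P" and BN: "B \<subseteq> N"
    and B: "B \<lhd> G" and A: "A = commutator_subgroup G B" and M: "M = commutator_subgroup G A"
    and es: "central_series G es" "series_span G es = A"
    and N: "subgroup N G" "N \<subseteq> saturation G P A"
  shows "N \<subseteq> saturation G P M"
proof -
  have An: "A \<lhd> G" and AB: "A \<subseteq> B" unfolding A using commutator_subgroup_normal[OF B] by auto
  have Mn: "M \<lhd> G" unfolding M by (rule commutator_subgroup_normal(1)[OF An])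
  obtain Q :: "'a set monoid" and q where "quotient_map G Q q M"
    using normal.ex_quotient_map[OF Mn] by blast
  then interpret q: quotient_map G Q q M .
  have PG: "P \<subseteq> carrier G" using P by (simp add: normal_subsemi_def)
  have AG: "a \<in> carrier G" if "a \<in> A" for a using that normal_imp_subgroup[OF An] subgroup.subset by blast
  have BG: "a \<in> carrier G" if "a \<in> B" for a using that normal_imp_subgroup[OF B] subgroup.subset by blast
  have A_mult: "a \<otimes> b \<in> A" if "a \<in> A" "b \<in> A" for a b
    using that subgroup.m_closed[OF normal_imp_subgroup[OF An]] by blast
  have A_inv: "inv a \<in> A" if "a \<in> A" for a
    using that subgroup.m_inv_closed[OF normal_imp_subgroup[OF An]] by blast
  have cent: "q a \<otimes>\<^bsub>Q\<^esub> q b = q b \<otimes>\<^bsub>Q\<^esub> q a" if "a \<in> A" "b \<in> carrier G" for a b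
    using commutator_subgroup_normal(3)[OF An that] q.centralizes_iff[OF AG[OF that(1)] that(2)]
    unfolding M by blast
  define P' where "P' = saturation G P M"
  have P': "normal_subsemi G P'" "P \<subseteq> P'"
    unfolding P'_def by (rule normal_subsemi_saturation[OF P Mn])+
  have P'G: "a \<in> carrier G" if "a \<in> P'" for a using that P'(1) by (auto simp: normal_subsemi_def)
  have P'_mult: "a \<otimes> b \<in> P'" if "a \<in> P'" "b \<in> P'" for a b
    using that P'(1) by (simp add: normal_subsemi_def)
  have P'_cong: "b \<in> P'" if "a \<in> P'" "q a = q b" "b \<in> carrier G" for a b
    using that(1,2) q.mem_saturation_iff[OF PG that(3)] q.mem_saturation_iff[OF PG P'G[OF that(1)]]
    unfolding P'_def by metis
  \<comment> \<open>\<open>R y\<close> asks for one shift \<open>z\<close> that works for all powers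
    of \<open>y\<close>, of both signs. In this uniform form the property passes to products and
    inverses, and later to the whole of \<open>A\<close>.\<close>
  define R where "R = (\<lambda>y. \<exists>z\<in>A \<inter> P'. \<forall>k::int. z \<otimes> y [^] k \<in> P')"
  have R_one: "R \<one>"
  proof -
    have "\<one> \<in> saturation G P A" using subgroup.one_closed[OF N(1)] N(2) by blast
    then obtain p where "p \<in> P" "\<one> \<otimes> inv p \<in> A" unfolding saturation_def by blast
    then have "p \<in> P" "inv (inv p) \<in> A" using A_inv[of "inv p"] PG by auto
    then have "p \<in> A \<inter> P'" using PG P' by auto
    then show ?thesis unfolding R_def using P'G by (intro bexI[of _ p]) auto
  qed
  have R_mult: "R (y \<otimes> y')" if R: "R y" "R y'" and y: "y \<in> A" "y' \<in> A" for y y'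
  proof -
    obtain z where z: "z \<in> A" "z \<in> P'" "\<And>k::int. z \<otimes> y [^] k \<in> P'"
      using R(1) unfolding R_def by blast
    obtain z' where z': "z' \<in> A" "z' \<in> P'" "\<And>k::int. z' \<otimes> y' [^] k \<in> P'"
      using R(2) unfolding R_def by blast
    have "z \<otimes> z' \<otimes> (y \<otimes> y') [^] k \<in> P'" for k :: int
    proof (rule P'_cong)
      show "(z \<otimes> y [^] k) \<otimes> (z' \<otimes> y' [^] k) \<in> P'" by (intro P'_mult z z')
      have yy: "q (y \<otimes> y') [^]\<^bsub>Q\<^esub> k = q y [^]\<^bsub>Q\<^esub> k \<otimes>\<^bsub>Q\<^esub> q y' [^]\<^bsub>Q\<^esub> k"
        using q.H.int_pow_mult_distrib[OF cent[OF y(1) AG[OF y(2)]], of k] AG y by simp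
      have yz: "q y [^]\<^bsub>Q\<^esub> k \<otimes>\<^bsub>Q\<^esub> q z' = q z' \<otimes>\<^bsub>Q\<^esub> q y [^]\<^bsub>Q\<^esub> k"
        using cent[OF z'(1), of "y [^] k"] AG y by (simp add: q.hom_int_pow)
      have "q ((z \<otimes> y [^] k) \<otimes> (z' \<otimes> y' [^] k)) =
          q z \<otimes>\<^bsub>Q\<^esub> (q y [^]\<^bsub>Q\<^esub> k \<otimes>\<^bsub>Q\<^esub> q z') \<otimes>\<^bsub>Q\<^esub> q y' [^]\<^bsub>Q\<^esub> k"
        using AG y z z' by (simp add: q.hom_int_pow q.H.m_assoc)
      also have "\<dots> = q (z \<otimes> z' \<otimes> (y \<otimes> y') [^] k)"
        unfolding yz using AG y z z' yy by (simp add: q.hom_int_pow q.H.m_assoc)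
      finally show "q ((z \<otimes> y [^] k) \<otimes> (z' \<otimes> y' [^] k)) = q (z \<otimes> z' \<otimes> (y \<otimes> y') [^] k)" .
    qed (use AG y z z' in simp)
    moreover have "z \<otimes> z' \<in> A \<inter> P'" using z z' A_mult P'_mult by blast
    ultimately show ?thesis unfolding R_def by blast
  qed
  have R_inv: "R (inv y)" if "R y" "y \<in> A" for y
  proof -
    obtain z where z: "z \<in> A \<inter> P'" "\<And>k::int. z \<otimes> y [^] k \<in> P'"
      using \<open>R y\<close> unfolding R_def by blast
    have "z \<otimes> inv y [^] k \<in> P'" for k :: int
      using z(2)[of "- k"] AG[OF that(2)] by (simp add: int_pow_neg int_pow_inv)
    then show ?thesis unfolding R_def using z(1) by blast
  qed
  have R_comm: "R (n \<otimes> g \<otimes> inv n \<otimes> inv g)" if n: "n \<in> B" and g: "g \<in> carrier G" for n g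
  proof -
    define y where "y = n \<otimes> g \<otimes> inv n \<otimes> inv g"
    have nG: "n \<in> carrier G" by (rule BG[OF n])
    have yA: "y \<in> A" using commutator_subgroup_normal(3)[OF B n g]
      unfolding A y_def centralizes_def .
    have "n \<in> N" "inv n \<in> N" using n BN subgroup.m_inv_closed[OF N(1)] by auto
    then obtain p r where p: "p \<in> P" "n \<otimes> inv p \<in> A" and r: "r \<in> P" "inv n \<otimes> inv r \<in> A"
      using N(2) unfolding saturation_def by blast
    have pr: "p \<in> carrier G" "r \<in> carrier G" using p r PG by auto
    \<comment> \<open>With \<open>p = a \<otimes> n\<close> and \<open>r = b \<otimes> inv n\<close>
      in \<open>P\<close>, multiplying a conjugate of \<open>p\<close> by \<open>r\<close> cancels
      \<open>n\<close> and leaves the factor \<open>z = a \<otimes> b\<close>.\<close>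
    define z where "z = inv (n \<otimes> inv p) \<otimes> inv (inv n \<otimes> inv r)"
    have zA: "z \<in> A" unfolding z_def using p r A_inv A_mult by blast
    note G = nG g pr AG[OF yA] AG[OF zA]
    define a where "a = inv (n \<otimes> inv p)"
    define b where "b = inv (inv n \<otimes> inv r)"
    have ab: "a \<in> A" "b \<in> A" "a \<in> carrier G" "b \<in> carrier G"
      using p r A_inv AG unfolding a_def b_def by blast+
    have p_eq: "p = a \<otimes> n" and r_eq: "r = b \<otimes> inv n"
      using G by (simp_all add: a_def b_def inv_mult_group m_assoc)
    have z_eq: "z = a \<otimes> b" by (simp add: z_def a_def b_def)
    have key: "z \<otimes> y [^] k \<in> P'" for k :: int
    proof (rule P'_cong)
      \<comment> \<open>Conjugation by the inverse of \<open>g [^] k\<close> turns \<open>n\<close>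
        into \<open>y [^] k \<otimes> n\<close> modulo \<open>M\<close>; this is where the power of
        the commutator comes from.\<close>
      define h where "h = inv (g [^] k)"
      have hG: "h \<in> carrier G" using g by (simp add: h_def)
      have "h \<otimes> p \<otimes> inv h \<in> P" using P p(1) hG by (simp add: normal_subsemi_def)
      then show "(h \<otimes> p \<otimes> inv h) \<otimes> r \<in> P'" using P'_mult subsetD[OF P'(2)] r(1) by blast
      have tw: "q n \<otimes>\<^bsub>Q\<^esub> q g [^]\<^bsub>Q\<^esub> k = q y [^]\<^bsub>Q\<^esub> k \<otimes>\<^bsub>Q\<^esub> q g [^]\<^bsub>Q\<^esub> k \<otimes>\<^bsub>Q\<^esub> q n"
      proof (rule q.H.int_pow_twisted_commute)
        have "n \<otimes> g = y \<otimes> g \<otimes> n" using G by (simp add: y_def m_assoc)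
        then show "q n \<otimes>\<^bsub>Q\<^esub> q g = q y \<otimes>\<^bsub>Q\<^esub> q g \<otimes>\<^bsub>Q\<^esub> q n"
          using G by (metis q.hom_mult m_closed)
        show "q y \<otimes>\<^bsub>Q\<^esub> q g = q g \<otimes>\<^bsub>Q\<^esub> q y" by (rule cent[OF yA g])
      qed (use G in auto)
      have qy: "q y [^]\<^bsub>Q\<^esub> k \<otimes>\<^bsub>Q\<^esub> q g [^]\<^bsub>Q\<^esub> k = q g [^]\<^bsub>Q\<^esub> k \<otimes>\<^bsub>Q\<^esub> q y [^]\<^bsub>Q\<^esub> k"
      proof -
        have "y [^] k \<in> A" by (rule subgroup_int_pow_closed[OF normal_imp_subgroup[OF An] yA])
        from cent[OF this, of "g [^] k"] show ?thesis using G by (simp add: q.hom_int_pow)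
      qed
      have "q h \<otimes>\<^bsub>Q\<^esub> q n \<otimes>\<^bsub>Q\<^esub> inv\<^bsub>Q\<^esub> q h = inv\<^bsub>Q\<^esub> (q g [^]\<^bsub>Q\<^esub> k) \<otimes>\<^bsub>Q\<^esub> (q n \<otimes>\<^bsub>Q\<^esub> q g [^]\<^bsub>Q\<^esub> k)"
        using G by (simp add: h_def q.hom_int_pow q.H.m_assoc)
      also have "\<dots> = q y [^]\<^bsub>Q\<^esub> k \<otimes>\<^bsub>Q\<^esub> q n"
        unfolding tw qy using G by (simp add: q.H.m_assoc)
      finally have hn: "q h \<otimes>\<^bsub>Q\<^esub> q n \<otimes>\<^bsub>Q\<^esub> inv\<^bsub>Q\<^esub> q h = q y [^]\<^bsub>Q\<^esub> k \<otimes>\<^bsub>Q\<^esub> q n" .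
      have "q ((h \<otimes> p \<otimes> inv h) \<otimes> r) =
          (q h \<otimes>\<^bsub>Q\<^esub> q a) \<otimes>\<^bsub>Q\<^esub> q n \<otimes>\<^bsub>Q\<^esub> inv\<^bsub>Q\<^esub> q h \<otimes>\<^bsub>Q\<^esub> (q b \<otimes>\<^bsub>Q\<^esub> inv\<^bsub>Q\<^esub> q n)"
        using G ab hG by (simp add: p_eq r_eq q.H.m_assoc)
      also have "q h \<otimes>\<^bsub>Q\<^esub> q a = q a \<otimes>\<^bsub>Q\<^esub> q h" using cent[OF ab(1) hG] by simp
      also have "q b \<otimes>\<^bsub>Q\<^esub> inv\<^bsub>Q\<^esub> q n = inv\<^bsub>Q\<^esub> q n \<otimes>\<^bsub>Q\<^esub> q b"
        using cent[OF ab(2), of "inv n"] G by simp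
      also have "q a \<otimes>\<^bsub>Q\<^esub> q h \<otimes>\<^bsub>Q\<^esub> q n \<otimes>\<^bsub>Q\<^esub> inv\<^bsub>Q\<^esub> q h \<otimes>\<^bsub>Q\<^esub> (inv\<^bsub>Q\<^esub> q n \<otimes>\<^bsub>Q\<^esub> q b) =
          q a \<otimes>\<^bsub>Q\<^esub> (q h \<otimes>\<^bsub>Q\<^esub> q n \<otimes>\<^bsub>Q\<^esub> inv\<^bsub>Q\<^esub> q h) \<otimes>\<^bsub>Q\<^esub> inv\<^bsub>Q\<^esub> q n \<otimes>\<^bsub>Q\<^esub> q b"
        using G ab hG by (simp add: q.H.m_assoc)
      also have "\<dots> = q a \<otimes>\<^bsub>Q\<^esub> (q y [^]\<^bsub>Q\<^esub> k \<otimes>\<^bsub>Q\<^esub> q b)"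
        unfolding hn using G ab by (simp add: q.H.m_assoc)
      also have "q y [^]\<^bsub>Q\<^esub> k \<otimes>\<^bsub>Q\<^esub> q b = q b \<otimes>\<^bsub>Q\<^esub> q y [^]\<^bsub>Q\<^esub> k"
        using cent[OF ab(2), of "y [^] k"] G by (simp add: q.hom_int_pow)
      also have "q a \<otimes>\<^bsub>Q\<^esub> (q b \<otimes>\<^bsub>Q\<^esub> q y [^]\<^bsub>Q\<^esub> k) = q (z \<otimes> y [^] k)"
        using G ab by (simp add: z_eq q.hom_int_pow q.H.m_assoc)
      finally show "q ((h \<otimes> p \<otimes> inv h) \<otimes> r) = q (z \<otimes> y [^] k)" .
      show "z \<otimes> y [^] k \<in> carrier G" using G by simp
    qed
    have "z \<in> P'" using key[of 0] G by simp
    then show ?thesis unfolding R_def y_def[symmetric] using key zA by blast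
  qed
  have R: "R y" if "y \<in> A" for y
  proof -
    have "y \<in> generate G {a \<otimes> b \<otimes> inv a \<otimes> inv b | a b. a \<in> B \<and> b \<in> carrier G}"
      using that unfolding A commutator_subgroup_def .
    then have "y \<in> A \<and> R y"
    proof induction
      case one
      then show ?case using R_one subgroup.one_closed[OF normal_imp_subgroup[OF An]] by blast
    next
      case (incl h)
      then show ?case using R_comm unfolding A commutator_subgroup_def by (blast intro: generate.incl)
    next
      case (inv h)
      then have "h \<in> A" "R h" using R_comm unfolding A commutator_subgroup_def
        by (blast intro: generate.incl)+
      then show ?case using R_inv A_inv by blast
    next
      case (eng h1 h2)
      then show ?case using R_mult A_mult by blast
    qed
    then show ?thesis by blast
  qed
  \<comment> \<open>The shifts belonging to the finitely many entries of a series multiply to a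
    single shift that serves every element of the span.\<close>
  have "\<exists>z\<in>A \<inter> P'. \<forall>y\<in>series_span G fs. z \<otimes> y \<in> P'"
    if "central_series G fs" "series_span G fs \<subseteq> A" for fs
    using that
  proof (induction fs)
    case Nil
    obtain z where "z \<in> A \<inter> P'" using R_one unfolding R_def by blast
    then show ?case using P'G by (intro bexI[of _ z]) auto
  next
    case (Cons f fs)
    have "series_span G fs \<subseteq> series_span G (f # fs)" "f \<in> series_span G (f # fs)"
      using series_span_append_subset[of "[f]" fs] set_subset_series_span[of "f # fs"] Cons.prems by auto
    then have fs: "series_span G fs \<subseteq> A" and f: "f \<in> A" using Cons.prems by blast+
    then obtain z where z: "z \<in> A \<inter> P'" "\<And>y. y \<in> series_span G fs \<Longrightarrow> z \<otimes> y \<in> P'"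
      using Cons by auto
    obtain z' where z': "z' \<in> A \<inter> P'" "\<And>k::int. z' \<otimes> f [^] k \<in> P'"
      using R[OF f] unfolding R_def by blast
    have "z' \<otimes> z \<otimes> y \<in> P'" if y: "y \<in> series_span G (f # fs)" for y
    proof -
      obtain k :: int and x where x: "y = f [^] k \<otimes> x" "x \<in> series_span G fs" using y by auto
      have G: "f \<in> carrier G" "x \<in> carrier G" "z \<in> carrier G" "z' \<in> carrier G"
        using f x fs z z' AG by auto
      have "(z' \<otimes> f [^] k) \<otimes> (z \<otimes> x) \<in> P'" using x z z' P'_mult by blast
      moreover have "q ((z' \<otimes> f [^] k) \<otimes> (z \<otimes> x)) = q (z' \<otimes> z \<otimes> y)"
      proof -
        have "q (f [^] k) \<otimes>\<^bsub>Q\<^esub> q z = q z \<otimes>\<^bsub>Q\<^esub> q (f [^] k)"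
          using cent[of z "f [^] k"] z G by simp
        then have "q z' \<otimes>\<^bsub>Q\<^esub> (q (f [^] k) \<otimes>\<^bsub>Q\<^esub> q z) \<otimes>\<^bsub>Q\<^esub> q x =
          q z' \<otimes>\<^bsub>Q\<^esub> (q z \<otimes>\<^bsub>Q\<^esub> q (f [^] k)) \<otimes>\<^bsub>Q\<^esub> q x" by simp
        then show ?thesis using G by (simp add: x(1) q.H.m_assoc)
      qed
      ultimately show ?thesis using P'_cong G x(1) by simp
    qed
    then show ?case using z z' A_mult P'_mult by (intro bexI[of _ "z' \<otimes> z"]) auto
  qed
  from this[OF es(1)] es(2) obtain z where z: "z \<in> A" "\<And>y. y \<in> A \<Longrightarrow> z \<otimes> y \<in> P'" by auto
  \<comment> \<open>Taking \<open>inv z \<otimes> v\<close> for \<open>y\<close> cancels the common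
    shift.\<close>
  have "v \<in> P'" if "v \<in> A" for v
    using z(2)[OF A_mult[OF A_inv[OF z(1)] that]] AG z that by simp
  then have AP': "A \<subseteq> P'" by blast
  show ?thesis
  proof
    fix n assume "n \<in> N"
    then obtain p where p: "n \<in> carrier G" "p \<in> P" "n \<otimes> inv p \<in> A"
      using N(2) unfolding saturation_def by blast
    then have "n \<otimes> inv p \<otimes> p \<in> P'" using AP' P'(2) P'_mult by blast
    moreover have "p \<in> carrier G" using p PG by blast
    ultimately show "n \<in> saturation G P M" using p(1) by (simp add: P'_def m_assoc)
  qed
qed

text \<open>The iterated commutators \<open>K j\<close> of \<open>N\<close> with \<open>G\<close>
  lie in the lower central series and so become trivial. The descent passes from saturation by one
  of them to saturation by the next, until the subgroup is trivial and saturation adds nothing to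
  \<open>P\<close>.\<close>

lemma one_mem_if_saturated:
  assumes "nilpotent_group c G" and rs: "central_series G rs" "series_span G rs = carrier G"
    and P: "normal_subsemi G P" and N: "N \<lhd> G" "N \<subseteq> saturation G P (commutator_subgroup G N)"
  shows "\<one> \<in> P"
proof -
  define K where "K j = (commutator_subgroup G ^^ j) N" for j
  have K_Suc: "K (Suc j) = commutator_subgroup G (K j)" for j by (simp add: K_def)
  have Kn: "K j \<lhd> G" for j
    by (induction j) (use N in \<open>auto simp: K_def commutator_subgroup_normal\<close>)
  have KN: "K j \<subseteq> N" for j
    by (induction j) (use commutator_subgroup_normal(2)[OF Kn] in \<open>auto simp: K_def\<close>)
  have series: "\<exists>es. central_series G es \<and> series_span G es = K j" for j
  proof -
    have "K j \<subseteq> carrier G" using normal_imp_subgroup[OF Kn] subgroup.subset by blast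
    moreover have "\<one> \<in> K j" using normal_imp_subgroup[OF Kn] subgroup.one_closed by blast
    ultimately show ?thesis
      using central_series_refine[OF rs(1) Kn[of j], of "[]"] rs(2) by (auto simp: Int_absorb2)
  qed
  have "N \<subseteq> saturation G P (K (Suc j))" for j
  proof (induction j)
    case 0
    then show ?case using N(2) by (simp add: K_def)
  next
    case (Suc j)
    obtain es where "central_series G es" "series_span G es = K (Suc j)" using series by blast
    then show ?case
      using saturation_commutator_step[OF P KN Kn K_Suc K_Suc _ _ normal_imp_subgroup[OF N(1)] Suc] by blast
  qed
  moreover have "K j \<subseteq> lower_central G j" for j
  proof (induction j)
    case 0
    then show ?case using normal_imp_subgroup[OF N(1)] subgroup.subset by (auto simp: K_def)
  next
    case (Suc j)
    then show ?case unfolding K_Suc lower_central_Suc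
      unfolding commutator_subgroup_def by (intro mono_generate) blast
  qed
  then have "K c \<subseteq> {\<one>}" using assms(1) by (auto simp: nilpotent_group_def)
  \<comment> \<open>The descent always speaks of a successor index, hence one step beyond
    \<open>c\<close>.\<close>
  then have "K (Suc c) \<subseteq> {\<one>}" unfolding K_Suc using commutator_subgroup_normal(2)[OF Kn] by blast
  moreover have "\<one> \<in> N" using normal_imp_subgroup[OF N(1)] subgroup.one_closed by blast
  ultimately have "\<one> \<in> saturation G P {\<one>}" unfolding saturation_def by blast
  then obtain p where "p \<in> P" "\<one> \<otimes> inv p \<in> {\<one>}" unfolding saturation_def by blast
  moreover have "p \<in> carrier G" using \<open>p \<in> P\<close> P by (auto simp: normal_subsemi_def)
  ultimately show ?thesis using inv_eq_1_iff by auto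
qed

end

text \<open>The lexicographic cone: an element belongs to it when the uppermost factor in which it
  is nontrivial is infinite and its exponent there is positive. Without infinite factors the cone is
  empty, which \<open>normal_subsemi\<close> admits.\<close>

primrec series_positive :: "('a, 'b) monoid_scheme \<Rightarrow> 'a list \<Rightarrow> 'a set" where
  "series_positive G [] = {}"
| "series_positive G (c # cs) = series_positive G cs \<union>
     (if infinite_factor G c cs
      then {c [^]\<^bsub>G\<^esub> k \<otimes>\<^bsub>G\<^esub> x | (k :: int) x. k > 0 \<and> x \<in> series_span G cs} else {})"

text \<open>An exponent vector is evaluated in the fixed order of the list; after a homomorphism
  under which the entries commute, the value depends linearly on the vector.\<close>

primrec power_product :: "('a, 'b) monoid_scheme \<Rightarrow> 'a list \<Rightarrow> ('a \<Rightarrow> int) \<Rightarrow> 'a" where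
  "power_product G [] u = \<one>\<^bsub>G\<^esub>"
| "power_product G (t # ts) u = t [^]\<^bsub>G\<^esub> u t \<otimes>\<^bsub>G\<^esub> power_product G ts u"

lemma normal_subsemigroup_mono: "S \<subseteq> T \<Longrightarrow> normal_subsemigroup G S \<subseteq> normal_subsemigroup G T"
proof
  fix a assume "S \<subseteq> T" "a \<in> normal_subsemigroup G S"
  from this(2) show "a \<in> normal_subsemigroup G T"
    by induction (use \<open>S \<subseteq> T\<close> in \<open>auto intro: normal_subsemigroup.intros\<close>)
qed

context group begin

lemma power_product_mem: "subgroup N G \<Longrightarrow> set ts \<subseteq> N \<Longrightarrow> power_product G ts u \<in> N"
  by (induction ts) (auto simp: subgroup.one_closed subgroup.m_closed subgroup_int_pow_closed)

lemma power_product_delta: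
  "set ts \<subseteq> carrier G \<Longrightarrow> distinct ts \<Longrightarrow>
    power_product G ts (\<lambda>x. if x = s then 1 else 0) = (if s \<in> set ts then s else \<one>)"
  by (induction ts) auto

lemma power_product_comb:
  assumes "subgroup N G" "group_hom G Q q" "set ts \<subseteq> N"
    and cent: "\<And>a b. a \<in> N \<Longrightarrow> b \<in> N \<Longrightarrow> q a \<otimes>\<^bsub>Q\<^esub> q b = q b \<otimes>\<^bsub>Q\<^esub> q a"
  shows "q (power_product G ts (\<lambda>s. a * u s + b * v s)) =
    q (power_product G ts u) [^]\<^bsub>Q\<^esub> (a::int) \<otimes>\<^bsub>Q\<^esub> q (power_product G ts v) [^]\<^bsub>Q\<^esub> (b::int)"
  using assms(3)
proof (induction ts)
  case Nil
  interpret q: group_hom G Q q by (rule assms(2))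
  show ?case by simp
next
  case (Cons t ts)
  interpret q: group_hom G Q q by (rule assms(2))
  have NG: "x \<in> carrier G" if "x \<in> N" for x using that assms(1) subgroup.subset by blast
  have pow: "x [^] (k::int) \<in> N" if "x \<in> N" for x k by (rule subgroup_int_pow_closed[OF assms(1) that])
  let ?X = "power_product G ts u" and ?Y = "power_product G ts v"
  have X: "?X \<in> N" and Y: "?Y \<in> N" and t: "t \<in> N"
    using Cons.prems power_product_mem[OF assms(1)] by auto
  have W: "power_product G ts (\<lambda>s. a * u s + b * v s) \<in> N"
    using Cons.prems power_product_mem[OF assms(1)] by auto
  have G: "t \<in> carrier G" "?X \<in> carrier G" "?Y \<in> carrier G"
    "power_product G ts (\<lambda>s. a * u s + b * v s) \<in> carrier G" using X Y t W NG by auto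
  have 1: "(q (t [^] u t) \<otimes>\<^bsub>Q\<^esub> q ?X) [^]\<^bsub>Q\<^esub> a = q t [^]\<^bsub>Q\<^esub> (a * u t) \<otimes>\<^bsub>Q\<^esub> q ?X [^]\<^bsub>Q\<^esub> a"
    using q.H.int_pow_mult_distrib[OF cent[OF pow[OF t] X]] G
    by (simp add: q.hom_int_pow q.H.int_pow_pow mult.commute)
  have 2: "(q (t [^] v t) \<otimes>\<^bsub>Q\<^esub> q ?Y) [^]\<^bsub>Q\<^esub> b = q t [^]\<^bsub>Q\<^esub> (b * v t) \<otimes>\<^bsub>Q\<^esub> q ?Y [^]\<^bsub>Q\<^esub> b"
    using q.H.int_pow_mult_distrib[OF cent[OF pow[OF t] Y]] G
    by (simp add: q.hom_int_pow q.H.int_pow_pow mult.commute)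
  have 3: "q ?X [^]\<^bsub>Q\<^esub> a \<otimes>\<^bsub>Q\<^esub> q t [^]\<^bsub>Q\<^esub> (b * v t) = q t [^]\<^bsub>Q\<^esub> (b * v t) \<otimes>\<^bsub>Q\<^esub> q ?X [^]\<^bsub>Q\<^esub> a"
    using cent[OF pow[OF X, of a] pow[OF t, of "b * v t"]] G by (simp add: q.hom_int_pow)
  have "q (power_product G (t # ts) (\<lambda>s. a * u s + b * v s)) =
      q t [^]\<^bsub>Q\<^esub> (a * u t) \<otimes>\<^bsub>Q\<^esub> (q t [^]\<^bsub>Q\<^esub> (b * v t) \<otimes>\<^bsub>Q\<^esub> q ?X [^]\<^bsub>Q\<^esub> a) \<otimes>\<^bsub>Q\<^esub> q ?Y [^]\<^bsub>Q\<^esub> b"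
    using Cons G by (simp add: q.hom_int_pow q.H.int_pow_mult q.H.m_assoc)
  also have "\<dots> = (q (t [^] u t) \<otimes>\<^bsub>Q\<^esub> q ?X) [^]\<^bsub>Q\<^esub> a \<otimes>\<^bsub>Q\<^esub> (q (t [^] v t) \<otimes>\<^bsub>Q\<^esub> q ?Y) [^]\<^bsub>Q\<^esub> b"
    unfolding 1 2 3[symmetric] using G by (simp add: q.H.m_assoc)
  finally show ?case using G by simp
qed

lemma normal_subsemi_int_pow:
  assumes "normal_subsemi G P" "p \<in> P" "(k::int) > 0"
  shows "p [^] k \<in> P"
proof -
  have "p [^] Suc n \<in> P" for n
    using assms(1,2) by (induction n) (auto simp: normal_subsemi_def)
  from this[of "nat k - 1"] have "p [^] nat k \<in> P" using assms(3) by simp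
  then show ?thesis using assms(3) int_pow_int[of G p "nat k"] by simp
qed

lemma power_product_positive:
  assumes "normal_subsemi G P" "ts \<noteq> []" "\<And>t. t \<in> set ts \<Longrightarrow> t \<in> P \<and> u t > 0"
  shows "power_product G ts u \<in> P"
  using assms(2,3)
proof (induction ts)
  case (Cons t ts)
  have t: "t [^] u t \<in> P" using normal_subsemi_int_pow[OF assms(1)] Cons.prems by simp
  show ?case
  proof (cases "ts = []")
    case True
    then show ?thesis using t assms(1) by (auto simp: normal_subsemi_def)
  next
    case False
    then show ?thesis using t Cons assms(1) by (auto simp: normal_subsemi_def)
  qed
qed simp

text \<open>The relations \<open>L\<close> are the exponent vectors on \<open>S\<close> whose value
  is trivial in \<open>N/[N,G]\<close>. A strictly positive one makes the inverses of
  \<open>S\<close> positive in that quotient and the descent applies; a functional annihilating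
  \<open>L\<close> factors through the quotient, so its invariance under conjugation is
  automatic.\<close>

lemma invariant_functional:
  assumes nil: "nilpotent_group c G" and rs: "central_series G rs" "series_span G rs = carrier G"
    and S: "finite S" "S \<noteq> {}" "S \<subseteq> carrier G" and one: "\<one> \<notin> normal_subsemigroup G S"
    and N_def: "N = generate G (normal_subsemigroup G S)"
  shows "N \<lhd> G" and "\<exists>\<Phi> :: 'a \<Rightarrow> int. (\<forall>a\<in>N. \<forall>b\<in>N. \<Phi> (a \<otimes> b) = \<Phi> a + \<Phi> b) \<and>
    (\<forall>a\<in>N. \<forall>g\<in>carrier G. \<Phi> (g \<otimes> a \<otimes> inv g) = \<Phi> a) \<and>
    (\<forall>s\<in>S. \<Phi> s \<ge> 0) \<and> (\<exists>s\<in>S. \<Phi> s > 0)"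
proof -
  define P where "P = normal_subsemigroup G S"
  have P: "normal_subsemi G P" unfolding P_def by (rule normal_subsemi_normal_subsemigroup[OF S(3)])
  have PG: "P \<subseteq> carrier G" using P by (simp add: normal_subsemi_def)
  have SP: "S \<subseteq> P" by (auto simp: P_def intro: normal_subsemigroup.incl)
  have PN: "P \<subseteq> N" by (auto simp: N_def P_def intro: generate.incl)
  show N: "N \<lhd> G" unfolding N_def P_def[symmetric]
    by (rule normal_generateI) (use P in \<open>auto simp: normal_subsemi_def\<close>)
  have Nsub: "subgroup N G" by (rule normal_imp_subgroup[OF N])
  have NG: "a \<in> carrier G" if "a \<in> N" for a using that Nsub subgroup.subset by blast
  define M where "M = commutator_subgroup G N"
  have M: "M \<lhd> G" unfolding M_def by (rule commutator_subgroup_normal(1)[OF N])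
  obtain Q :: "'a set monoid" and q where "quotient_map G Q q M"
    using normal.ex_quotient_map[OF M] by blast
  then interpret q: quotient_map G Q q M .
  have cent: "q a \<otimes>\<^bsub>Q\<^esub> q b = q b \<otimes>\<^bsub>Q\<^esub> q a" if "a \<in> N" "b \<in> carrier G" for a b
    using commutator_subgroup_normal(3)[OF N that] q.centralizes_iff[OF NG[OF that(1)] that(2)]
    unfolding M_def by blast
  have q_conj: "q (g \<otimes> a \<otimes> inv g) = q a" if "a \<in> N" "g \<in> carrier G" for a g
    using cent[OF that] NG that by (simp add: q.H.m_assoc[symmetric] flip: cent[OF that])
       (simp add: q.H.m_assoc)
  obtain ss where ss: "set ss = S" "distinct ss" using finite_distinct_list[OF S(1)] by blast
  have ssN: "set ss \<subseteq> N" using ss SP PN by blast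
  define ev where "ev = power_product G ss"
  have evN: "ev u \<in> N" for u unfolding ev_def by (rule power_product_mem[OF Nsub ssN])
  have comb: "q (ev (\<lambda>s. a * u s + b * v s)) = q (ev u) [^]\<^bsub>Q\<^esub> a \<otimes>\<^bsub>Q\<^esub> q (ev v) [^]\<^bsub>Q\<^esub> b" for a b u v
    unfolding ev_def
    by (rule power_product_comb[OF Nsub q.group_hom_axioms ssN]) (rule cent, auto intro: NG)
  define \<delta> :: "'a \<Rightarrow> 'a \<Rightarrow> int" where "\<delta> = (\<lambda>s x. if x = s then 1 else 0)"
  have ev_\<delta>: "ev (\<delta> s) = s" if "s \<in> S" for s
    unfolding ev_def \<delta>_def using power_product_delta[of ss s] ss S(3) that by simp
  define L where "L = {u. q (ev u) = \<one>\<^bsub>Q\<^esub>}"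
  have L_comb: "(\<lambda>s. a * u s + b * v s) \<in> L" if "u \<in> L" "v \<in> L" for u v a b
    using that by (simp add: L_def comb)
  \<comment> \<open>The zero vector is written as a trivial combination of an arbitrary vector so
    that \<open>comb\<close> evaluates it.\<close>
  have "(\<lambda>s. 0 * \<delta> undefined s + 0 * \<delta> undefined s) \<in> L"
    unfolding L_def mem_Collect_eq comb using NG[OF evN] by simp
  then have "L \<noteq> {}" by blast
  from stiemke_int[OF S(1) this L_comb] consider
      (pos) v where "v \<in> L" "\<forall>s\<in>S. v s > 0"
    | (func) f where "\<forall>s\<in>S. f s \<ge> 0" "\<exists>s\<in>S. f s > 0" "\<forall>u\<in>L. (\<Sum>s\<in>S. f s * u s) = 0"
    by blast
  then show "\<exists>\<Phi> :: 'a \<Rightarrow> int. (\<forall>a\<in>N. \<forall>b\<in>N. \<Phi> (a \<otimes> b) = \<Phi> a + \<Phi> b) \<and>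
    (\<forall>a\<in>N. \<forall>g\<in>carrier G. \<Phi> (g \<otimes> a \<otimes> inv g) = \<Phi> a) \<and>
    (\<forall>s\<in>S. \<Phi> s \<ge> 0) \<and> (\<exists>s\<in>S. \<Phi> s > 0)"
  proof cases
    case pos
    define T where "T = saturation G P M"
    have T: "normal_subsemi G T" "P \<subseteq> T" unfolding T_def by (rule normal_subsemi_saturation[OF P M])+
    have inv_S: "inv s \<in> T" if s: "s \<in> S" for s
    proof -
      \<comment> \<open>Twice the positive relation minus one copy of \<open>s\<close> still has all
        exponents positive, and its value modulo \<open>M\<close> is the inverse of
        \<open>s\<close>.\<close>
      let ?w = "\<lambda>x. 2 * v x + (-1) * \<delta> s x"
      have "ev ?w \<in> P" unfolding ev_def
        using pos(2) ss S(2) SP by (intro power_product_positive[OF P]) (auto simp: \<delta>_def)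
      moreover have "q (inv s) = q (ev ?w)"
        unfolding comb using pos(1) s S(3) NG[OF evN]
        by (simp add: L_def ev_\<delta> q.H.int_pow_neg subset_iff)
      ultimately show ?thesis unfolding T_def
        using q.mem_saturation_iff[OF PG, of "inv s"] s S(3) by blast
    qed
    have inv_P: "inv p \<in> T" if "p \<in> P" for p
      using that unfolding P_def
    proof induction
      case (incl a)
      then show ?case by (rule inv_S)
    next
      case (mult a b)
      then have "a \<in> carrier G" "b \<in> carrier G" using PG by (auto simp: P_def)
      then show ?case using mult T(1) by (simp add: inv_mult_group normal_subsemi_def)
    next
      case (conj a b)
      then have "a \<in> carrier G" using PG by (auto simp: P_def)
      then have "inv (b \<otimes> a \<otimes> inv b) = b \<otimes> inv a \<otimes> inv b"
        using conj by (simp add: inv_mult_group m_assoc)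
      then show ?case using conj T(1) by (simp add: normal_subsemi_def)
    qed
    have "n \<in> T" if "n \<in> N" for n
      using that unfolding N_def P_def[symmetric]
    proof induction
      case one
      obtain s where s: "s \<in> S" using S(2) by blast
      then have "s \<otimes> inv s \<in> T" using inv_S SP T by (auto simp: normal_subsemi_def)
      then show ?case using s S(3) by auto
    next
      case (eng h1 h2)
      then show ?case using T(1) by (simp add: normal_subsemi_def)
    qed (use T inv_P in auto)
    then have "\<one> \<in> P"
      unfolding T_def M_def by (intro one_mem_if_saturated[OF nil rs P N]) blast
    then show ?thesis using one by (simp add: P_def)
  next
    case func
    \<comment> \<open>Conjugation by \<open>G\<close> is trivial on \<open>N\<close> modulo
      \<open>M\<close>, so the image of \<open>P\<close>, and then that of \<open>N\<close>,
      consists of products of powers of \<open>S\<close> itself.\<close>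
    have rep_P: "\<exists>u. q p = q (ev u)" if "p \<in> P" for p
      using that unfolding P_def
    proof induction
      case (incl a)
      then show ?case using ev_\<delta> by metis
    next
      case (mult a b)
      then obtain u v where "q a = q (ev u)" "q b = q (ev v)" by blast
      moreover have "a \<in> carrier G" "b \<in> carrier G" using mult PG by (auto simp: P_def)
      ultimately have "q (a \<otimes> b) = q (ev (\<lambda>s. 1 * u s + 1 * v s))"
        unfolding comb using NG[OF evN] by simp
      then show ?case by blast
    next
      case (conj a b)
      then have "q (b \<otimes> a \<otimes> inv b) = q a" using q_conj PN by (simp add: P_def subset_iff)
      then show ?case using conj.IH by simp
    qed
    have rep: "\<exists>u. q n = q (ev u)" if "n \<in> N" for n
    proof -
      have "n \<in> generate G P" using that by (simp add: N_def P_def)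
      then show ?thesis
      proof induction
        case one
        have "q \<one> = q (ev (\<lambda>s. 0 * \<delta> undefined s + 0 * \<delta> undefined s))"
          unfolding comb using NG[OF evN] by simp
        then show ?case by blast
      next
        case (incl h)
        then show ?case by (rule rep_P)
      next
        case (inv h)
        then obtain u where "q h = q (ev u)" using rep_P by blast
        moreover have "h \<in> carrier G" using inv PG by blast
        ultimately have "q (inv h) = q (ev (\<lambda>s. (-1) * u s + 0 * u s))"
          unfolding comb using NG[OF evN] by (simp add: q.H.int_pow_neg)
        then show ?case by blast
      next
        case (eng h1 h2)
        then obtain u v where "q h1 = q (ev u)" "q h2 = q (ev v)" by blast
        moreover have "h1 \<in> carrier G" "h2 \<in> carrier G"
          using eng PG generate_in_carrier by blast+
        ultimately have "q (h1 \<otimes> h2) = q (ev (\<lambda>s. 1 * u s + 1 * v s))"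
          unfolding comb using NG[OF evN] by simp
        then show ?case by blast
      qed
    qed
    \<comment> \<open>Any exponent vector representing \<open>n\<close> may be chosen: two of them
      differ by a relation in \<open>L\<close>, on which \<open>f\<close> vanishes.\<close>
    define \<Phi> where "\<Phi> n = (\<Sum>s\<in>S. f s * (SOME u. q n = q (ev u)) s)" for n
    have \<Phi>: "\<Phi> n = (\<Sum>s\<in>S. f s * u s)" if "q n = q (ev u)" for n u
    proof -
      define v where "v = (SOME u. q n = q (ev u))"
      have v: "q n = q (ev v)" unfolding v_def by (rule someI[where P = "\<lambda>u. q n = q (ev u)"]) (rule that)
      have "(\<lambda>s. 1 * v s + (-1) * u s) \<in> L"
        unfolding L_def mem_Collect_eq comb using v that NG[OF evN] by (simp add: q.H.int_pow_neg)
      from bspec[OF func(3) this] have "(\<Sum>s\<in>S. f s * (1 * v s + (-1) * u s)) = 0" .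
      then show ?thesis by (simp add: \<Phi>_def v_def[symmetric] right_diff_distrib sum_subtractf)
    qed
    have "\<Phi> (a \<otimes> b) = \<Phi> a + \<Phi> b" if ab: "a \<in> N" "b \<in> N" for a b
    proof -
      obtain u v where uv: "q a = q (ev u)" "q b = q (ev v)"
        using rep[OF ab(1)] rep[OF ab(2)] by blast
      then have "q (a \<otimes> b) = q (ev (\<lambda>s. 1 * u s + 1 * v s))"
        unfolding comb using NG[OF evN] NG ab by simp
      from \<Phi>[OF this] \<Phi>[OF uv(1)] \<Phi>[OF uv(2)] show ?thesis
        by (simp add: distrib_left sum.distrib)
    qed
    moreover have "\<Phi> (g \<otimes> a \<otimes> inv g) = \<Phi> a" if "a \<in> N" "g \<in> carrier G" for a g
      unfolding \<Phi>_def q_conj[OF that] ..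
    moreover have \<Phi>_S: "\<Phi> s = f s" if "s \<in> S" for s
    proof -
      have "q s = q (ev (\<delta> s))" using ev_\<delta>[OF that] by simp
      from \<Phi>[OF this] show ?thesis using that S(1) by (simp add: \<delta>_def if_distrib sum.delta cong: if_cong)
    qed
    ultimately show ?thesis using func(1,2) by (intro exI[of _ \<Phi>]) auto
  qed
qed

end

section \<open>Positive central series\<close>

context group begin

lemma series_positive_subset: "central_series G cs \<Longrightarrow> series_positive G cs \<subseteq> series_span G cs"
proof (induction cs)
  case (Cons c cs)
  then have "series_positive G cs \<subseteq> series_span G (c # cs)"
    using series_span_append_subset[of "[c]" cs] by fastforce
  then show ?case by auto
qed simp

lemma series_positive_append_subset: "series_positive G cs \<subseteq> series_positive G (bs @ cs)"
  by (induction bs) auto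

text \<open>Leading exponents add under multiplication, because the remainder \<open>x\<close> can
  be moved past a power of \<open>c\<close> without leaving the normal span of the tail.\<close>

lemma series_span_absorb:
  assumes "central_series G (c # cs)" "x \<in> series_span G cs" "y \<in> series_span G cs"
  shows "\<exists>z\<in>series_span G cs. (c [^] (k::int) \<otimes> x) \<otimes> (c [^] (l::int) \<otimes> y) = c [^] (k + l) \<otimes> z"
proof -
  have c: "c \<in> carrier G" and cs: "central_series G cs" using assms(1) by simp_all
  have N: "series_span G cs \<lhd> G" by (rule central_series_normal[OF cs])
  have xy: "x \<in> carrier G" "y \<in> carrier G" using assms(2,3) series_span_subset[OF cs] by blast+
  let ?z = "inv (c [^] l) \<otimes> x \<otimes> c [^] l \<otimes> y"
  have "inv (c [^] l) \<otimes> x \<otimes> c [^] l \<in> series_span G cs"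
    using normal.inv_op_closed1[OF N int_pow_closed[OF c] assms(2)] .
  then have "?z \<in> series_span G cs"
    using subgroup.m_closed[OF normal_imp_subgroup[OF N]] assms(3) by blast
  moreover have "(c [^] k \<otimes> x) \<otimes> (c [^] l \<otimes> y) = c [^] (k + l) \<otimes> ?z"
    using c xy by (simp add: int_pow_mult m_assoc)
  ultimately show ?thesis by blast
qed

text \<open>The factor is central, so conjugation changes only the remainder and keeps the leading
  exponent.\<close>

lemma series_span_conj:
  assumes "central_series G (c # cs)" "x \<in> series_span G cs" "g \<in> carrier G"
  shows "\<exists>z\<in>series_span G cs. g \<otimes> (c [^] (k::int) \<otimes> x) \<otimes> inv g = c [^] k \<otimes> z"
proof -
  have c: "c \<in> carrier G" and cs: "central_series G cs" using assms(1) by simp_all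
  have N: "series_span G cs \<lhd> G" by (rule central_series_normal[OF cs])
  have x: "x \<in> carrier G" using assms(2) series_span_subset[OF cs] by blast
  have "c [^] k \<otimes> x \<in> series_span G (c # cs)" by (rule series_span_ConsI[OF assms(2)])
  then have cent: "centralizes G (series_span G cs) g (c [^] k \<otimes> x)"
    by (rule centralizes_series_span_Cons[OF assms(1) _ assms(3)])
  obtain Q :: "'a set monoid" and q where "quotient_map G Q q (series_span G cs)"
    using normal.ex_quotient_map[OF N] by blast
  then interpret q: quotient_map G Q q "series_span G cs" .
  let ?a = "c [^] k \<otimes> x"
  have a: "?a \<in> carrier G" using c x by simp
  have "q g \<otimes>\<^bsub>Q\<^esub> q ?a = q ?a \<otimes>\<^bsub>Q\<^esub> q g" using q.centralizes_iff[OF assms(3) a] cent by blast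
  then have "q (g \<otimes> ?a \<otimes> inv g) = q ?a" using a assms(3) c x by (simp add: q.H.m_assoc)
  also have "\<dots> = q c [^]\<^bsub>Q\<^esub> k" using q.mem_cyclic_extension_iff[OF c a, of k] assms(2) by blast
  finally show ?thesis
    using q.mem_cyclic_extension_iff[OF c, of "g \<otimes> ?a \<otimes> inv g" k] a assms(3) by auto
qed

text \<open>Leading exponents add and are invariant under conjugation. If those of two positive
  elements add to zero, both elements lie in the cone of the tail; and the identity cannot have a
  positive exponent in an infinite factor.\<close>

lemma series_positive_normal_subsemi:
  "central_series G cs \<Longrightarrow> normal_subsemi G (series_positive G cs) \<and> \<one> \<notin> series_positive G cs"
proof (induction cs)
  case Nil
  then show ?case by (simp add: normal_subsemi_def)
next
  case (Cons c cs)
  then have cs: "central_series G cs" and c: "c \<in> carrier G" by simp_all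
  have IH: "normal_subsemi G (series_positive G cs)" "\<one> \<notin> series_positive G cs"
    using Cons.IH[OF cs] by auto
  show ?case
  proof (cases "infinite_factor G c cs")
    case False
    then show ?thesis using IH by simp
  next
    case True
    let ?T = "{c [^] k \<otimes> x | (k :: int) x. k > 0 \<and> x \<in> series_span G cs}"
    have pos: "series_positive G (c # cs) = series_positive G cs \<union> ?T" using True by simp
    have low: "series_positive G cs \<subseteq> {c [^] (0::int) \<otimes> x | x. x \<in> series_span G cs}"
      using series_positive_subset[OF cs] series_span_subset[OF cs] by force
    have T: "\<exists>z\<in>series_span G cs. \<exists>k. (k > 0 \<or> k = 0 \<and> a \<in> series_positive G cs) \<and> a = c [^] (k::int) \<otimes> z"
      if "a \<in> series_positive G (c # cs)" for a
      using that low unfolding pos by blast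
    have sub: "series_positive G (c # cs) \<subseteq> carrier G"
      using series_positive_subset[OF Cons.prems] series_span_subset[OF Cons.prems] by blast
    have "a \<otimes> b \<in> series_positive G (c # cs)"
      if ab: "a \<in> series_positive G (c # cs)" "b \<in> series_positive G (c # cs)" for a b
    proof -
      obtain k l :: int and x y where k: "k > 0 \<or> k = 0 \<and> a \<in> series_positive G cs" "a = c [^] k \<otimes> x"
        and x: "x \<in> series_span G cs" and l: "l > 0 \<or> l = 0 \<and> b \<in> series_positive G cs" "b = c [^] l \<otimes> y"
        and y: "y \<in> series_span G cs" using T[OF ab(1)] T[OF ab(2)] by blast
      obtain z where z: "z \<in> series_span G cs" "a \<otimes> b = c [^] (k + l) \<otimes> z"
        using series_span_absorb[OF Cons.prems x y, of k l] k l by blast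
      show ?thesis
      proof (cases "k + l > 0")
        case True
        then show ?thesis using z unfolding pos by blast
      next
        case False
        then have "a \<in> series_positive G cs" "b \<in> series_positive G cs" using k(1) l(1) by auto
        then show ?thesis using IH(1) unfolding pos by (auto simp: normal_subsemi_def)
      qed
    qed
    moreover have "g \<otimes> a \<otimes> inv g \<in> series_positive G (c # cs)"
      if a: "a \<in> series_positive G (c # cs)" and g: "g \<in> carrier G" for a g
    proof (cases "a \<in> series_positive G cs")
      case True
      then show ?thesis using IH(1) g unfolding pos by (auto simp: normal_subsemi_def)
    next
      case False
      then obtain k :: int and x where k: "k > 0" "a = c [^] k \<otimes> x" "x \<in> series_span G cs"
        using a unfolding pos by blast
      then show ?thesis using series_span_conj[OF Cons.prems k(3) g, of k] unfolding pos by blast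
    qed
    moreover have "\<one> \<notin> ?T"
    proof
      assume "\<one> \<in> ?T"
      then obtain k :: int and x where k: "k > 0" "\<one> = c [^] k \<otimes> x" "x \<in> series_span G cs" by blast
      have N: "subgroup (series_span G cs) G" by (rule normal_imp_subgroup[OF central_series_normal[OF cs]])
      have "x \<in> carrier G" using k(3) series_span_subset[OF cs] by blast
      then have "inv x = c [^] k" using k(2) c by (metis int_pow_closed inv_equality)
      then have "c [^] k \<in> series_span G cs" using subgroup.m_inv_closed[OF N k(3)] by simp
      then show False using infinite_factor_int_pow[OF Cons.prems True] k(1) by blast
    qed
    ultimately show ?thesis using sub IH(2) unfolding pos normal_subsemi_def by blast
  qed
qed

lemma one_notin_if_series_positive:
  assumes "central_series G cs" "S \<subseteq> series_positive G cs"
  shows "\<one> \<notin> normal_subsemigroup G S"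
  using series_positive_normal_subsemi[OF assms(1)] normal_subsemigroup_minimal[OF _ assms(2)] by blast

text \<open>Induction on the size of \<open>S\<close>: the kernel of the functional contains
  strictly fewer elements of \<open>S\<close>, and an element of least positive value generates an
  infinite factor above it. The group \<open>A\<close> is a parameter because the recursive call
  concerns this kernel.\<close>

lemma positive_series_exists:
  assumes nil: "nilpotent_group c G" and rs: "central_series G rs" "series_span G rs = carrier G"
  shows "finite S \<Longrightarrow> S \<subseteq> A \<Longrightarrow> A \<lhd> G \<Longrightarrow> \<one> \<notin> normal_subsemigroup G S \<Longrightarrow>
    \<exists>cs. central_series G cs \<and> series_span G cs = A \<and> S \<subseteq> series_positive G cs"
proof (induction "card S" arbitrary: S A rule: less_induct)
  case (less S A)
  have Asub: "subgroup A G" by (rule normal_imp_subgroup[OF less.prems(3)])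
  have AG: "A \<subseteq> carrier G" by (rule subgroup.subset[OF Asub])
  have extend: "\<exists>es. central_series G (es @ ds) \<and> series_span G (es @ ds) = A"
    if "central_series G ds" "series_span G ds \<subseteq> A" for ds
    using central_series_refine[OF rs(1) less.prems(3) that] AG rs(2) by (auto simp: Int_absorb2)
  show ?case
  proof (cases "S = {}")
    case True
    then show ?thesis using extend[of "[]"] subgroup.one_closed[OF Asub] by auto
  next
    case False
    have SG: "S \<subseteq> carrier G" using less.prems AG by blast
    define N where "N = generate G (normal_subsemigroup G S)"
    note inv_func = invariant_functional[OF nil rs less.prems(1) False SG less.prems(4) N_def]
    have N: "N \<lhd> G" by (rule inv_func(1))
    have Nsub: "subgroup N G" by (rule normal_imp_subgroup[OF N])
    have NG: "a \<in> carrier G" if "a \<in> N" for a using that subgroup.subset[OF Nsub] by blast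
    have N_mult: "a \<otimes> b \<in> N" if "a \<in> N" "b \<in> N" for a b using that subgroup.m_closed[OF Nsub] by blast
    have N_inv: "inv a \<in> N" if "a \<in> N" for a using that subgroup.m_inv_closed[OF Nsub] by blast
    have N_one: "\<one> \<in> N" by (rule subgroup.one_closed[OF Nsub])
    have N_pow: "a [^] (k::int) \<in> N" if "a \<in> N" for a k by (rule subgroup_int_pow_closed[OF Nsub that])
    have SN: "S \<subseteq> N"
      unfolding N_def by (auto intro: generate.incl normal_subsemigroup.incl)
    have "normal_subsemi G A"
      using AG subgroup.m_closed[OF Asub] normal.inv_op_closed2[OF less.prems(3)]
      by (auto simp: normal_subsemi_def)
    then have NA: "N \<subseteq> A" unfolding N_def
      using normal_subsemigroup_minimal less.prems(2) by (intro generate_subgroup_incl[OF _ Asub])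
    obtain \<Phi> :: "'a \<Rightarrow> int" where \<Phi>_mult: "\<And>a b. a \<in> N \<Longrightarrow> b \<in> N \<Longrightarrow> \<Phi> (a \<otimes> b) = \<Phi> a + \<Phi> b"
      and \<Phi>_conj: "\<And>a g. a \<in> N \<Longrightarrow> g \<in> carrier G \<Longrightarrow> \<Phi> (g \<otimes> a \<otimes> inv g) = \<Phi> a"
      and \<Phi>_nonneg: "\<And>s. s \<in> S \<Longrightarrow> \<Phi> s \<ge> 0" and \<Phi>_pos: "\<exists>s\<in>S. \<Phi> s > 0"
      using inv_func(2) by blast
    have \<Phi>_one: "\<Phi> \<one> = 0" using \<Phi>_mult[OF N_one N_one] by simp
    have \<Phi>_inv: "\<Phi> (inv a) = - \<Phi> a" if "a \<in> N" for a
      using \<Phi>_mult[OF that N_inv[OF that]] NG[OF that] \<Phi>_one by simp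
    have \<Phi>_nat_pow: "\<Phi> (a [^] n) = int n * \<Phi> a \<and> a [^] n \<in> N" if "a \<in> N" for a and n :: nat
      by (induction n) (use that N_mult N_one \<Phi>_mult \<Phi>_one in \<open>auto simp: distrib_right\<close>)
    have \<Phi>_pow: "\<Phi> (a [^] k) = k * \<Phi> a" if "a \<in> N" for a and k :: int
    proof (cases k rule: int_cases2)
      case (nonneg n)
      then show ?thesis using \<Phi>_nat_pow[OF that] by (simp add: int_pow_int)
    next
      case (nonpos n)
      then show ?thesis using \<Phi>_nat_pow[OF that] \<Phi>_inv NG[OF that] by (simp add: int_pow_neg int_pow_int)
    qed
    define K where "K = {a \<in> N. \<Phi> a = 0}"
    have "subgroup K G"
      by (rule subgroupI) (use NG N_one \<Phi>_one N_inv \<Phi>_inv N_mult \<Phi>_mult in \<open>auto simp: K_def\<close>)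
    then have K: "K \<lhd> G" unfolding normal_inv_iff
      using \<Phi>_conj normal.inv_op_closed2[OF N] by (auto simp: K_def)
    have "\<exists>d\<in>\<Phi> ` N. d \<ge> 0 \<and> (\<forall>k\<in>\<Phi> ` N. d dvd k)"
    proof (rule int_subgroup_principal)
      show "0 \<in> \<Phi> ` N" using N_one \<Phi>_one by force
      fix k l assume "k \<in> \<Phi> ` N" "l \<in> \<Phi> ` N"
      then obtain a b where "a \<in> N" "b \<in> N" "k = \<Phi> a" "l = \<Phi> b" by blast
      then have "k - l = \<Phi> (a \<otimes> inv b)" "a \<otimes> inv b \<in> N" using \<Phi>_mult \<Phi>_inv N_inv N_mult by auto
      then show "k - l \<in> \<Phi> ` N" by blast
    qed
    then obtain t where t: "t \<in> N" "\<Phi> t \<ge> 0" "\<And>a. a \<in> N \<Longrightarrow> \<Phi> t dvd \<Phi> a" by blast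
    obtain s0 where s0: "s0 \<in> S" "\<Phi> s0 > 0" using \<Phi>_pos by blast
    \<comment> \<open>The generator of the image is nonzero because some element of \<open>S\<close>
      has positive value; this makes the new factor infinite.\<close>
    have "\<Phi> t \<noteq> 0" using t(3)[of s0] s0 SN by auto
    then have t_pos: "\<Phi> t > 0" using t(2) by simp
    let ?S = "S \<inter> K"
    have "card ?S < card S"
    proof (rule psubset_card_mono[OF less.prems(1)])
      have "s0 \<notin> K" using s0(2) by (simp add: K_def)
      then show "?S \<subset> S" using s0(1) by blast
    qed
    moreover have "\<one> \<notin> normal_subsemigroup G ?S"
      using less.prems(4) normal_subsemigroup_mono[of ?S S] by blast
    ultimately obtain es where es: "central_series G es" "series_span G es = K"
      "?S \<subseteq> series_positive G es"
      using less.hyps[of ?S K] K less.prems(1) by blast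
    \<comment> \<open>Invariance under conjugation gives every commutator with \<open>t\<close> the
      value zero, which is exactly centrality of \<open>t\<close> modulo the kernel.\<close>
    have "centralizes G K g t" if g: "g \<in> carrier G" for g
    proof -
      have "g \<otimes> t \<otimes> inv g \<in> N" using normal.inv_op_closed2[OF N g t(1)] .
      then show ?thesis
        using \<Phi>_mult[OF _ N_inv[OF t(1)]] \<Phi>_conj[OF t(1) g] \<Phi>_inv[OF t(1)] N_mult N_inv t(1)
        by (simp add: centralizes_def K_def)
    qed
    then have ser: "central_series G (t # es)" using es NG[OF t(1)] by simp
    have decomp: "\<exists>x\<in>K. a = t [^] k \<otimes> x" if a: "a \<in> N" "\<Phi> a = \<Phi> t * k" for a and k :: int
    proof
      show "inv (t [^] k) \<otimes> a \<in> K"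
        using a N_pow[OF t(1)] N_inv N_mult \<Phi>_mult \<Phi>_inv \<Phi>_pow[OF t(1)] by (simp add: K_def)
      show "a = t [^] k \<otimes> (inv (t [^] k) \<otimes> a)" using NG a t by simp
    qed
    have "series_span G (t # es) \<subseteq> A"
      using es(2) N_pow[OF t(1)] N_mult NA by (auto simp: K_def)
    \<comment> \<open>The series \<open>t # es\<close> stays inside \<open>N\<close>; the entries
      \<open>fs\<close> fill the gap up to \<open>A\<close> and do not disturb the positive elements
      below them.\<close>
    then obtain fs where fs: "central_series G (fs @ t # es)" "series_span G (fs @ t # es) = A"
      using extend[OF ser] by blast
    have inf: "infinite_factor G t es"
      unfolding infinite_factor_def es(2) using \<Phi>_nat_pow[OF t(1)] t_pos by (auto simp: K_def)
    have "S \<subseteq> series_positive G (t # es)"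
    proof
      fix s assume s: "s \<in> S"
      then have sN: "s \<in> N" using SN by blast
      show "s \<in> series_positive G (t # es)"
      proof (cases "\<Phi> s = 0")
        case True
        then have "s \<in> ?S" using s sN by (simp add: K_def)
        then show ?thesis using es(3) by auto
      next
        case False
        then have pos: "\<Phi> s > 0" using \<Phi>_nonneg[OF s] by simp
        obtain k where k: "\<Phi> s = \<Phi> t * k" using t(3)[OF sN] by (auto elim: dvdE)
        then have "k > 0" using pos t_pos by (simp add: zero_less_mult_iff)
        moreover obtain x where "x \<in> K" "s = t [^] k \<otimes> x" using decomp[OF sN k] by blast
        ultimately show ?thesis using inf es(2) by auto
      qed
    qed
    then show ?thesis using fs series_positive_append_subset[of "t # es" fs] by blast
  qed
qed

end

section \<open>Extending partial orders on torsion-free nilpotent groups\<close>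

definition torsion_free :: "('a, 'b) monoid_scheme \<Rightarrow> bool" where
  "torsion_free G \<longleftrightarrow> (\<forall>x\<in>carrier G. \<forall>n::nat. n > 0 \<longrightarrow> x [^]\<^bsub>G\<^esub> n = \<one>\<^bsub>G\<^esub> \<longrightarrow> x = \<one>\<^bsub>G\<^esub>)"

context group begin

lemma normal_subsemi_insert_one:
  "normal_subsemi G P \<Longrightarrow> normal_subsemi G (insert \<one> P)"
  by (auto simp: normal_subsemi_def)

text \<open>Invariance of \<open>P\<close> under conjugation allows all copies of \<open>r\<close>
  to be collected on the right.\<close>

lemma comparable_pow:
  assumes P: "normal_subsemi G P" "\<one> \<in> P" and X: "X \<in> carrier G" and r: "r \<in> P"
  shows "\<exists>r'\<in>P. (X \<otimes> r) [^] (n::nat) = X [^] n \<otimes> r'"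
proof (induction n)
  case 0
  then show ?case using P by (intro bexI[of _ \<one>]) auto
next
  case (Suc n)
  then obtain r' where r': "r' \<in> P" "(X \<otimes> r) [^] n = X [^] n \<otimes> r'" by blast
  have G: "r \<in> carrier G" "r' \<in> carrier G" using r r'(1) P(1) by (auto simp: normal_subsemi_def)
  have "inv X \<otimes> r' \<otimes> inv (inv X) \<in> P" using P(1) r'(1) inv_closed[OF X] unfolding normal_subsemi_def by blast
  then have "inv X \<otimes> r' \<otimes> X \<otimes> r \<in> P" using P(1) r X by (simp add: normal_subsemi_def)
  moreover have "(X \<otimes> r) [^] Suc n = X [^] Suc n \<otimes> (inv X \<otimes> r' \<otimes> X \<otimes> r)"
    using X G r'(2) by (simp add: m_assoc)
  ultimately show ?case by blast
qed

text \<open>A product of pairwise comparable conjugates of \<open>x\<close> is bounded below by a power of the least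
  of them; this is what makes a maximal cone total.\<close>

lemma normal_subsemigroup_insert_comparable:
  assumes P: "normal_subsemi G P" and x: "x \<in> carrier G"
    and comp: "\<And>g. g \<in> carrier G \<Longrightarrow>
      x \<otimes> g \<otimes> inv x \<otimes> inv g \<in> insert \<one> P \<or> inv (x \<otimes> g \<otimes> inv x \<otimes> inv g) \<in> insert \<one> P"
    and u: "u \<in> normal_subsemigroup G (insert x P)"
  shows "u \<in> P \<or> (\<exists>(n::nat) h p. n > 0 \<and> h \<in> carrier G \<and> p \<in> insert \<one> P \<and> u = (h \<otimes> x \<otimes> inv h) [^] n \<otimes> p)"
proof -
  define P0 where "P0 = insert \<one> P"
  have P0: "normal_subsemi G P0" "\<one> \<in> P0" unfolding P0_def
    using normal_subsemi_insert_one[OF P] by auto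
  have P0G: "p \<in> carrier G" if "p \<in> P0" for p using that P0 by (auto simp: normal_subsemi_def)
  have P0_mult: "p \<otimes> r \<in> P0" if "p \<in> P0" "r \<in> P0" for p r using that P0 by (auto simp: normal_subsemi_def)
  have P0_conj: "g \<otimes> p \<otimes> inv g \<in> P0" if "p \<in> P0" "g \<in> carrier G" for p g
    using that P0 by (auto simp: normal_subsemi_def)
  have P0_conj': "inv g \<otimes> p \<otimes> g \<in> P0" if "p \<in> P0" "g \<in> carrier G" for p g
    using P0_conj[OF that(1) inv_closed[OF that(2)]] that by simp
  define C where "C h = h \<otimes> x \<otimes> inv h" for h
  have CG: "C h \<in> carrier G" if "h \<in> carrier G" for h using that x by (simp add: C_def)
  have compar: "(\<exists>r\<in>P0. C k = C h \<otimes> r) \<or> (\<exists>r\<in>P0. C h = C k \<otimes> r)"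
    if h: "h \<in> carrier G" and k: "k \<in> carrier G" for h k
  proof -
    \<comment> \<open>The quotient \<open>C h \<otimes> inv (C k)\<close> of two conjugates of
      \<open>x\<close> is \<open>h \<otimes> ?w \<otimes> inv h\<close>, a conjugate of the
      commutator of \<open>x\<close> with \<open>inv h \<otimes> k\<close>. So comparability of
      commutators with the identity makes the conjugates comparable.\<close>
    let ?g = "inv h \<otimes> k"
    let ?w = "x \<otimes> ?g \<otimes> inv x \<otimes> inv ?g"
    have w: "?w \<in> carrier G" using x h k by simp
    have 1: "C h = C k \<otimes> (inv (C k) \<otimes> (h \<otimes> ?w \<otimes> inv h) \<otimes> C k)"
      using x h k by (simp add: C_def m_assoc inv_mult_group)
    have 2: "C k = C h \<otimes> (inv (C h) \<otimes> (h \<otimes> inv ?w \<otimes> inv h) \<otimes> C h)"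
      using x h k by (simp add: C_def m_assoc inv_mult_group)
    have "?w \<in> P0 \<or> inv ?w \<in> P0" using comp[of ?g] h k by (simp add: P0_def)
    then show ?thesis
    proof
      assume "?w \<in> P0"
      then have "inv (C k) \<otimes> (h \<otimes> ?w \<otimes> inv h) \<otimes> C k \<in> P0" by (intro P0_conj' P0_conj h CG k)
      then show ?thesis using 1 by blast
    next
      assume "inv ?w \<in> P0"
      then have "inv (C h) \<otimes> (h \<otimes> inv ?w \<otimes> inv h) \<otimes> C h \<in> P0" by (intro P0_conj' P0_conj h CG)
      then show ?thesis using 2 by blast
    qed
  qed
  \<comment> \<open>The normal form for products that involve \<open>x\<close>: a positive power of
    a single conjugate, times an element of \<open>P0\<close>.\<close>
  define T where "T u \<longleftrightarrow> (\<exists>(n::nat) h p. n > 0 \<and> h \<in> carrier G \<and> p \<in> P0 \<and> u = C h [^] n \<otimes> p)" for u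
  have T_left: "T (p \<otimes> u)" if p: "p \<in> P0" and Tu: "T u" for p u
  proof -
    obtain n :: nat and h r where u: "n > 0" "h \<in> carrier G" "r \<in> P0" "u = C h [^] n \<otimes> r"
      using Tu unfolding T_def by blast
    have "p \<otimes> u = C h [^] n \<otimes> ((inv (C h [^] n) \<otimes> p \<otimes> C h [^] n) \<otimes> r)"
      using p u P0G CG by (simp add: m_assoc)
    moreover have "(inv (C h [^] n) \<otimes> p \<otimes> C h [^] n) \<otimes> r \<in> P0"
      using p u by (intro P0_mult P0_conj' nat_pow_closed CG)
    ultimately show ?thesis unfolding T_def using u(1,2) by blast
  qed
  have T_right: "T (u \<otimes> p)" if p: "p \<in> P0" and Tu: "T u" for p u
  proof -
    obtain n :: nat and h r where u: "n > 0" "h \<in> carrier G" "r \<in> P0" "u = C h [^] n \<otimes> r"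
      using Tu unfolding T_def by blast
    have "u \<otimes> p = C h [^] n \<otimes> (r \<otimes> p)" using p u P0G CG by (simp add: m_assoc)
    then show ?thesis unfolding T_def using u p P0_mult by blast
  qed
  \<comment> \<open>The smaller of the two conjugates absorbs the other, and
    \<open>comparable_pow\<close> turns the excess into an element of \<open>P0\<close>.\<close>
  have T_pow: "T (C h [^] n \<otimes> C k [^] m)"
    if nm: "n > 0" "m > 0" "h \<in> carrier G" "k \<in> carrier G" for n m :: nat and h k
    using compar[OF nm(3,4)]
  proof
    assume "\<exists>r\<in>P0. C k = C h \<otimes> r"
    then obtain r where r: "r \<in> P0" "C k [^] m = C h [^] m \<otimes> r"
      using comparable_pow[OF P0 CG[OF nm(3)], of _ m] by metis
    then have "C h [^] n \<otimes> C k [^] m = C h [^] (n + m) \<otimes> r"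
      using CG nm P0G by (simp add: m_assoc flip: nat_pow_mult)
    then show ?thesis unfolding T_def using nm r by (intro exI[of _ "n + m"] exI[of _ h] exI[of _ r]) auto
  next
    assume "\<exists>r\<in>P0. C h = C k \<otimes> r"
    then obtain r where r: "r \<in> P0" "C h [^] n = C k [^] n \<otimes> r"
      using comparable_pow[OF P0 CG[OF nm(4)], of _ n] by metis
    let ?r = "inv (C k [^] m) \<otimes> r \<otimes> C k [^] m"
    have "C h [^] n \<otimes> C k [^] m = C k [^] (n + m) \<otimes> ?r"
      using CG nm P0G r by (simp add: m_assoc flip: nat_pow_mult)
    moreover have "?r \<in> P0" using r nm by (intro P0_conj' nat_pow_closed CG)
    ultimately show ?thesis unfolding T_def using nm
      by (intro exI[of _ "n + m"] exI[of _ k] exI[of _ ?r]) auto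
  qed
  have T_mult: "T (u \<otimes> v)" if Tuv: "T u" "T v" for u v
  proof -
    obtain n :: nat and h r where u: "n > 0" "h \<in> carrier G" "r \<in> P0" "u = C h [^] n \<otimes> r"
      using Tuv(1) unfolding T_def by blast
    obtain m :: nat and k p where v: "m > 0" "k \<in> carrier G" "p \<in> P0" "v = C k [^] m \<otimes> p"
      using Tuv(2) unfolding T_def by blast
    let ?r = "inv (C k [^] m) \<otimes> r \<otimes> C k [^] m"
    have "u \<otimes> v = (C h [^] n \<otimes> C k [^] m) \<otimes> (?r \<otimes> p)"
      using u v CG P0G by (simp add: m_assoc)
    moreover have "?r \<otimes> p \<in> P0" using u v by (intro P0_mult P0_conj' nat_pow_closed CG)
    ultimately show ?thesis using T_right[OF _ T_pow[OF u(1) v(1) u(2) v(2)]] by simp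
  qed
  have T_conj: "T (g \<otimes> u \<otimes> inv g)" if Tu: "T u" and g: "g \<in> carrier G" for g u
  proof -
    obtain n :: nat and h r where u: "n > 0" "h \<in> carrier G" "r \<in> P0" "u = C h [^] n \<otimes> r"
      using Tu unfolding T_def by blast
    interpret c: group_hom G G "\<lambda>y. g \<otimes> y \<otimes> inv g" by (rule conj_hom[OF g])
    have "g \<otimes> C h [^] n \<otimes> inv g = (g \<otimes> C h \<otimes> inv g) [^] n" using c.hom_nat_pow[OF CG[OF u(2)], of n] .
    also have "g \<otimes> C h \<otimes> inv g = C (g \<otimes> h)" using g u(2) x by (simp add: C_def m_assoc inv_mult_group)
    finally have "g \<otimes> u \<otimes> inv g = C (g \<otimes> h) [^] n \<otimes> (g \<otimes> r \<otimes> inv g)"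
      using c.hom_mult[of "C h [^] n" r] u CG P0G by simp
    moreover have "g \<otimes> r \<otimes> inv g \<in> P0" by (rule P0_conj[OF u(3) g])
    moreover have "g \<otimes> h \<in> carrier G" using g u(2) by simp
    ultimately show ?thesis unfolding T_def using u(1) by blast
  qed
  have "u \<in> P \<or> T u" using u
  proof induction
    case (incl a)
    have "x = C \<one> [^] (1::nat) \<otimes> \<one>" using x by (simp add: C_def)
    then have "T x" unfolding T_def
      by (intro exI[of _ "1::nat"] exI[of _ \<one>]) (use P0(2) in simp)
    then show ?case using incl by (elim insertE) simp_all
  next
    case (mult a b)
    then consider "a \<in> P" "b \<in> P" | "a \<in> P" "T b" | "T a" "b \<in> P" | "T a" "T b" by blast
    then show ?case
    proof cases
      case 1
      then show ?thesis using P by (simp add: normal_subsemi_def)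
    next
      case 2
      then show ?thesis using T_left[of a b] by (simp add: P0_def)
    next
      case 3
      then show ?thesis using T_right[of b a] by (simp add: P0_def)
    next
      case 4
      then show ?thesis using T_mult[of a b] by simp
    qed
  next
    case (conj a b)
    then show ?case using T_conj[of a b] P by (auto simp: normal_subsemi_def)
  qed
  then show ?thesis unfolding T_def C_def P0_def .
qed

text \<open>Maximality forces the identity into the subsemigroup enlarged by \<open>x\<close>.
  Written as a power of a conjugate of \<open>x\<close> times an element of
  \<open>insert \<one> P\<close>, it shows that the inverse of a power of \<open>x\<close> is in
  \<open>insert \<one> P\<close>; torsion-freeness excludes the identity.\<close>

lemma maximal_normal_subsemi_pow:
  assumes tf: "torsion_free G" and P: "normal_subsemi G P" "\<one> \<notin> P"
    and max: "\<And>P'. normal_subsemi G P' \<Longrightarrow> P \<subseteq> P' \<Longrightarrow> \<one> \<notin> P' \<Longrightarrow> P' = P"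
    and x: "x \<in> carrier G" "x \<noteq> \<one>" "x \<notin> P"
    and comp: "\<And>g. g \<in> carrier G \<Longrightarrow>
      x \<otimes> g \<otimes> inv x \<otimes> inv g \<in> insert \<one> P \<or> inv (x \<otimes> g \<otimes> inv x \<otimes> inv g) \<in> insert \<one> P"
  shows "\<exists>n::nat. n > 0 \<and> inv (x [^] n) \<in> P"
proof -
  have PG: "P \<subseteq> carrier G" using P(1) by (simp add: normal_subsemi_def)
  let ?P' = "normal_subsemigroup G (insert x P)"
  have "normal_subsemi G ?P'" using x(1) PG by (intro normal_subsemi_normal_subsemigroup) auto
  moreover have "insert x P \<subseteq> ?P'" by (auto intro: normal_subsemigroup.incl)
  ultimately have "\<one> \<in> ?P'" using max[of ?P'] x(3) by blast
  then obtain n :: nat and h p where n: "n > 0" "h \<in> carrier G" "p \<in> insert \<one> P"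
    "\<one> = (h \<otimes> x \<otimes> inv h) [^] n \<otimes> p"
    using normal_subsemigroup_insert_comparable[OF P(1) x(1) comp] P(2) by blast
  have p: "p \<in> carrier G" using n(3) PG by auto
  interpret c: group_hom G G "\<lambda>y. h \<otimes> y \<otimes> inv h" by (rule conj_hom[OF n(2)])
  have "\<one> = h \<otimes> x [^] n \<otimes> inv h \<otimes> p" using n(4) c.hom_nat_pow[OF x(1), of n] by simp
  then have "inv (h \<otimes> x [^] n \<otimes> inv h) = p" using n(2) x(1) p by (metis inv_closed inv_equality inv_inv m_closed nat_pow_closed)
  then have "inv h \<otimes> p \<otimes> h = inv (x [^] n)" using n(2) x(1) by (auto simp: inv_mult_group m_assoc)
  moreover have "inv h \<otimes> p \<otimes> inv (inv h) \<in> insert \<one> P"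
    using normal_subsemi_insert_one[OF P(1)] n(2,3) inv_closed unfolding normal_subsemi_def by blast
  ultimately have "inv (x [^] n) \<in> insert \<one> P" using n(2) by simp
  moreover have "inv (x [^] n) \<noteq> \<one>" using tf x(1,2) n(1) by (auto simp: torsion_free_def)
  ultimately show ?thesis using n(1) by blast
qed

text \<open>Once the smaller term of the lower central series is settled, commutators with
  \<open>x\<close> are comparable with the identity. If neither \<open>x\<close> nor its inverse
  were in \<open>P\<close>, then \<open>P\<close> would contain a negative and a positive power of
  \<open>x\<close>; raised to each other's exponents, they multiply to the identity.\<close>

lemma maximal_normal_subsemi_total:
  assumes nil: "nilpotent_group c G" and tf: "torsion_free G" and P: "normal_subsemi G P" "\<one> \<notin> P"
    and max: "\<And>P'. normal_subsemi G P' \<Longrightarrow> P \<subseteq> P' \<Longrightarrow> \<one> \<notin> P' \<Longrightarrow> P' = P"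
    and x: "x \<in> carrier G"
  shows "x = \<one> \<or> x \<in> P \<or> inv x \<in> P"
proof -
  have "\<forall>x\<in>lower_central G (c - k). x = \<one> \<or> x \<in> P \<or> inv x \<in> P" if "k \<le> c" for k
    using that
  proof (induction k)
    case 0
    then show ?case using nil by (simp add: nilpotent_group_def)
  next
    case (Suc k)
    let ?i = "c - Suc k"
    have i: "c - k = Suc ?i" using Suc.prems by simp
    have IH: "y \<in> insert \<one> P \<or> inv y \<in> insert \<one> P" if "y \<in> lower_central G (Suc ?i)" for y
      using that Suc i by auto
    have comp: "x \<otimes> g \<otimes> inv x \<otimes> inv g \<in> insert \<one> P \<or> inv (x \<otimes> g \<otimes> inv x \<otimes> inv g) \<in> insert \<one> P"
      if "x \<in> lower_central G ?i" "g \<in> carrier G" for x g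
      using IH commutator_subgroup_normal(3)[OF lower_central_normal that]
      unfolding lower_central_Suc centralizes_def by blast
    show ?case
    proof
      fix x assume x: "x \<in> lower_central G ?i"
      then have xG: "x \<in> carrier G" using lower_central_subset by blast
      have ix: "inv x \<in> lower_central G ?i"
        using subgroup.m_inv_closed[OF normal_imp_subgroup[OF lower_central_normal] x] .
      show "x = \<one> \<or> x \<in> P \<or> inv x \<in> P"
      proof (rule ccontr)
        assume *: "\<not> (x = \<one> \<or> x \<in> P \<or> inv x \<in> P)"
        obtain n :: nat where n: "n > 0" "inv (x [^] n) \<in> P"
          using maximal_normal_subsemi_pow[OF tf P max xG _ _ comp[OF x]] * by blast
        have "inv x \<noteq> \<one>" using * xG by (simp add: inv_eq_1_iff)
        then obtain m :: nat where m: "m > 0" "inv (inv x [^] m) \<in> P"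
          using maximal_normal_subsemi_pow[OF tf P max inv_closed[OF xG] _ _ comp[OF ix]] * by blast
        have "inv (x [^] n) [^] int m \<in> P" "inv (inv x [^] m) [^] int n \<in> P"
          using n m by (auto intro: normal_subsemi_int_pow[OF P(1)])
        then have "inv (x [^] n) [^] int m \<otimes> inv (inv x [^] m) [^] int n \<in> P"
          using P(1) by (simp add: normal_subsemi_def)
        moreover have "inv (x [^] n) [^] int m \<otimes> inv (inv x [^] m) [^] int n = \<one>"
          using xG by (simp add: int_pow_int nat_pow_pow nat_pow_inv mult.commute)
        ultimately show False using P(2) by simp
      qed
    qed
  qed
  from this[of c] show ?thesis using x by simp
qed

lemma ex_maximal_normal_subsemi:
  assumes "S \<subseteq> carrier G" "\<one> \<notin> normal_subsemigroup G S"
  shows "\<exists>P. normal_subsemi G P \<and> S \<subseteq> P \<and> \<one> \<notin> P \<and>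
    (\<forall>P'. normal_subsemi G P' \<longrightarrow> P \<subseteq> P' \<longrightarrow> \<one> \<notin> P' \<longrightarrow> P' = P)"
proof -
  let ?A = "{P. normal_subsemi G P \<and> S \<subseteq> P \<and> \<one> \<notin> P}"
  have "normal_subsemigroup G S \<in> ?A"
    using assms normal_subsemi_normal_subsemigroup by (auto intro: normal_subsemigroup.incl)
  then have "?A \<noteq> {}" by blast
  moreover have "\<Union>C \<in> ?A" if C: "C \<noteq> {}" "subset.chain ?A C" for C
  proof -
    have CA: "X \<in> ?A" if "X \<in> C" for X using that C(2) by (auto simp: subset.chain_def)
    have "a \<otimes> b \<in> \<Union>C" if ab: "a \<in> X" "X \<in> C" "b \<in> Y" "Y \<in> C" for a b X Y
    proof -
      have "X \<subseteq> Y \<or> Y \<subseteq> X" using C(2) ab by (auto simp: subset.chain_def)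
      then obtain Z where "Z \<in> C" "a \<in> Z" "b \<in> Z" using ab by blast
      moreover have "a \<otimes> b \<in> Z" using CA[OF \<open>Z \<in> C\<close>] calculation by (simp add: normal_subsemi_def)
      ultimately show ?thesis by blast
    qed
    moreover have "g \<otimes> a \<otimes> inv g \<in> \<Union>C" if "a \<in> X" "X \<in> C" "g \<in> carrier G" for a g X
    proof -
      have "g \<otimes> a \<otimes> inv g \<in> X" using CA[OF that(2)] that by (simp add: normal_subsemi_def)
      then show ?thesis using that by blast
    qed
    moreover have "\<Union>C \<subseteq> carrier G" using CA unfolding normal_subsemi_def by blast
    moreover have "S \<subseteq> \<Union>C" "\<one> \<notin> \<Union>C" using CA C(1) by blast+
    ultimately show ?thesis unfolding normal_subsemi_def by blast
  qed
  ultimately have "\<exists>P\<in>?A. \<forall>P'\<in>?A. P \<subseteq> P' \<longrightarrow> P' = P" by (rule subset_Zorn_nonempty)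
  then obtain P where P: "P \<in> ?A" "\<forall>P'\<in>?A. P \<subseteq> P' \<longrightarrow> P' = P" by (elim bexE)
  have "P' = P" if "normal_subsemi G P'" "P \<subseteq> P'" "\<one> \<notin> P'" for P'
    using P that by auto
  with P(1) show ?thesis by (intro exI[of _ P]) simp
qed

section \<open>Total cones and bi-orders\<close>

lemma bi_order_of_cone:
  assumes P: "normal_subsemi G P" "\<one> \<notin> P"
    and total: "\<And>x. x \<in> carrier G \<Longrightarrow> x = \<one> \<or> x \<in> P \<or> inv x \<in> P"
  defines "R \<equiv> {(a, b). a \<in> carrier G \<and> b \<in> carrier G \<and> (a = b \<or> inv a \<otimes> b \<in> P)}"
  shows "bi_order G R" "P \<subseteq> positive_cone G R"
proof -
  have PG: "P \<subseteq> carrier G" using P(1) by (simp add: normal_subsemi_def)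
  have mult: "a \<otimes> b \<in> P" if "a \<in> P" "b \<in> P" for a b using that P(1) by (simp add: normal_subsemi_def)
  have conj: "inv g \<otimes> a \<otimes> g \<in> P" if "a \<in> P" "g \<in> carrier G" for a g
    using P(1) that(1) inv_closed[OF that(2)] that(2) unfolding normal_subsemi_def by fastforce
  have trans: "inv a \<otimes> c \<in> P" if "inv a \<otimes> b \<in> P" "inv b \<otimes> c \<in> P" "a \<in> carrier G" "b \<in> carrier G" "c \<in> carrier G" for a b c
    using mult[OF that(1,2)] that(3-5) by (simp add: m_assoc)
  have "trans R" unfolding R_def trans_def using trans by blast
  moreover have "antisym R"
  proof (rule antisymI)
    fix a b assume ab: "(a, b) \<in> R" "(b, a) \<in> R"
    show "a = b"
    proof (rule ccontr)
      assume "a \<noteq> b"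
      then have "inv a \<otimes> b \<in> P" "inv b \<otimes> a \<in> P" "a \<in> carrier G" "b \<in> carrier G"
        using ab by (auto simp: R_def)
      then have "inv a \<otimes> a \<in> P" using trans by blast
      then show False using P(2) \<open>a \<in> carrier G\<close> by simp
    qed
  qed
  moreover have "total_on (carrier G) R"
  proof (rule total_onI)
    fix a b assume ab: "a \<in> carrier G" "b \<in> carrier G" "a \<noteq> b"
    have "inv (inv a \<otimes> b) = inv b \<otimes> a" using ab by (simp add: inv_mult_group)
    moreover have "inv a \<otimes> b \<noteq> \<one>" using ab by (metis inv_closed inv_inv inv_equality)
    ultimately show "(a, b) \<in> R \<or> (b, a) \<in> R"
      using total[of "inv a \<otimes> b"] ab by (auto simp: R_def)
  qed
  ultimately have "linear_order_on (carrier G) R"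
    unfolding order_on_defs by (auto simp: R_def refl_on_def)
  moreover have "(c \<otimes> a \<otimes> d, c \<otimes> b \<otimes> d) \<in> R"
    if "a \<in> carrier G" "b \<in> carrier G" "c \<in> carrier G" "d \<in> carrier G" "(a, b) \<in> R" for a b c d
  proof -
    have "inv (c \<otimes> a \<otimes> d) \<otimes> (c \<otimes> b \<otimes> d) = inv d \<otimes> (inv a \<otimes> b) \<otimes> d"
      using that by (simp add: inv_mult_group m_assoc)
    then show ?thesis using that conj[of "inv a \<otimes> b" d] by (auto simp: R_def)
  qed
  ultimately show "bi_order G R" unfolding bi_order_def by blast
  show "P \<subseteq> positive_cone G R" using PG P(2) by (auto simp: positive_cone_def R_def)
qed

lemma positive_cone_normal_subsemi:
  assumes "bi_order G R"
  shows "normal_subsemi G (positive_cone G R)"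
proof -
  have R: "linear_order_on (carrier G) R" "\<And>a b c d. a \<in> carrier G \<Longrightarrow> b \<in> carrier G \<Longrightarrow>
    c \<in> carrier G \<Longrightarrow> d \<in> carrier G \<Longrightarrow> (a, b) \<in> R \<Longrightarrow> (c \<otimes> a \<otimes> d, c \<otimes> b \<otimes> d) \<in> R"
    using assms unfolding bi_order_def by blast+
  have tr: "trans R" and as: "antisym R" using R(1) by (auto simp: order_on_defs)
  have "a \<otimes> b \<in> positive_cone G R" if "a \<in> positive_cone G R" "b \<in> positive_cone G R" for a b
  proof -
    have ab: "a \<in> carrier G" "(\<one>, a) \<in> R" "a \<noteq> \<one>" "b \<in> carrier G" "(\<one>, b) \<in> R"
      using that by (auto simp: positive_cone_def)
    have *: "(a, a \<otimes> b) \<in> R" using R(2)[OF one_closed ab(4) ab(1) one_closed ab(5)] ab by simp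
    then have "(\<one>, a \<otimes> b) \<in> R" using ab(2) tr by (blast dest: transD)
    moreover have "a \<otimes> b \<noteq> \<one>" using * ab(2,3) as by (metis antisymD)
    ultimately show ?thesis using ab by (simp add: positive_cone_def)
  qed
  moreover have "g \<otimes> a \<otimes> inv g \<in> positive_cone G R" if "a \<in> positive_cone G R" "g \<in> carrier G" for a g
  proof -
    have a: "a \<in> carrier G" "(\<one>, a) \<in> R" "a \<noteq> \<one>" using that by (auto simp: positive_cone_def)
    have "(\<one>, g \<otimes> a \<otimes> inv g) \<in> R"
      using R(2)[OF one_closed a(1) that(2) inv_closed[OF that(2)] a(2)] that(2) by simp
    moreover have "g \<otimes> a \<otimes> inv g \<noteq> \<one>"
    proof
      assume "g \<otimes> a \<otimes> inv g = \<one>"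
      then have "inv g \<otimes> (g \<otimes> a \<otimes> inv g) \<otimes> g = \<one>" using that(2) by simp
      then show False using a that(2) by (simp add: m_assoc)
    qed
    ultimately show ?thesis using a that(2) by (simp add: positive_cone_def)
  qed
  ultimately show ?thesis by (auto simp: normal_subsemi_def positive_cone_def)
qed

lemma one_notin_normal_subsemigroup_if_bi_order:
  assumes "bi_order G R" "S \<subseteq> positive_cone G R"
  shows "\<one> \<notin> normal_subsemigroup G S"
  using normal_subsemigroup_minimal[OF positive_cone_normal_subsemi[OF assms(1)] assms(2)]
  by (auto simp: positive_cone_def)

text \<open>Either \<open>x\<close> or its inverse is positive, and so are all its positive
  powers.\<close>

lemma torsion_free_if_bi_order:
  assumes "bi_order G R"
  shows "torsion_free G"
  unfolding torsion_free_def
proof (intro ballI allI impI, rule ccontr)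
  fix x and n :: nat
  assume x: "x \<in> carrier G" and n: "n > 0" "x [^] n = \<one>" and ne: "x \<noteq> \<one>"
  let ?P = "positive_cone G R"
  note P = positive_cone_normal_subsemi[OF assms]
  have R: "linear_order_on (carrier G) R" "(\<one>, x) \<in> R \<or> (x, \<one>) \<in> R"
    using assms x ne by (auto simp: bi_order_def order_on_defs total_on_def)
  have "x \<in> ?P \<or> inv x \<in> ?P"
    using R(2)
  proof
    assume "(x, \<one>) \<in> R"
    then have "(inv x \<otimes> x \<otimes> \<one>, inv x \<otimes> \<one> \<otimes> \<one>) \<in> R"
      using assms x unfolding bi_order_def by blast
    then show ?thesis using x ne by (simp add: positive_cone_def inv_eq_1_iff)
  qed (use x ne in \<open>simp add: positive_cone_def\<close>)
  then have "x [^] int n \<in> ?P \<or> inv x [^] int n \<in> ?P"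
    using normal_subsemi_int_pow[OF P] n(1) by auto
  then have "\<one> \<in> ?P" using n(2) x by (auto simp: int_pow_int nat_pow_inv)
  then show False by (simp add: positive_cone_def)
qed

theorem bi_order_extension_iff:
  assumes "nilpotent_group c G" "torsion_free G" "S \<subseteq> carrier G"
  shows "(\<exists>R. bi_order G R \<and> S \<subseteq> positive_cone G R) \<longleftrightarrow> \<one> \<notin> normal_subsemigroup G S"
proof
  assume "\<one> \<notin> normal_subsemigroup G S"
  then obtain P where P: "normal_subsemi G P" "S \<subseteq> P" "\<one> \<notin> P"
    "\<And>P'. normal_subsemi G P' \<Longrightarrow> P \<subseteq> P' \<Longrightarrow> \<one> \<notin> P' \<Longrightarrow> P' = P"
    using ex_maximal_normal_subsemi[OF assms(3)] by blast
  note total = maximal_normal_subsemi_total[OF assms(1,2) P(1,3,4)]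
  show "\<exists>R. bi_order G R \<and> S \<subseteq> positive_cone G R"
    using bi_order_of_cone[OF P(1,3) total] P(2) by blast
qed (use one_notin_normal_subsemigroup_if_bi_order in blast)

end

section \<open>Computable normal forms\<close>

lemma computable_comp2:
  assumes "computable (\<lambda>m. f (pfst m) (psnd m))" "computable a" "computable b"
  shows "computable (\<lambda>n. f (a n) (b n))"
  using computable_compose[OF assms(1) computable_pair[OF assms(2,3)]] by simp

lemma decidable_comp2:
  assumes "decidable (\<lambda>m. P (pfst m) (psnd m))" "computable a" "computable b"
  shows "decidable (\<lambda>n. P (a n) (b n))"
  using decidable_subst[OF assms(1) computable_pair[OF assms(2,3)]] by simp

text \<open>The loop counts with a carry, for a modulus fixed in the program. For
  \<open>m = 0\<close> the carry never occurs, in agreement with \<open>n div 0 = 0\<close> and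
  \<open>n mod 0 = n\<close>; infinite factors use this case.\<close>

lemma computable_div_mod:
  assumes "computable a"
  shows "computable (\<lambda>n. a n div m)" "computable (\<lambda>n. a n mod m)"
proof -
  define step where "step = (\<lambda>(n::nat) s. if Suc (psnd s) = m then pair (Suc (pfst s)) 0
    else pair (pfst s) (Suc (psnd s)))"
  have eq: "(step n ^^ k) (pair 0 0) = pair (k div m) (k mod m)" for n k
    by (induction k) (auto simp: step_def div_Suc mod_Suc)
  have "computable (\<lambda>n. (step n ^^ a n) (pair 0 0))" unfolding step_def
    by (intro computable_funpow computable_if decidable_eq computable_pair computable_Suc
        computable_pfst computable_psnd computable_id computable_const assms)
  then have c: "computable (\<lambda>n. pair (a n div m) (a n mod m))" by (simp only: eq)
  show "computable (\<lambda>n. a n div m)" "computable (\<lambda>n. a n mod m)"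
    using computable_pfst[OF c] computable_psnd[OF c] by simp_all
qed

text \<open>Codes need not be unique; decidable equality makes up for it. The range \<open>K\<close>
  is kept apart from the carrier of \<open>G\<close> because the induction runs over the spans of
  tails.\<close>

definition computable_numbering :: "('a, 'b) monoid_scheme \<Rightarrow> 'a set \<Rightarrow> (nat \<Rightarrow> 'a) \<Rightarrow> bool" where
  "computable_numbering G K \<nu> \<longleftrightarrow> range \<nu> = K \<and>
     (\<exists>\<mu>. computable (\<lambda>m. \<mu> (pfst m) (psnd m)) \<and> (\<forall>a b. \<nu> (\<mu> a b) = \<nu> a \<otimes>\<^bsub>G\<^esub> \<nu> b)) \<and>
     (\<exists>\<iota>. computable \<iota> \<and> (\<forall>a. \<nu> (\<iota> a) = inv\<^bsub>G\<^esub> \<nu> a)) \<and>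
     decidable (\<lambda>m. \<nu> (pfst m) = \<nu> (psnd m))"

text \<open>An integer exponent is coded as a difference of two natural numbers, so that products
  and inverses require no case distinction on signs.\<close>

primrec series_numbering :: "('a, 'b) monoid_scheme \<Rightarrow> 'a list \<Rightarrow> nat \<Rightarrow> 'a" where
  "series_numbering G [] n = \<one>\<^bsub>G\<^esub>"
| "series_numbering G (c # cs) n =
     c [^]\<^bsub>G\<^esub> (int (pfst (pfst n)) - int (psnd (pfst n))) \<otimes>\<^bsub>G\<^esub> series_numbering G cs (psnd n)"

lemma range_series_numbering: "range (series_numbering G cs) = series_span G cs"
proof (induction cs)
  case (Cons c cs)
  show ?case
  proof (intro equalityI subsetI)
    fix a assume "a \<in> range (series_numbering G (c # cs))"
    then obtain n where "a = series_numbering G (c # cs) n" by blast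
    moreover have "series_numbering G cs (psnd n) \<in> series_span G cs" using Cons by blast
    ultimately show "a \<in> series_span G (c # cs)" by (simp only: series_numbering.simps series_span_ConsI)
  next
    fix a assume "a \<in> series_span G (c # cs)"
    then obtain k :: int and x where x: "a = c [^]\<^bsub>G\<^esub> k \<otimes>\<^bsub>G\<^esub> x" "x \<in> series_span G cs" by auto
    then obtain n where "x = series_numbering G cs n" using Cons by blast
    with x have a: "a = c [^]\<^bsub>G\<^esub> k \<otimes>\<^bsub>G\<^esub> series_numbering G cs n" by simp
    have "int (nat k) - int (nat (- k)) = k" by simp
    then have "a = series_numbering G (c # cs) (pair (pair (nat k) (nat (- k))) n)"
      using a by (simp del: nat_minus_as_int)
    then show "a \<in> range (series_numbering G (c # cs))" by blast
  qed
qed auto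

context group begin

lemma computable_numbering_pow:
  assumes "computable_numbering G K \<nu>" "subgroup K G"
  shows "\<exists>\<pi>. computable (\<lambda>m. \<pi> (pfst m) (psnd m)) \<and> (\<forall>a k. \<nu> (\<pi> a k) = \<nu> a [^] (k::nat))"
proof -
  obtain \<mu> where \<mu>: "computable (\<lambda>m. \<mu> (pfst m) (psnd m))" "\<And>a b. \<nu> (\<mu> a b) = \<nu> a \<otimes> \<nu> b"
    using assms(1) unfolding computable_numbering_def by blast
  have range: "range \<nu> = K" using assms(1) by (simp add: computable_numbering_def)
  have G: "\<nu> a \<in> carrier G" for a using range assms(2) subgroup.subset by blast
  obtain e where e: "\<nu> e = \<one>" using range subgroup.one_closed[OF assms(2)] by (metis imageE)
  define \<pi> where "\<pi> a k = (\<mu> a ^^ k) e" for a k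
  have "computable (\<lambda>m. ((\<lambda>x. \<mu> (pfst m) x) ^^ psnd m) e)"
    by (intro computable_funpow computable_comp2[OF \<mu>(1)] computable_pfst computable_psnd
        computable_id computable_const)
  then have "computable (\<lambda>m. \<pi> (pfst m) (psnd m))" by (simp add: \<pi>_def)
  moreover have "\<nu> (\<pi> a k) = \<nu> a [^] k" for a and k :: nat
    unfolding \<pi>_def using e G nat_pow_Suc2[OF G] by (induction k) (simp_all add: \<mu>(2))
  ultimately show ?thesis by blast
qed

text \<open>A homomorphism is computed on normal forms from the codes of the images of the generators.\<close>

lemma computable_hom:
  assumes num: "computable_numbering G K \<nu>" and K: "subgroup K G" and \<phi>: "group_hom G G \<phi>"
    and "set cs \<subseteq> carrier G" "\<phi> ` set cs \<subseteq> K"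
  shows "\<exists>f. computable f \<and> (\<forall>n. \<nu> (f n) = \<phi> (series_numbering G cs n))"
proof -
  interpret \<phi>: group_hom G G \<phi> by (rule \<phi>)
  obtain \<mu> where \<mu>: "computable (\<lambda>m. \<mu> (pfst m) (psnd m))" "\<And>a b. \<nu> (\<mu> a b) = \<nu> a \<otimes> \<nu> b"
    using num unfolding computable_numbering_def by blast
  obtain \<iota> where \<iota>: "computable \<iota>" "\<And>a. \<nu> (\<iota> a) = inv \<nu> a"
    using num unfolding computable_numbering_def by blast
  obtain \<pi> where \<pi>: "computable (\<lambda>m. \<pi> (pfst m) (psnd m))" "\<And>a k. \<nu> (\<pi> a k) = \<nu> a [^] (k::nat)"
    using computable_numbering_pow[OF num K] by blast
  have range: "range \<nu> = K" using num by (simp add: computable_numbering_def)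
  obtain e where e: "\<nu> e = \<one>" using range subgroup.one_closed[OF K] by (metis imageE)
  show ?thesis using assms(4,5)
  proof (induction cs)
    case Nil
    then show ?case using e computable_const by (intro exI[of _ "\<lambda>_. e"]) simp
  next
    case (Cons c cs)
    then obtain f where f: "computable f" "\<And>n. \<nu> (f n) = \<phi> (series_numbering G cs n)" by auto
    have c: "c \<in> carrier G" using Cons.prems by simp
    have sG: "series_numbering G cs n \<in> carrier G" for n
    proof -
      have "set cs \<subseteq> carrier G" using Cons.prems by simp
      then show ?thesis by (induction cs arbitrary: n) auto
    qed
    have "\<phi> c \<in> K" using Cons.prems by simp
    then obtain d where d: "\<nu> d = \<phi> c" using range by (metis imageE)
    define g where "g n = \<mu> (\<mu> (\<pi> d (pfst (pfst n))) (\<iota> (\<pi> d (psnd (pfst n))))) (f (psnd n))" for n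
    have "computable g" unfolding g_def
      by (intro computable_comp2[OF \<mu>(1)] computable_comp2[OF \<pi>(1)] computable_compose[OF \<iota>(1)]
          computable_compose[OF f(1)] computable_pfst computable_psnd computable_id computable_const)
    moreover have "\<nu> (g n) = \<phi> (series_numbering G (c # cs) n)" for n
    proof -
      have "\<nu> (g n) = \<phi> c [^] pfst (pfst n) \<otimes> inv (\<phi> c [^] psnd (pfst n)) \<otimes> \<phi> (series_numbering G cs (psnd n))"
        by (simp add: g_def \<mu>(2) \<pi>(2) \<iota>(2) f(2) d)
      also have "\<dots> = \<phi> (series_numbering G (c # cs) n)"
        using c sG by (simp add: int_pow_diff \<phi>.hom_int_pow \<phi>.hom_nat_pow int_pow_int)
      finally show ?thesis .
    qed
    ultimately show ?case by blast
  qed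
qed

text \<open>The collection step of multiplication: moving \<open>c [^] l\<close> to the left
  conjugates \<open>x\<close>.\<close>

lemma int_pow_conj:
  assumes "c \<in> carrier G" "x \<in> carrier G" "y \<in> carrier G"
  shows "c [^] (k::int) \<otimes> x \<otimes> (c [^] (l::int) \<otimes> y) = c [^] (k + l) \<otimes> (c [^] (- l) \<otimes> x \<otimes> c [^] l \<otimes> y)"
  using assms by (simp add: int_pow_mult int_pow_neg m_assoc)

lemma int_pow_eq_iff:
  assumes "c \<in> carrier G" "x \<in> carrier G" "y \<in> carrier G"
  shows "c [^] (k::int) \<otimes> x = c [^] (l::int) \<otimes> y \<longleftrightarrow> c [^] (k - l) \<otimes> x = y"
proof -
  have "c [^] (k - l) \<otimes> x = inv (c [^] l) \<otimes> (c [^] k \<otimes> x)"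
    using assms int_pow_mult[OF assms(1), of "- l" k] by (simp add: int_pow_neg m_assoc)
  then show ?thesis using assms by (metis int_pow_closed inv_mult_cancel_left m_closed)
qed

text \<open>Each step puts one generator \<open>c\<close> on top of a computable group
  \<open>K\<close>. Products need conjugation of \<open>K\<close> by powers of \<open>c\<close>;
  conjugation by \<open>c\<close> is determined by finitely many values, hence computable, and can
  be iterated. Equality needs the exponents \<open>k\<close> with \<open>c [^] k\<close> in
  \<open>K\<close>, which are the multiples of one constant.\<close>

lemma computable_series_numbering:
  "central_series G cs \<Longrightarrow> computable_numbering G (series_span G cs) (series_numbering G cs)"
proof (induction cs)
  case Nil
  have "decidable (\<lambda>m. True)" by (rule decidableI[OF computable_const[of 0]]) simp
  then show ?case unfolding computable_numbering_def
    using computable_id computable_const[of 0] by (auto intro!: exI[of _ "\<lambda>_. 0"] exI[of _ "\<lambda>_ _. 0"])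
next
  case (Cons c cs)
  define K where "K = series_span G cs"
  define \<nu> where "\<nu> = series_numbering G cs"
  have c: "c \<in> carrier G" and cs: "central_series G cs" using Cons.prems by simp_all
  have N: "K \<lhd> G" unfolding K_def by (rule central_series_normal[OF cs])
  have K: "subgroup K G" by (rule normal_imp_subgroup[OF N])
  have KG: "x \<in> carrier G" if "x \<in> K" for x using that subgroup.subset[OF K] by blast
  have num: "computable_numbering G K \<nu>" using Cons.IH[OF cs] by (simp add: K_def \<nu>_def)
  have range: "range \<nu> = K" using num by (simp add: computable_numbering_def)
  have \<nu>K: "\<nu> n \<in> K" for n using range by blast
  have \<nu>G: "\<nu> n \<in> carrier G" for n using \<nu>K KG by blast
  obtain \<mu> where \<mu>: "computable (\<lambda>m. \<mu> (pfst m) (psnd m))" "\<And>a b. \<nu> (\<mu> a b) = \<nu> a \<otimes> \<nu> b"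
    using num unfolding computable_numbering_def by blast
  obtain \<iota> where \<iota>: "computable \<iota>" "\<And>a. \<nu> (\<iota> a) = inv \<nu> a"
    using num unfolding computable_numbering_def by blast
  obtain \<pi> where \<pi>: "computable (\<lambda>m. \<pi> (pfst m) (psnd m))" "\<And>a k. \<nu> (\<pi> a k) = \<nu> a [^] (k::nat)"
    using computable_numbering_pow[OF num K] by blast
  have dec: "decidable (\<lambda>m. \<nu> (pfst m) = \<nu> (psnd m))"
    using num by (simp add: computable_numbering_def)
  have conj: "\<exists>f. computable f \<and> (\<forall>n. \<nu> (f n) = g \<otimes> \<nu> n \<otimes> inv g)" if g: "g \<in> carrier G" for g
  proof -
    have *: "(\<lambda>x. g \<otimes> x \<otimes> inv g) ` K \<subseteq> K" using normal.inv_op_closed2[OF N g] by blast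
    have csK: "set cs \<subseteq> K" using set_subset_series_span[OF cs] by (simp add: K_def)
    show ?thesis unfolding \<nu>_def
    proof (rule computable_hom[OF num[unfolded \<nu>_def] K conj_hom[OF g]])
      show "set cs \<subseteq> carrier G" using csK KG by blast
      show "(\<lambda>x. g \<otimes> x \<otimes> inv g) ` set cs \<subseteq> K" using csK * by blast
    qed
  qed
  obtain \<alpha> where \<alpha>: "computable \<alpha>" "\<And>n. \<nu> (\<alpha> n) = c \<otimes> \<nu> n \<otimes> inv c" using conj[OF c] by blast
  obtain \<beta> where \<beta>: "computable \<beta>" "\<And>n. \<nu> (\<beta> n) = inv c \<otimes> \<nu> n \<otimes> inv (inv c)"
    using conj[OF inv_closed[OF c]] by blast
  have \<alpha>_pow: "\<nu> ((\<alpha> ^^ k) n) = c [^] int k \<otimes> \<nu> n \<otimes> c [^] (- int k)" for k n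
  proof (induction k)
    case (Suc k)
    have "c [^] int (Suc k) = c \<otimes> c [^] int k" "c [^] (- int (Suc k)) = c [^] (- int k) \<otimes> inv c"
      using c int_pow_mult[OF c, of 1 "int k"] int_pow_mult[OF c, of "- int k" "- 1"]
      by (simp_all add: int_pow_neg add.commute)
    then show ?case using Suc c \<nu>G by (simp add: \<alpha>(2) m_assoc)
  qed (use \<nu>G in simp)
  have \<beta>_pow: "\<nu> ((\<beta> ^^ k) n) = c [^] (- int k) \<otimes> \<nu> n \<otimes> c [^] int k" for k n
  proof (induction k)
    case (Suc k)
    have "c [^] int (Suc k) = c [^] int k \<otimes> c" "c [^] (- int (Suc k)) = inv c \<otimes> c [^] (- int k)"
      using c int_pow_mult[OF c, of "int k" 1] int_pow_mult[OF c, of "- 1" "- int k"]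
      by (simp_all add: int_pow_neg add.commute)
    then show ?case using Suc c \<nu>G by (simp add: \<beta>(2) m_assoc)
  qed (use \<nu>G in simp)
  \<comment> \<open>Forward and backward iterations combine to conjugation by a signed power,
    without comparing \<open>k\<close> and \<open>l\<close>.\<close>
  have \<alpha>\<beta>: "\<nu> ((\<beta> ^^ k) ((\<alpha> ^^ l) n)) = c [^] (int l - int k) \<otimes> \<nu> n \<otimes> c [^] (int k - int l)" for k l n
  proof -
    have "c [^] (int l - int k) = c [^] (- int k) \<otimes> c [^] int l"
      "c [^] (int k - int l) = c [^] (- int l) \<otimes> c [^] int k"
      using int_pow_mult[OF c, of "- int k" "int l"] int_pow_mult[OF c, of "- int l" "int k"]
      by (simp_all add: add.commute)
    then show ?thesis unfolding \<beta>_pow \<alpha>_pow using c \<nu>G by (simp add: m_assoc)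
  qed
  let ?\<nu> = "series_numbering G (c # cs)"
  have \<nu>': "?\<nu> n = c [^] (int (pfst (pfst n)) - int (psnd (pfst n))) \<otimes> \<nu> (psnd n)" for n
    by (simp add: \<nu>_def)
  define \<mu>' where "\<mu>' = (\<lambda>a b. pair
    (pair (pfst (pfst a) + pfst (pfst b)) (psnd (pfst a) + psnd (pfst b)))
    (\<mu> ((\<beta> ^^ pfst (pfst b)) ((\<alpha> ^^ psnd (pfst b)) (psnd a))) (psnd b)))"
  have "computable (\<lambda>m. \<mu>' (pfst m) (psnd m))" unfolding \<mu>'_def
    by (intro computable_pair computable_add computable_comp2[OF \<mu>(1)] computable_funpow
        computable_compose[OF \<alpha>(1)] computable_compose[OF \<beta>(1)] computable_pfst computable_psnd computable_id)
  moreover have "?\<nu> (\<mu>' a b) = ?\<nu> a \<otimes> ?\<nu> b" for a b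
  proof -
    let ?k = "int (pfst (pfst a)) - int (psnd (pfst a))"
    let ?l = "int (pfst (pfst b)) - int (psnd (pfst b))"
    have "?\<nu> (\<mu>' a b) = c [^] (?k + ?l) \<otimes> (c [^] (- ?l) \<otimes> \<nu> (psnd a) \<otimes> c [^] ?l \<otimes> \<nu> (psnd b))"
      unfolding \<nu>' by (simp add: \<mu>'_def \<mu>(2) \<alpha>\<beta> algebra_simps)
    also have "\<dots> = ?\<nu> a \<otimes> ?\<nu> b" unfolding \<nu>' using int_pow_conj[OF c \<nu>G \<nu>G] by simp
    finally show ?thesis .
  qed
  moreover define \<iota>' where "\<iota>' = (\<lambda>a. pair (pair (psnd (pfst a)) (pfst (pfst a)))
    ((\<beta> ^^ psnd (pfst a)) ((\<alpha> ^^ pfst (pfst a)) (\<iota> (psnd a)))))"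
  have "computable \<iota>'" unfolding \<iota>'_def
    by (intro computable_pair computable_funpow computable_compose[OF \<alpha>(1)] computable_compose[OF \<beta>(1)]
        computable_compose[OF \<iota>(1)] computable_pfst computable_psnd computable_id)
  moreover have "?\<nu> (\<iota>' a) = inv ?\<nu> a" for a
  proof -
    let ?k = "int (pfst (pfst a)) - int (psnd (pfst a))"
    have "?\<nu> (\<iota>' a) = c [^] (- ?k) \<otimes> (c [^] ?k \<otimes> inv \<nu> (psnd a) \<otimes> c [^] (- ?k))"
      unfolding \<nu>' by (simp add: \<iota>'_def \<iota>(2) \<alpha>\<beta>)
    also have "\<dots> = inv \<nu> (psnd a) \<otimes> c [^] (- ?k)"
      using c \<nu>G by (simp add: int_pow_neg m_assoc del: minus_diff_eq)
    also have "\<dots> = inv ?\<nu> a" unfolding \<nu>' using c \<nu>G by (simp add: inv_mult_group int_pow_neg del: minus_diff_eq)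
    finally show ?thesis .
  qed
  moreover have "decidable (\<lambda>m. ?\<nu> (pfst m) = ?\<nu> (psnd m))"
  proof -
    define I where "I = {k::int. c [^] k \<in> K}"
    have "\<exists>d\<in>I. d \<ge> 0 \<and> (\<forall>k\<in>I. d dvd k)"
    proof (rule int_subgroup_principal)
      show "0 \<in> I" using subgroup.one_closed[OF K] by (simp add: I_def)
      show "a - b \<in> I" if "a \<in> I" "b \<in> I" for a b
        using that c subgroup.m_closed[OF K] subgroup.m_inv_closed[OF K] by (simp add: I_def int_pow_diff)
    qed
    then obtain d :: int where d: "c [^] d \<in> K" "d \<ge> 0" "\<And>k::int. c [^] k \<in> K \<Longrightarrow> d dvd k"
      unfolding I_def by blast
    \<comment> \<open>\<open>m\<close> is the order of \<open>c\<close> modulo \<open>K\<close>, or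
      0 if that order is infinite; \<open>m\<close> and the code \<open>u\<close> of
      \<open>c [^] m\<close> are constants of the program.\<close>
    define m where "m = nat d"
    have m: "c [^] m \<in> K" "\<And>k::int. c [^] k \<in> K \<Longrightarrow> int m dvd k"
      using d int_pow_int[of G c m] by (simp_all add: m_def)
    obtain u where u: "\<nu> u = c [^] m" using m(1) range by (metis imageE)
    \<comment> \<open>\<open>s a b - s b a\<close> is the difference of the two exponents of
      \<open>c\<close>, expressed through natural numbers. Equal remainders modulo \<open>m\<close>
      put this power of \<open>c\<close> into \<open>K\<close>, and the quotients express it by
      powers of \<open>u\<close>.\<close>
    define s where "s a b = pfst (pfst a) + psnd (pfst b)" for a b
    have crit: "?\<nu> a = ?\<nu> b \<longleftrightarrow> s a b mod m = s b a mod m \<and>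
        \<nu> (\<mu> (\<pi> u (s a b div m)) (psnd a)) = \<nu> (\<mu> (\<pi> u (s b a div m)) (psnd b))" for a b
    proof -
      let ?k = "int (pfst (pfst a)) - int (psnd (pfst a))"
      let ?l = "int (pfst (pfst b)) - int (psnd (pfst b))"
      let ?x = "\<nu> (psnd a)" and ?y = "\<nu> (psnd b)"
      have kl: "?k - ?l = int (s a b) - int (s b a)" by (simp add: s_def)
      have eq1: "?\<nu> a = ?\<nu> b \<longleftrightarrow> c [^] (?k - ?l) \<otimes> ?x = ?y"
        unfolding \<nu>' by (rule int_pow_eq_iff[OF c \<nu>G \<nu>G])
      have eq2: "c [^] (?k - ?l) \<otimes> ?x = ?y \<longleftrightarrow>
          \<nu> (\<mu> (\<pi> u (s a b div m)) (psnd a)) = \<nu> (\<mu> (\<pi> u (s b a div m)) (psnd b))"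
        if mods: "s a b mod m = s b a mod m"
      proof -
        let ?t = "s b a div m" and ?t' = "s a b div m"
        have cm: "c [^] (int m * int t) = (c [^] m) [^] t" for t
          using int_pow_pow[OF c, of "int m" "int t"] by (simp only: int_pow_int)
        have "int (s a b) = int m * int ?t' + int (s a b mod m)"
          "int (s b a) = int m * int ?t + int (s b a mod m)"
          by (metis of_nat_add of_nat_mult mult_div_mod_eq)+
        then have "?k - ?l = int m * int ?t' - int m * int ?t" using kl mods by linarith
        then have "c [^] (?k - ?l) = inv (c [^] (int m * int ?t)) \<otimes> c [^] (int m * int ?t')"
          using int_pow_mult[OF c, of "- (int m * int ?t)" "int m * int ?t'"] c
          by (simp add: int_pow_neg)
        also have "\<dots> = inv ((c [^] m) [^] ?t) \<otimes> (c [^] m) [^] ?t'"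
          by (simp only: cm)
        finally have "c [^] (?k - ?l) = inv ((c [^] m) [^] ?t) \<otimes> (c [^] m) [^] ?t'" .
        then show ?thesis unfolding \<mu>(2) \<pi>(2) u
          using c \<nu>G by (simp add: m_assoc inv_solve_left')
      qed
      have "s a b mod m = s b a mod m" if "c [^] (?k - ?l) \<otimes> ?x = ?y"
      proof -
        have "c [^] (?k - ?l) = ?y \<otimes> inv ?x"
          using that c \<nu>G inv_solve_right[of "c [^] (?k - ?l)" ?y ?x] by simp
        then have "c [^] (?k - ?l) \<in> K"
          using \<nu>K subgroup.m_closed[OF K] subgroup.m_inv_closed[OF K] by simp
        then have "int m dvd int (s a b) - int (s b a)" using m(2) kl by metis
        then have "int (s a b) mod int m = int (s b a) mod int m" by (simp add: mod_eq_dvd_iff)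
        then show ?thesis by (metis of_nat_eq_iff zmod_int)
      qed
      then show ?thesis using eq1 eq2 by blast
    qed
    show ?thesis unfolding crit s_def
      by (intro decidable_conj decidable_eq decidable_comp2[OF dec] computable_div_mod
          computable_comp2[OF \<mu>(1)] computable_comp2[OF \<pi>(1)] computable_add computable_pfst
          computable_psnd computable_id computable_const)
  qed
  ultimately show ?case unfolding computable_numbering_def range_series_numbering by blast
qed

end

section \<open>Semidecidable certificates\<close>

text \<open>It suffices to exhibit at most \<open>h\<close> factors, at the positions \<open>f i\<close>, such that all others are
  visibly finite: if \<open>h\<close> is the number of infinite factors, the exhibited ones are then infinite.\<close>

definition positive_certificate ::
  "('a, 'b) monoid_scheme \<Rightarrow> 'a set \<Rightarrow> 'a set \<Rightarrow> nat \<Rightarrow> 'a list \<Rightarrow> (nat \<Rightarrow> nat) \<Rightarrow> bool" where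
  "positive_certificate G X S h cs f \<longleftrightarrow> X \<subseteq> generate G (set cs) \<and>
    (\<forall>j<length cs.
      (\<forall>x\<in>X. centralizes G (generate G (set (drop (Suc j) cs))) x (cs ! j)) \<and>
      ((\<exists>i<h. f i = j) \<or> (\<exists>m::nat. cs ! j [^]\<^bsub>G\<^esub> Suc m \<in> generate G (set (drop (Suc j) cs))))) \<and>
    (\<forall>s\<in>S. \<exists>j<length cs. (\<exists>i<h. f i = j) \<and>
      (\<exists>k::nat. \<exists>x\<in>generate G (set (drop (Suc j) cs)). s = cs ! j [^]\<^bsub>G\<^esub> Suc k \<otimes>\<^bsub>G\<^esub> x))"

context group begin

text \<open>Spans are replaced by generated subgroups and centrality is tested on \<open>X\<close>
  only, so that for finite \<open>X\<close> finitely many memberships certify the series.\<close>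

lemma central_series_iff_nth:
  assumes X: "X \<subseteq> carrier G" "generate G X = carrier G" and cs: "set cs \<subseteq> carrier G"
  shows "central_series G cs \<longleftrightarrow> (\<forall>j<length cs. \<forall>x\<in>X.
    centralizes G (generate G (set (drop (Suc j) cs))) x (cs ! j))"
  using cs
proof (induction cs)
  case (Cons c cs)
  then have IH: "central_series G cs \<longleftrightarrow> (\<forall>j<length cs. \<forall>x\<in>X.
    centralizes G (generate G (set (drop (Suc j) cs))) x (cs ! j))" and c: "c \<in> carrier G" by auto
  have "(\<forall>g\<in>carrier G. centralizes G (series_span G cs) g c) \<longleftrightarrow>
      (\<forall>x\<in>X. centralizes G (generate G (set cs)) x c)" if ser: "central_series G cs"
    unfolding series_span_eq_generate[OF ser]
  proof
    assume *: "\<forall>x\<in>X. centralizes G (generate G (set cs)) x c"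
    interpret N: normal "generate G (set cs)" G
      using central_series_normal[OF ser] series_span_eq_generate[OF ser] by simp
    show "\<forall>g\<in>carrier G. centralizes G (generate G (set cs)) g c"
      using N.centralizes_generate'[OF c X(1)] * X(2) by blast
  qed (use X(1) in blast)
  then show ?case using IH c by (auto simp: All_less_Suc2)
qed simp

lemma infinite_length_eq_card:
  "infinite_length G cs = card {j. j < length cs \<and> infinite_factor G (cs ! j) (drop (Suc j) cs)}"
proof (induction cs)
  case (Cons c cs)
  let ?I = "{j. j < length cs \<and> infinite_factor G (cs ! j) (drop (Suc j) cs)}"
  have "{j. j < length (c # cs) \<and> infinite_factor G ((c # cs) ! j) (drop (Suc j) (c # cs))} =
      Suc ` ?I \<union> (if infinite_factor G c cs then {0} else {})"
    by (auto simp: image_iff less_Suc_eq_0_disj)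
  moreover have "card (Suc ` ?I) = card ?I" by (intro card_image) simp
  ultimately show ?case using Cons by (simp add: card_insert_disjoint image_iff)
qed simp

lemma mem_series_positive_iff:
  "a \<in> series_positive G cs \<longleftrightarrow> (\<exists>j<length cs. infinite_factor G (cs ! j) (drop (Suc j) cs) \<and>
    (\<exists>k::int. k > 0 \<and> (\<exists>x\<in>series_span G (drop (Suc j) cs). a = cs ! j [^] k \<otimes> x)))"
proof (induction cs)
  case (Cons c cs)
  then show ?case by (auto simp: Ex_less_Suc2)
qed simp

lemma central_series_drop: "central_series G cs \<Longrightarrow> central_series G (drop j cs)"
  using central_series_appendD[of "take j cs" "drop j cs"] by simp

lemma ex_int_pos_iff: "(\<exists>k::int. k > 0 \<and> P k) \<longleftrightarrow> (\<exists>k::nat. P (int (Suc k)))"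
  by (metis of_nat_0_less_iff zero_less_Suc Suc_pred pos_int_cases)

lemma one_notin_normal_subsemigroup_iff:
  assumes nil: "nilpotent_group c G" and rs: "central_series G rs" "series_span G rs = carrier G"
    and X: "X \<subseteq> carrier G" "generate G X = carrier G"
    and S: "finite S" "S \<subseteq> carrier G"
    and h: "h = infinite_length G rs"
  shows "\<one> \<notin> normal_subsemigroup G S \<longleftrightarrow>
    (\<exists>cs f. set cs \<subseteq> carrier G \<and> positive_certificate G X S h cs f)"
proof
  assume "\<one> \<notin> normal_subsemigroup G S"
  then obtain cs where cs: "central_series G cs" "series_span G cs = carrier G" "S \<subseteq> series_positive G cs"
    using positive_series_exists[OF nil rs S normal_self] by blast
  let ?I = "{j. j < length cs \<and> infinite_factor G (cs ! j) (drop (Suc j) cs)}"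
  have "card ?I = h"
    unfolding h infinite_length_eq_card[symmetric] by (rule infinite_length_invariant[OF cs(1,2) rs])
  moreover have "finite ?I" by simp
  ultimately obtain f where f: "bij_betw f {0..<h} ?I"
    using ex_bij_betw_nat_finite by metis
  have "(\<exists>i<h. f i = j) \<longleftrightarrow> j \<in> f ` {0..<h}" for j by auto
  then have f_iff: "(\<exists>i<h. f i = j) \<longleftrightarrow> j \<in> ?I" for j
    unfolding bij_betw_imp_surj_on[OF f] .
  have csG: "set cs \<subseteq> carrier G" using set_subset_series_span[OF cs(1)] cs(2) by simp
  have gen: "generate G (set (drop j cs)) = series_span G (drop j cs)" for j
    using series_span_eq_generate[OF central_series_drop[OF cs(1)]] by simp
  have "positive_certificate G X S h cs f" unfolding positive_certificate_def
  proof (intro conjI allI impI ballI)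
    show "X \<subseteq> generate G (set cs)" using X gen[of 0] cs(2) by simp
    fix j assume j: "j < length cs"
    show "centralizes G (generate G (set (drop (Suc j) cs))) x (cs ! j)" if "x \<in> X" for x
      using central_series_iff_nth[OF X csG] cs(1) j that by blast
    show "(\<exists>i<h. f i = j) \<or> (\<exists>m::nat. cs ! j [^] Suc m \<in> generate G (set (drop (Suc j) cs)))"
    proof (cases "j \<in> ?I")
      case False
      then obtain m :: nat where m: "m > 0" "cs ! j [^] m \<in> series_span G (drop (Suc j) cs)"
        using j unfolding infinite_factor_def by blast
      obtain m' where "m = Suc m'" using gr0_implies_Suc[OF m(1)] by blast
      then show ?thesis using m(2) unfolding gen by blast
    qed (use f_iff in blast)
  next
    fix s assume "s \<in> S"
    then obtain j k x where "j < length cs" "infinite_factor G (cs ! j) (drop (Suc j) cs)"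
      "x \<in> series_span G (drop (Suc j) cs)" "s = cs ! j [^] int (Suc k) \<otimes> x"
      using cs(3) mem_series_positive_iff[of s cs] unfolding ex_int_pos_iff by blast
    then show "\<exists>j<length cs. (\<exists>i<h. f i = j) \<and>
      (\<exists>k::nat. \<exists>x\<in>generate G (set (drop (Suc j) cs)). s = cs ! j [^] Suc k \<otimes> x)"
      unfolding f_iff gen int_pow_int by blast
  qed
  with csG show "\<exists>cs f. set cs \<subseteq> carrier G \<and> positive_certificate G X S h cs f" by blast
next
  assume "\<exists>cs f. set cs \<subseteq> carrier G \<and> positive_certificate G X S h cs f"
  then obtain cs f where csG: "set cs \<subseteq> carrier G" and XC: "X \<subseteq> generate G (set cs)"
    and comm: "\<And>j x. j < length cs \<Longrightarrow> x \<in> X \<Longrightarrow>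
      centralizes G (generate G (set (drop (Suc j) cs))) x (cs ! j)"
    and fin: "\<And>j. j < length cs \<Longrightarrow> (\<exists>i<h. f i = j) \<or>
      (\<exists>m::nat. cs ! j [^] Suc m \<in> generate G (set (drop (Suc j) cs)))"
    and pos: "\<And>s. s \<in> S \<Longrightarrow> \<exists>j<length cs. (\<exists>i<h. f i = j) \<and>
      (\<exists>k::nat. \<exists>x\<in>generate G (set (drop (Suc j) cs)). s = cs ! j [^] Suc k \<otimes> x)"
    unfolding positive_certificate_def by blast
  have ser: "central_series G cs"
    unfolding central_series_iff_nth[OF X csG] using comm by blast
  have gen: "generate G (set (drop j cs)) = series_span G (drop j cs)" for j
    using series_span_eq_generate[OF central_series_drop[OF ser]] by simp
  have "generate G X \<subseteq> generate G (set cs)"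
    by (rule generate_subgroup_incl[OF XC generate_is_subgroup[OF csG]])
  then have span: "series_span G cs = carrier G"
    using X(2) series_span_subset[OF ser] gen[of 0] by auto
  let ?I = "{j. j < length cs \<and> infinite_factor G (cs ! j) (drop (Suc j) cs)}"
  have "card ?I = h"
    unfolding h infinite_length_eq_card[symmetric] by (rule infinite_length_invariant[OF ser span rs])
  moreover have "card (f ` {..<h}) \<le> h" using card_image_le[of "{..<h}" f] by simp
  moreover have "?I \<subseteq> f ` {..<h}"
  proof
    fix j assume j: "j \<in> ?I"
    then have "cs ! j [^] Suc m \<notin> generate G (set (drop (Suc j) cs))" for m :: nat
      unfolding gen infinite_factor_def by blast
    then show "j \<in> f ` {..<h}" using fin[of j] j by blast
  qed
  \<comment> \<open>A set with \<open>h\<close> elements inside an image with at most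
    \<open>h\<close> elements is the whole image, so every exhibited position is infinite.\<close>
  ultimately have I: "?I = f ` {..<h}" by (intro card_seteq) auto
  have "S \<subseteq> series_positive G cs"
  proof
    fix s assume "s \<in> S"
    from pos[OF this] obtain i j k x where j: "j < length cs" "i < h" "f i = j"
      "x \<in> series_span G (drop (Suc j) cs)" "s = cs ! j [^] Suc k \<otimes> x"
      unfolding gen by blast
    then have "j \<in> ?I" unfolding I by blast
    then show "s \<in> series_positive G cs"
      unfolding mem_series_positive_iff ex_int_pos_iff int_pow_int using j by blast
  qed
  then show "\<one> \<notin> normal_subsemigroup G S" by (rule one_notin_if_series_positive[OF ser])
qed

section \<open>Elements of a normal subsemigroup as products of conjugates\<close>

lemma list_product_closed: "set ys \<subseteq> carrier G \<Longrightarrow> foldr (\<otimes>) ys \<one> \<in> carrier G"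
  by (induction ys) auto

lemma list_product_append:
  "set ys \<subseteq> carrier G \<Longrightarrow> set zs \<subseteq> carrier G \<Longrightarrow>
    foldr (\<otimes>) (ys @ zs) \<one> = foldr (\<otimes>) ys \<one> \<otimes> foldr (\<otimes>) zs \<one>"
  by (induction ys) (auto simp: list_product_closed m_assoc)

text \<open>Unrolling the inductive definition gives a finite product that a search can guess. The
  list is nonempty because a subsemigroup need not contain the identity.\<close>

lemma mem_normal_subsemigroup_iff:
  assumes S: "S \<subseteq> carrier G"
  shows "u \<in> normal_subsemigroup G S \<longleftrightarrow>
    (\<exists>ys. ys \<noteq> [] \<and> u = foldr (\<otimes>) ys \<one> \<and> (\<forall>y\<in>set ys. \<exists>g\<in>carrier G. \<exists>s\<in>S. y = g \<otimes> s \<otimes> inv g))"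
proof
  let ?Y = "{g \<otimes> s \<otimes> inv g | g s. g \<in> carrier G \<and> s \<in> S}"
  have YG: "?Y \<subseteq> carrier G" using S by auto
  have Y: "(\<forall>y\<in>set ys. \<exists>g\<in>carrier G. \<exists>s\<in>S. y = g \<otimes> s \<otimes> inv g) \<longleftrightarrow> set ys \<subseteq> ?Y" for ys by blast
  {
    assume "u \<in> normal_subsemigroup G S"
    then have "\<exists>ys. ys \<noteq> [] \<and> u = foldr (\<otimes>) ys \<one> \<and> set ys \<subseteq> ?Y"
    proof induction
      case (incl a)
      then have "a = \<one> \<otimes> a \<otimes> inv \<one>" using S by auto
      then have "a \<in> ?Y" using incl by blast
      moreover have "a = foldr (\<otimes>) [a] \<one>" using incl S by auto
      ultimately show ?case by (intro exI[of _ "[a]"]) simp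
    next
      case (mult a b)
      then obtain ys zs where "ys \<noteq> []" "a = foldr (\<otimes>) ys \<one>" "set ys \<subseteq> ?Y"
        "b = foldr (\<otimes>) zs \<one>" "set zs \<subseteq> ?Y" by blast
      moreover have "set ys \<subseteq> carrier G" "set zs \<subseteq> carrier G" using calculation YG by blast+
      ultimately have "a \<otimes> b = foldr (\<otimes>) (ys @ zs) \<one>" "ys @ zs \<noteq> []" "set (ys @ zs) \<subseteq> ?Y"
        by (simp_all only: list_product_append set_append Un_subset_iff append_is_Nil_conv simp_thms)
      then show ?case by blast
    next
      case (conj a b)
      then obtain ys where ys: "ys \<noteq> []" "a = foldr (\<otimes>) ys \<one>" "set ys \<subseteq> ?Y" by blast
      interpret c: group_hom G G "\<lambda>y. b \<otimes> y \<otimes> inv b" by (rule conj_hom[OF conj.hyps(2)])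
      have conj_prod: "b \<otimes> foldr (\<otimes>) ys \<one> \<otimes> inv b = foldr (\<otimes>) (map (\<lambda>y. b \<otimes> y \<otimes> inv b) ys) \<one>"
        if "set ys \<subseteq> carrier G" for ys
        using that
      proof (induction ys)
        case Nil
        then show ?case using conj.hyps(2) by simp
      next
        case (Cons y ys)
        then show ?case
          using c.hom_mult[of y "foldr (\<otimes>) ys \<one>"] list_product_closed[of ys] by simp
      qed
      have ysG: "set ys \<subseteq> carrier G" using ys(3) YG by blast
      have conjY: "b \<otimes> y \<otimes> inv b \<in> ?Y" if y: "y \<in> ?Y" for y
      proof -
        obtain g s where gs: "g \<in> carrier G" "s \<in> S" "y = g \<otimes> s \<otimes> inv g" using y by blast
        then have "s \<in> carrier G" using S by blast
        then have "b \<otimes> y \<otimes> inv b = (b \<otimes> g) \<otimes> s \<otimes> inv (b \<otimes> g)"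
          using conj.hyps(2) gs by (simp add: m_assoc inv_mult_group)
        then show ?thesis using gs(2) m_closed[OF conj.hyps(2) gs(1)] by blast
      qed
      have "set (map (\<lambda>y. b \<otimes> y \<otimes> inv b) ys) \<subseteq> ?Y" unfolding set_map
        by (rule image_subsetI) (rule conjY, rule subsetD[OF ys(3)])
      moreover have "map (\<lambda>y. b \<otimes> y \<otimes> inv b) ys \<noteq> []" using ys(1) by simp
      ultimately show ?case unfolding ys(2) conj_prod[OF ysG]
        by (intro exI[of _ "map (\<lambda>y. b \<otimes> y \<otimes> inv b) ys"] conjI refl)
    qed
    then show "\<exists>ys. ys \<noteq> [] \<and> u = foldr (\<otimes>) ys \<one> \<and> (\<forall>y\<in>set ys. \<exists>g\<in>carrier G. \<exists>s\<in>S. y = g \<otimes> s \<otimes> inv g)"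
      unfolding Y .
  next
    have Yn: "?Y \<subseteq> normal_subsemigroup G S" by (auto intro: normal_subsemigroup.intros)
    have "foldr (\<otimes>) ys \<one> \<in> normal_subsemigroup G S" if "ys \<noteq> []" "set ys \<subseteq> ?Y" for ys
      using that
    proof (induction ys)
      case (Cons y ys)
      show ?case
      proof (cases "ys = []")
        case True
        have "y \<in> carrier G" using Cons.prems YG by auto
        with True show ?thesis using Cons.prems Yn by auto
      next
        case False
        then have "foldr (\<otimes>) ys \<one> \<in> normal_subsemigroup G S" using Cons by auto
        moreover have "y \<in> normal_subsemigroup G S" using Cons.prems Yn by auto
        ultimately show ?thesis by (simp add: normal_subsemigroup.mult)
      qed
    qed simp
    moreover assume "\<exists>ys. ys \<noteq> [] \<and> u = foldr (\<otimes>) ys \<one> \<and> (\<forall>y\<in>set ys. \<exists>g\<in>carrier G. \<exists>s\<in>S. y = g \<otimes> s \<otimes> inv g)"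
    ultimately show "u \<in> normal_subsemigroup G S" unfolding Y by blast
  }
qed

end

section \<open>Coded instances and the evaluation of coded words\<close>

definition decode_instance :: "nat \<Rightarrow> group_word list" where
  "decode_instance n = map (\<lambda>w. map sum_decode (list_decode w)) (list_decode n)"

lemma instance_code_decode [simp]: "instance_code (decode_instance n) = n"
  by (simp add: instance_code_def decode_instance_def comp_def)

text \<open>\<open>instance_code\<close> is a bijection, so the membership of a number in either
  problem concerns exactly one list of words.\<close>

lemma decode_instance_code: "n = instance_code ws \<longleftrightarrow> ws = decode_instance n"
  using inj_instance_code instance_code_decode by (metis injD)

text \<open>Half of the code, rounded down, is the index of the generator; the parity tells a
  generator from an inverse.\<close>

lemma sum_decode_in_letters: "sum_decode x \<in> {..<r} <+> {..<r} \<longleftrightarrow> x div 2 < r"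
  by (auto simp: sum_decode_def)

lemma decode_instance_words_over: "set (decode_instance n) \<subseteq> words_over r \<longleftrightarrow>
    (\<forall>w\<in>set (list_decode n). \<forall>x\<in>set (list_decode w). x div 2 < r)"
  by (simp add: decode_instance_def words_over_def lists_eq_set image_subset_iff sum_decode_in_letters)

text \<open>\<open>l\<close> codes a list of codes of group elements. Indices beyond its length
  evaluate to \<open>e\<close>, later the code of the identity, so every number denotes a word and a
  search may range over all numbers.\<close>

definition code_letter :: "nat \<Rightarrow> (nat \<Rightarrow> nat) \<Rightarrow> nat \<Rightarrow> nat \<Rightarrow> nat" where
  "code_letter e \<iota> l x = (if x div 2 < length (list_decode l)
     then (if x mod 2 = 0 then code_nth l (x div 2) else \<iota> (code_nth l (x div 2))) else e)"

definition code_word :: "nat \<Rightarrow> (nat \<Rightarrow> nat \<Rightarrow> nat) \<Rightarrow> (nat \<Rightarrow> nat) \<Rightarrow> nat \<Rightarrow> nat \<Rightarrow> nat" where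
  "code_word e \<mu> \<iota> l w = fold (\<lambda>x a. \<mu> a (code_letter e \<iota> l x)) (list_decode w) e"

lemma computable_code_word:
  assumes "computable (\<lambda>m. \<mu> (pfst m) (psnd m))" "computable \<iota>" "computable a" "computable b"
  shows "computable (\<lambda>n. code_word e \<mu> \<iota> (a n) (b n))"
  unfolding code_word_def code_letter_def
  by (intro computable_fold computable_comp2[OF assms(1)] computable_if decidable_less decidable_eq
      computable_div_mod computable_length computable_code_nth computable_compose[OF assms(2)]
      computable_compose[OF assms(3)] computable_compose[OF assms(4)] assms(4)
      computable_pfst computable_psnd computable_id computable_const)

context group begin

text \<open>\<open>T n\<close> is a finite set of group elements for every number \<open>n\<close>,
  also when a letter is out of range; the legitimacy of \<open>n\<close> as an instance can thus be
  tested separately.\<close>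

lemma decidable_one_mem_normal_subsemigroup:
  assumes nil: "nilpotent_group c G" and X: "set xs \<subseteq> carrier G" "generate G (set xs) = carrier G"
  shows "\<exists>T. decidable (\<lambda>n. \<one> \<in> normal_subsemigroup G (T n)) \<and>
    (\<forall>n. set (decode_instance n) \<subseteq> words_over (length xs) \<longrightarrow>
      T n = word_value G xs ` set (decode_instance n))"
proof -
  obtain rs where rs: "central_series G rs" "series_span G rs = carrier G"
    using nilpotent_central_series[OF nil X(1) finite_set X(2)] by blast
  define \<nu> where "\<nu> = series_numbering G rs"
  have num: "computable_numbering G (carrier G) \<nu>"
    using computable_series_numbering[OF rs(1)] rs(2) by (simp add: \<nu>_def)
  have range: "range \<nu> = carrier G" using num by (simp add: computable_numbering_def)
  have \<nu>G [simp]: "\<nu> n \<in> carrier G" for n using range by blast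
  obtain \<mu> where \<mu>: "computable (\<lambda>m. \<mu> (pfst m) (psnd m))" "\<And>a b. \<nu> (\<mu> a b) = \<nu> a \<otimes> \<nu> b"
    using num unfolding computable_numbering_def by blast
  obtain \<iota> where \<iota>: "computable \<iota>" "\<And>a. \<nu> (\<iota> a) = inv \<nu> a"
    using num unfolding computable_numbering_def by blast
  obtain \<pi> where \<pi>: "computable (\<lambda>m. \<pi> (pfst m) (psnd m))" "\<And>a k. \<nu> (\<pi> a k) = \<nu> a [^] (k::nat)"
    using computable_numbering_pow[OF num subgroup_self] by blast
  have dec: "decidable (\<lambda>m. \<nu> (pfst m) = \<nu> (psnd m))"
    using num by (simp add: computable_numbering_def)
  have ex_code: "\<exists>n. a = \<nu> n" if "a \<in> carrier G" for a using range that by (metis imageE)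
  obtain e where e: "\<nu> e = \<one>" using ex_code[OF one_closed] by metis
  \<comment> \<open>Quantification over finite lists of group elements thereby becomes
    quantification over numbers.\<close>
  have ex_list: "\<exists>l. as = map \<nu> (list_decode l)" if as: "set as \<subseteq> carrier G" for as
  proof -
    obtain g where "\<And>a. a \<in> carrier G \<Longrightarrow> a = \<nu> (g a)" using ex_code by metis
    then have "as = map \<nu> (list_decode (list_encode (map g as)))"
      using as by (auto simp: map_idI comp_def subset_iff intro!: map_idI[symmetric])
    then show ?thesis by blast
  qed
  define V where "V = code_word e \<mu> \<iota>"
  have cV: "computable (\<lambda>n. V (a n) (b n))" if "computable a" "computable b" for a b
    unfolding V_def by (rule computable_code_word[OF \<mu>(1) \<iota>(1) that])
  \<comment> \<open>The program accumulates from the left while products are right folds;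
    associativity identifies the two.\<close>
  have \<nu>_fold: "\<nu> (fold (\<lambda>x a. \<mu> a (g x)) ys a) = \<nu> a \<otimes> foldr (\<otimes>) (map (\<lambda>x. \<nu> (g x)) ys) \<one>"
    for g :: "nat \<Rightarrow> nat" and ys a
    by (induction ys arbitrary: a) (simp_all add: \<mu>(2) m_assoc list_product_closed image_subset_iff)
  have \<nu>V: "\<nu> (V l w) = foldr (\<otimes>) (map (\<lambda>x. \<nu> (code_letter e \<iota> l x)) (list_decode w)) \<one>" for l w
    unfolding V_def code_word_def \<nu>_fold by (simp add: e list_product_closed image_subset_iff)
  have letter_in: "\<nu> (code_letter e \<iota> l x) \<in> generate G (\<nu> ` set (list_decode l))" for l x
    by (auto simp: code_letter_def code_nth_list_decode \<iota>(2) e intro: generate.intros)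
  have V_in: "\<nu> (V l w) \<in> generate G (\<nu> ` set (list_decode l))" for l w
  proof -
    have "foldr (\<otimes>) (map (\<lambda>x. \<nu> (code_letter e \<iota> l x)) ys) \<one> \<in> generate G (\<nu> ` set (list_decode l))" for ys
      by (induction ys) (auto intro: generate.one generate.eng letter_in)
    then show ?thesis unfolding \<nu>V .
  qed
  have V_surj: "\<exists>w. a = \<nu> (V l w)" if "a \<in> generate G (\<nu> ` set (list_decode l))" for a l
    using that
  proof induction
    case one
    have "\<one> = \<nu> (V l (list_encode []))" unfolding \<nu>V by (simp add: list_decode.simps(1))
    then show ?case by blast
  next
    case (incl a)
    then obtain i where i: "i < length (list_decode l)" "a = \<nu> (list_decode l ! i)"
      by (auto simp: in_set_conv_nth)
    then have "a = \<nu> (V l (list_encode [2 * i]))"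
      unfolding \<nu>V list_encode_inverse by (simp add: code_letter_def code_nth_list_decode)
    then show ?case by blast
  next
    case (inv a)
    then obtain i where i: "i < length (list_decode l)" "a = \<nu> (list_decode l ! i)"
      by (auto simp: in_set_conv_nth)
    then have "inv a = \<nu> (V l (list_encode [Suc (2 * i)]))"
      unfolding \<nu>V list_encode_inverse by (simp add: code_letter_def code_nth_list_decode \<iota>(2))
    then show ?case by blast
  next
    case (eng a b)
    then obtain v w where "a = \<nu> (V l v)" "b = \<nu> (V l w)" by blast
    then have "a \<otimes> b = \<nu> (V l (list_encode (list_decode v @ list_decode w)))"
      unfolding \<nu>V list_encode_inverse map_append
      by (subst list_product_append) auto
    then show ?case by blast
  qed
  \<comment> \<open>This is what turns membership in a finitely generated subgroup into an
    existential statement about codes.\<close>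
  have gen_iff: "a \<in> generate G (\<nu> ` set (list_decode l)) \<longleftrightarrow> (\<exists>w. a = \<nu> (V l w))" for a l
    using V_in V_surj by blast
  \<comment> \<open>\<open>x\<close> codes the fixed generating list and is, like \<open>h\<close>
    below, a constant of the program.\<close>
  obtain x where x: "xs = map \<nu> (list_decode x)" using ex_list[OF X(1)] by blast
  define T where "T n = (\<lambda>w. \<nu> (V x w)) ` set (list_decode n)" for n
  have T: "finite (T n)" "T n \<subseteq> carrier G" for n by (auto simp: T_def)
  have T_eq: "T n = word_value G xs ` set (decode_instance n)"
    if "set (decode_instance n) \<subseteq> words_over (length xs)" for n
  proof -
    have "\<nu> (V x w) = word_value G xs (map sum_decode (list_decode w))" if w: "w \<in> set (list_decode n)" for w
    proof -
      have letters: "y div 2 < length (list_decode x)" if "y \<in> set (list_decode w)" for y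
        using that w \<open>set (decode_instance n) \<subseteq> words_over (length xs)\<close>
        unfolding decode_instance_words_over x by simp
      have "letter_value G xs (sum_decode y) = \<nu> (code_letter e \<iota> x y)" if "y \<in> set (list_decode w)" for y
        using letters[OF that]
        by (simp add: x sum_decode_def code_letter_def code_nth_list_decode \<iota>(2) even_iff_mod_2_eq_zero)
      then have "word_value G xs (map sum_decode ys) = foldr (\<otimes>) (map (\<lambda>y. \<nu> (code_letter e \<iota> x y)) ys) \<one>"
        if "set ys \<subseteq> set (list_decode w)" for ys
        using that by (induction ys) (auto simp: word_value_def)
      then show ?thesis unfolding \<nu>V by simp
    qed
    then show ?thesis by (simp add: T_def decode_instance_def image_image)
  qed
  define h where "h = infinite_length G rs"
  \<comment> \<open>\<open>l\<close> codes a nonempty list of elements; each is recognised as a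
    conjugate of an element of \<open>T n\<close>, and their product as the identity.\<close>
  have yes: "\<one> \<in> normal_subsemigroup G (T n) \<longleftrightarrow> (\<exists>l. 0 < length (list_decode l) \<and>
      \<nu> (fold (\<lambda>y a. \<mu> a y) (list_decode l) e) = \<nu> e \<and>
      (\<forall>y\<in>set (list_decode l). \<exists>g. \<exists>w\<in>set (list_decode n). \<nu> y = \<nu> (\<mu> (\<mu> g (V x w)) (\<iota> g))))" for n
  proof -
    have "(\<exists>ys. ys \<noteq> [] \<and> \<one> = foldr (\<otimes>) ys \<one> \<and> (\<forall>y\<in>set ys. \<exists>g\<in>carrier G. \<exists>s\<in>T n. y = g \<otimes> s \<otimes> inv g)) \<longleftrightarrow>
      (\<exists>l. list_decode l \<noteq> [] \<and> \<one> = foldr (\<otimes>) (map \<nu> (list_decode l)) \<one> \<and>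
        (\<forall>y\<in>set (map \<nu> (list_decode l)). \<exists>g\<in>carrier G. \<exists>s\<in>T n. y = g \<otimes> s \<otimes> inv g))" (is "?L \<longleftrightarrow> ?R")
    proof
      assume ?L
      then obtain ys where ys: "ys \<noteq> []" "\<one> = foldr (\<otimes>) ys \<one>"
        "\<forall>y\<in>set ys. \<exists>g\<in>carrier G. \<exists>s\<in>T n. y = g \<otimes> s \<otimes> inv g" by blast
      then have "set ys \<subseteq> carrier G" using T(2) by fastforce
      then obtain l where "ys = map \<nu> (list_decode l)" using ex_list by blast
      with ys show ?R by auto
    next
      assume ?R
      then obtain l where "map \<nu> (list_decode l) \<noteq> []" "\<one> = foldr (\<otimes>) (map \<nu> (list_decode l)) \<one>"
        "\<forall>y\<in>set (map \<nu> (list_decode l)). \<exists>g\<in>carrier G. \<exists>s\<in>T n. y = g \<otimes> s \<otimes> inv g" by auto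
      then show ?L by blast
    qed
    moreover have "(\<exists>g\<in>carrier G. \<exists>s\<in>T n. \<nu> y = g \<otimes> s \<otimes> inv g) \<longleftrightarrow>
        (\<exists>g. \<exists>w\<in>set (list_decode n). \<nu> y = \<nu> (\<mu> (\<mu> g (V x w)) (\<iota> g)))" for y
      unfolding range[symmetric] T_def by (simp add: \<mu>(2) \<iota>(2))
    moreover have "\<nu> (fold (\<lambda>y a. \<mu> a y) ys e) = foldr (\<otimes>) (map \<nu> ys) \<one>" for ys
      unfolding \<nu>_fold by (simp add: e list_product_closed image_subset_iff)
    ultimately show ?thesis unfolding mem_normal_subsemigroup_iff[OF T(2)]
      by (simp add: e eq_commute[of \<one>])
  qed
  \<comment> \<open>The clauses of the certificate on codes: \<open>l\<close> is the series,
    \<open>code_drop\<close> gives its lower terms and \<open>f\<close> lists the exhibited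
    positions. Every unbounded quantifier is existential; the universal ones are bounded by a coded
    list.\<close>
  have no: "\<one> \<notin> normal_subsemigroup G (T n) \<longleftrightarrow> (\<exists>l f.
      (\<forall>y\<in>set (list_decode x). \<exists>w. \<nu> y = \<nu> (V l w)) \<and>
      (\<forall>j<length (list_decode l).
        (\<forall>y\<in>set (list_decode x). \<exists>w.
          \<nu> (\<mu> (\<mu> (\<mu> y (code_nth l j)) (\<iota> y)) (\<iota> (code_nth l j))) = \<nu> (V (code_drop l (Suc j)) w)) \<and>
        ((\<exists>i. i < h \<and> code_nth f i = j) \<or>
          (\<exists>m w. \<nu> (\<pi> (code_nth l j) (Suc m)) = \<nu> (V (code_drop l (Suc j)) w)))) \<and>
      (\<forall>s\<in>set (list_decode n). \<exists>j. j < length (list_decode l) \<and> (\<exists>i. i < h \<and> code_nth f i = j) \<and>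
        (\<exists>k w. \<nu> (V x s) = \<nu> (\<mu> (\<pi> (code_nth l j) (Suc k)) (V (code_drop l (Suc j)) w)))))"
    (is "_ \<longleftrightarrow> (\<exists>l f. ?D l f)") for n
  proof -
    let ?C = "positive_certificate G (set xs) (T n) h"
    have C_D: "?C (map \<nu> (list_decode l)) (code_nth f) \<longleftrightarrow> ?D l f" for l f
    proof -
      let ?cs = "map \<nu> (list_decode l)"
      have drop: "set (drop (Suc j) ?cs) = \<nu> ` set (list_decode (code_drop l (Suc j)))" for j
        by (simp add: drop_map list_decode_code_drop)
      have nth: "?cs ! j = \<nu> (code_nth l j)" if "j < length (list_decode l)" for j
        using that by (simp add: code_nth_list_decode)
      have 1: "set xs \<subseteq> generate G (set ?cs) \<longleftrightarrow> (\<forall>y\<in>set (list_decode x). \<exists>w. \<nu> y = \<nu> (V l w))"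
        unfolding set_map gen_iff[symmetric] x by blast
      have 2: "(\<forall>y\<in>set xs. centralizes G (generate G (set (drop (Suc j) ?cs))) y (?cs ! j)) \<longleftrightarrow>
        (\<forall>y\<in>set (list_decode x). \<exists>w.
          \<nu> (\<mu> (\<mu> (\<mu> y (code_nth l j)) (\<iota> y)) (\<iota> (code_nth l j))) = \<nu> (V (code_drop l (Suc j)) w))"
        if "j < length (list_decode l)" for j
        unfolding centralizes_def drop gen_iff nth[OF that] by (simp add: x \<mu>(2) \<iota>(2))
      have 3: "(\<exists>m::nat. ?cs ! j [^] Suc m \<in> generate G (set (drop (Suc j) ?cs))) \<longleftrightarrow>
        (\<exists>m w. \<nu> (\<pi> (code_nth l j) (Suc m)) = \<nu> (V (code_drop l (Suc j)) w))"
        if "j < length (list_decode l)" for j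
        unfolding drop gen_iff nth[OF that] \<pi>(2) ..
      have 4: "(\<exists>k::nat. \<exists>x\<in>generate G (set (drop (Suc j) ?cs)). s = ?cs ! j [^] Suc k \<otimes> x) \<longleftrightarrow>
        (\<exists>k w. s = \<nu> (\<mu> (\<pi> (code_nth l j) (Suc k)) (V (code_drop l (Suc j)) w)))"
        if "j < length (list_decode l)" for j s
        unfolding drop Bex_def gen_iff nth[OF that] \<pi>(2) \<mu>(2) by blast
      show ?thesis unfolding positive_certificate_def 1 T_def ball_simps length_map using 2 3 4 by (simp cong: conj_cong)
    qed
    have "\<one> \<notin> normal_subsemigroup G (T n) \<longleftrightarrow> (\<exists>cs f. set cs \<subseteq> carrier G \<and> ?C cs f)"
      by (rule one_notin_normal_subsemigroup_iff[OF nil rs X T h_def])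
    also have "\<dots> \<longleftrightarrow> (\<exists>l f. ?C (map \<nu> (list_decode l)) (code_nth f))"
    proof
      assume "\<exists>cs f. set cs \<subseteq> carrier G \<and> ?C cs f"
      then obtain cs f where cs: "set cs \<subseteq> carrier G" "?C cs f" by blast
      obtain l where l: "cs = map \<nu> (list_decode l)" using ex_list[OF cs(1)] by blast
      \<comment> \<open>Only the first \<open>h\<close> values of \<open>f\<close> occur in the
        certificate, so an arbitrary function may be replaced by a coded list.\<close>
      obtain g where "\<forall>i<h. code_nth g i = f i" using ex_code_nth by blast
      then have "(\<exists>i<h. code_nth g i = j) \<longleftrightarrow> (\<exists>i<h. f i = j)" for j by auto
      then have "?C cs (code_nth g)" using cs(2) unfolding positive_certificate_def by simp
      then show "\<exists>l f. ?C (map \<nu> (list_decode l)) (code_nth f)" unfolding l by blast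
    next
      assume "\<exists>l f. ?C (map \<nu> (list_decode l)) (code_nth f)"
      moreover have "set (map \<nu> (list_decode l)) \<subseteq> carrier G" for l by auto
      ultimately show "\<exists>cs f. set cs \<subseteq> carrier G \<and> ?C cs f" by blast
    qed
    finally show ?thesis unfolding C_D .
  qed
  note computable_rules = computable_comp2[OF \<mu>(1)] computable_comp2[OF \<pi>(1)]
    computable_compose[OF \<iota>(1)] cV computable_code_nth computable_code_drop computable_length
    computable_Suc computable_pfst computable_psnd computable_id computable_const
  note semidecidable_rules = semidecidable_ex semidecidable_conj semidecidable_disj
    semidecidable_all_set semidecidable_ex_set semidecidable_all_less
    semidecidable_decidable[OF decidable_less] semidecidable_decidable[OF decidable_eq]
    semidecidable_decidable[OF decidable_comp2[OF dec]]
  have "semidecidable (\<lambda>n. \<one> \<in> normal_subsemigroup G (T n))"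
    unfolding yes by (intro semidecidable_rules computable_fold computable_rules)
  moreover have "semidecidable (\<lambda>n. \<one> \<notin> normal_subsemigroup G (T n))"
    unfolding no by (intro semidecidable_rules computable_rules)
  ultimately have "decidable (\<lambda>n. \<one> \<in> normal_subsemigroup G (T n))"
    by (rule decidable_if_semidecidable)
  then show ?thesis using T_eq by blast
qed

end

text \<open>Both problems reduce to one decidable question, whether the identity lies in the normal
  subsemigroup of the decoded words, combined with the test that all letters are in range.\<close>

theorem corollary15:
  fixes G :: "('a, 'b) monoid_scheme" and xs :: "'a list" and c :: nat
  assumes "c \<ge> 1"
    and "free_nilpotent_group c G (set xs)"
    and "distinct xs"
  shows "decidable_set (normal_identity_problem G xs) \<and>
         decidable_set (bi_order_extension_problem G xs)"
proof -
  have nil: "nilpotent_group c G" and X: "set xs \<subseteq> carrier G" "generate G (set xs) = carrier G"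
    using assms(2) by (auto simp: free_nilpotent_group_def)
  interpret group G using nil by (simp add: nilpotent_group_def)
  obtain T where T: "decidable (\<lambda>n. \<one>\<^bsub>G\<^esub> \<in> normal_subsemigroup G (T n))"
    "\<And>n. set (decode_instance n) \<subseteq> words_over (length xs) \<Longrightarrow>
      T n = word_value G xs ` set (decode_instance n)"
    using decidable_one_mem_normal_subsemigroup[OF nil X] by blast
  have valid: "decidable (\<lambda>n. set (decode_instance n) \<subseteq> words_over (length xs))"
    unfolding decode_instance_words_over
    by (intro decidable_all_set decidable_less computable_div_mod computable_psnd computable_id computable_const)
  have closed: "word_value G xs ` set (decode_instance n) \<subseteq> carrier G"
    if "set (decode_instance n) \<subseteq> words_over (length xs)" for n
  proof -
    have "letter_value G xs l \<in> carrier G" if "l \<in> {..<length xs} <+> {..<length xs}" for l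
      using that X(1) nth_mem by fastforce
    then have "word_value G xs w \<in> carrier G" if "w \<in> words_over (length xs)" for w
      using that unfolding words_over_def by (induction w) (auto simp: word_value_def)
    then show ?thesis using that by blast
  qed
  have "decidable (\<lambda>n. n \<in> normal_identity_problem G xs)"
  proof -
    have "n \<in> normal_identity_problem G xs \<longleftrightarrow>
        set (decode_instance n) \<subseteq> words_over (length xs) \<and> \<one>\<^bsub>G\<^esub> \<in> normal_subsemigroup G (T n)" for n
      unfolding normal_identity_problem_def mem_Collect_eq decode_instance_code using T(2) by metis
    then show ?thesis using decidable_conj[OF valid T(1)] by simp
  qed
  moreover have "decidable (\<lambda>n. n \<in> bi_order_extension_problem G xs)"
  \<comment> \<open>Decidability asserts that some program exists, so the distinction is made
    outside the program: either the complement of the first answer or constant rejection is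
    correct.\<close>
  proof (cases "torsion_free G")
    case True
    have "n \<in> bi_order_extension_problem G xs \<longleftrightarrow>
        set (decode_instance n) \<subseteq> words_over (length xs) \<and> \<one>\<^bsub>G\<^esub> \<notin> normal_subsemigroup G (T n)" for n
      unfolding bi_order_extension_problem_def mem_Collect_eq decode_instance_code
      using T(2)[of n] bi_order_extension_iff[OF nil True closed[of n]] by metis
    then show ?thesis using decidable_conj[OF valid decidable_not[OF T(1)]] by simp
  next
    case False
    then have "n \<notin> bi_order_extension_problem G xs" for n
      using torsion_free_if_bi_order unfolding bi_order_extension_problem_def by blast
    moreover have "decidable (\<lambda>_. False)" by (rule decidableI[OF computable_const[of 1]]) simp
    ultimately show ?thesis by simp
  qed
  ultimately show ?thesis by (blast intro: decidable_set_if_decidable)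
qed

end
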